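(* Let $A^+,A^-$ be a pair of marked non-synchronized finite sets on coordinate circles $\mathbb R/\mathbb Z$. Then there exists a vector field $v$ of class $PC$ on $S^2$ such that $A^{+},A^-$ (as marked sets) are the characteristic sets $A^+(v),A^-(v)$ of $v$.
   Context: Vector fields are $C^\infty$ vector fields on the oriented sphere $S^2$ with isolated singular points. Class $PC$: $v$ is of class $PC$ if it has a limit cycle $\gamma$ that is parabolic of multiplicity 2, i.e. its Poincaré map has the form $x\mapsto x+ax^2+\dots$, $a\neq 0$; all singular points and all limit cycles other than $\gamma$ are hyperbolic; and $v$ has no saddle connections. Marked sets: an equivalence relation on a finite subset of an oriented circle is proper if each class consists of one or two points, and any two two-point classes $\{a,b\}$, $\{c,d\}$ are not intermingled: either both $c,d$ belong to the oriented arc from $a$ to $b$, or neither does. A finite set on a circle with a proper equivalence relation is called marked. Non-synchronized: finite sets $A^+,A^-\subset \mathbb R/\mathbb Z$ are non-synchronized if $\#\big((A^++\alpha)\cap A^-\big)\le 1$ for every $\alpha\in\mathbb R$. Characteristic sets of $v\in PC$: let $\Gamma$ be a cross-section to $\gamma$ with a smooth chart $x$, $x(\gamma\cap\Gamma)=0$, in which the Poincaré map is $P(x)=x+x^2+\dots$. There is a unique germ of $C^\infty$ vector field $u(x)=x^2+\dots$ at $0$ whose time-one flow map is $P$ (Takens). Let $\Gamma^+=\{x\ge0\}$, $\Gamma^-=\{x\le 0\}$; fix small $b^-<0<b^+$ and set $T^\pm(b)=\int_{b^\pm}^b \frac{dx}{u(x)}$ for $b\in\Gamma^\pm\setminus\{0\}$.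 Then $T^\pm(P(x))=T^\pm(x)+1$, so the set of orbits of $P$ on $\Gamma^\pm\setminus\{0\}$ is a coordinate circle $S^1_\pm=\mathbb R/\mathbb Z$ with coordinate $T^\pm \pmod{\mathbb Z}$, well defined up to an additive constant (depending on the choice of $b^\pm$). Let $D^\pm$ be the set of intersection points with the half-open segment $[b^\pm,P(b^\pm))$ of the separatrices of hyperbolic saddles of $v$ that wind towards $\gamma$ in positive or negative time, and $A^\pm(v)=T^\pm(D^\pm)\pmod{\mathbb Z}\subset S^1_\pm$. Two points of $A^+(v)$ (respectively of $A^-(v)$) are declared equivalent if they come from separatrices of the same saddle; with this relation $A^\pm(v)$ are marked sets, called the characteristic sets of $v$; they are defined modulo additive constants. *)

theory Defs
  imports "HOL-Analysis.Analysis" "HOL-Library.Landau_Symbols"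
begin

section \<open>Marked sets on the coordinate circle\<close>

text \<open>A point of the circle \<open>\<real>/\<int>\<close> is given by its representative in \<open>[0,1)\<close>, so that
  \<^term>\<open>frac\<close> is the quotient map from the reals.\<close>

definition rotate_circle :: "real \<Rightarrow> real \<Rightarrow> real" where
  "rotate_circle \<alpha> x = frac (x + \<alpha>)"

text \<open>The closed arc from \<open>a\<close> to \<open>b\<close> in the positive direction.\<close>

definition oriented_arc :: "real \<Rightarrow> real \<Rightarrow> real set" where
  "oriented_arc a b = {x \<in> {0..<1}. frac (x - a) \<le> frac (b - a)}"

text \<open>Two distinct classes are disjoint, hence including the endpoints in the arc is harmless;
  it also makes the condition hold trivially when the two classes coincide.\<close>

definition proper_equiv :: "real set \<Rightarrow> real rel \<Rightarrow> bool" where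
  "proper_equiv A E \<longleftrightarrow>
     equiv A E \<and>
     (\<forall>C\<in>A // E. card C = 1 \<or> card C = 2) \<and>
     (\<forall>a b c d. a \<noteq> b \<and> c \<noteq> d \<and> {a, b} \<in> A // E \<and> {c, d} \<in> A // E \<longrightarrow>
        (c \<in> oriented_arc a b \<longleftrightarrow> d \<in> oriented_arc a b))"

definition marked_set :: "real set \<Rightarrow> real rel \<Rightarrow> bool" where
  "marked_set A E \<longleftrightarrow> finite A \<and> A \<subseteq> {0..<1} \<and> proper_equiv A E"

definition non_synchronized :: "real set \<Rightarrow> real set \<Rightarrow> bool" where
  "non_synchronized Ap Am \<longleftrightarrow> (\<forall>\<alpha>. card (rotate_circle \<alpha> ` Ap \<inter> Am) \<le> 1)"

definition equal_mod_rotation ::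
    "real set \<Rightarrow> real rel \<Rightarrow> real set \<Rightarrow> real rel \<Rightarrow> bool" where
  "equal_mod_rotation A E B F \<longleftrightarrow>
     (\<exists>c. B = rotate_circle c ` A \<and> F = map_prod (rotate_circle c) (rotate_circle c) ` E)"


section \<open>Smooth vector fields on the sphere and their trajectories\<close>

text \<open>\<open>C\<^sup>k\<close> and \<open>C\<^sup>\<infinity>\<close> functions on an open set \<open>S\<close>, by iterated partial derivatives.\<close>

primrec Ck_on :: "nat \<Rightarrow> 'a::euclidean_space set \<Rightarrow> ('a \<Rightarrow> 'b::real_normed_vector) \<Rightarrow> bool" where
  "Ck_on 0 S f \<longleftrightarrow> continuous_on S f"
| "Ck_on (Suc k) S f \<longleftrightarrow>
     (\<forall>x\<in>S. f differentiable (at x)) \<and>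
     (\<forall>i\<in>Basis. Ck_on k S (\<lambda>x. frechet_derivative f (at x) i))"

definition smooth_on :: "'a::euclidean_space set \<Rightarrow> ('a \<Rightarrow> 'b::real_normed_vector) \<Rightarrow> bool" where
  "smooth_on S f \<longleftrightarrow> (\<forall>k. Ck_on k S f)"

abbreviation S2 :: "(real^3) set" where
  "S2 \<equiv> sphere 0 1"

definition singular_points :: "(real^3 \<Rightarrow> real^3) \<Rightarrow> (real^3) set" where
  "singular_points v = {p \<in> S2. v p = 0}"

text \<open>Only the values of \<open>v\<close> on the sphere matter; there, smoothness means that \<open>v\<close> extends
  smoothly to a neighbourhood of the sphere.\<close>

definition sphere_vector_field :: "(real^3 \<Rightarrow> real^3) \<Rightarrow> bool" where
  "sphere_vector_field v \<longleftrightarrow>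
     (\<exists>U V. open U \<and> S2 \<subseteq> U \<and> smooth_on U V \<and> (\<forall>x\<in>S2. V x = v x)) \<and>
     (\<forall>x\<in>S2. v x \<bullet> x = 0) \<and>
     (\<forall>p\<in>singular_points v. \<not> p islimpt singular_points v)"

definition trajectory :: "(real^3 \<Rightarrow> real^3) \<Rightarrow> (real \<Rightarrow> real^3) \<Rightarrow> bool" where
  "trajectory v \<phi> \<longleftrightarrow> (\<forall>t. \<phi> t \<in> S2 \<and> (\<phi> has_vector_derivative v (\<phi> t)) (at t))"


section \<open>Singular points, separatrices and saddle connections\<close>

text \<open>\<open>z\<close> is an eigenvalue of the linear part of \<open>v\<close> at the singular point \<open>p\<close>, acting on the
  complexified tangent plane, with eigenvector \<open>a + \<i> b\<close>.  A derivative of \<open>v\<close> within the sphere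
  is uniquely determined on tangent vectors.\<close>

definition linear_part_eigenvalue :: "(real^3 \<Rightarrow> real^3) \<Rightarrow> real^3 \<Rightarrow> complex \<Rightarrow> bool" where
  "linear_part_eigenvalue v p z \<longleftrightarrow>
     (\<exists>L a b. (v has_derivative L) (at p within S2) \<and>
        a \<bullet> p = 0 \<and> b \<bullet> p = 0 \<and> (a \<noteq> 0 \<or> b \<noteq> 0) \<and>
        L a = Re z *\<^sub>R a - Im z *\<^sub>R b \<and>
        L b = Im z *\<^sub>R a + Re z *\<^sub>R b)"

definition hyperbolic_singular_point :: "(real^3 \<Rightarrow> real^3) \<Rightarrow> real^3 \<Rightarrow> bool" where
  "hyperbolic_singular_point v p \<longleftrightarrow>
     p \<in> singular_points v \<and> (\<forall>z. linear_part_eigenvalue v p z \<longrightarrow> Re z \<noteq> 0)"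

definition hyperbolic_saddle :: "(real^3 \<Rightarrow> real^3) \<Rightarrow> real^3 \<Rightarrow> bool" where
  "hyperbolic_saddle v p \<longleftrightarrow>
     p \<in> singular_points v \<and>
     (\<exists>c d::real. c < 0 \<and> 0 < d \<and>
        linear_part_eigenvalue v p (of_real c) \<and> linear_part_eigenvalue v p (of_real d))"

definition stable_separatrix :: "(real^3 \<Rightarrow> real^3) \<Rightarrow> real^3 \<Rightarrow> (real \<Rightarrow> real^3) \<Rightarrow> bool" where
  "stable_separatrix v p \<phi> \<longleftrightarrow>
     hyperbolic_saddle v p \<and> trajectory v \<phi> \<and> \<phi> 0 \<noteq> p \<and> (\<phi> \<longlongrightarrow> p) at_top"

definition unstable_separatrix :: "(real^3 \<Rightarrow> real^3) \<Rightarrow> real^3 \<Rightarrow> (real \<Rightarrow> real^3) \<Rightarrow> bool" where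
  "unstable_separatrix v p \<phi> \<longleftrightarrow>
     hyperbolic_saddle v p \<and> trajectory v \<phi> \<and> \<phi> 0 \<noteq> p \<and> (\<phi> \<longlongrightarrow> p) at_bot"

definition saddle_connection :: "(real^3 \<Rightarrow> real^3) \<Rightarrow> (real \<Rightarrow> real^3) \<Rightarrow> bool" where
  "saddle_connection v \<phi> \<longleftrightarrow> (\<exists>p q. unstable_separatrix v p \<phi> \<and> stable_separatrix v q \<phi>)"


section \<open>Limit cycles and Poincare maps\<close>

definition closed_orbit :: "(real^3 \<Rightarrow> real^3) \<Rightarrow> (real^3) set \<Rightarrow> bool" where
  "closed_orbit v \<gamma> \<longleftrightarrow>
     (\<exists>\<phi> \<tau>. trajectory v \<phi> \<and> 0 < \<tau> \<and> (\<forall>t. \<phi> (t + \<tau>) = \<phi> t) \<and> v (\<phi> 0) \<noteq> 0 \<and> \<gamma> = range \<phi>)"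

definition limit_cycle :: "(real^3 \<Rightarrow> real^3) \<Rightarrow> (real^3) set \<Rightarrow> bool" where
  "limit_cycle v \<gamma> \<longleftrightarrow>
     closed_orbit v \<gamma> \<and>
     (\<exists>U. open U \<and> \<gamma> \<subseteq> U \<and> (\<forall>\<gamma>'. closed_orbit v \<gamma>' \<and> \<gamma>' \<subseteq> U \<longrightarrow> \<gamma>' = \<gamma>))"

text \<open>The cross-section is the arc \<open>\<Gamma> = \<sigma> ` {l..r}\<close>; its chart \<open>x\<close> is the inverse of \<open>\<sigma>\<close>.\<close>

definition cross_section ::
    "(real^3 \<Rightarrow> real^3) \<Rightarrow> (real^3) set \<Rightarrow> (real \<Rightarrow> real^3) \<Rightarrow> real \<Rightarrow> real \<Rightarrow> bool" where
  "cross_section v \<gamma> \<sigma> l r \<longleftrightarrow>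
     l < 0 \<and> 0 < r \<and>
     (\<exists>U. open U \<and> {l..r} \<subseteq> U \<and> smooth_on U \<sigma>) \<and>
     inj_on \<sigma> {l..r} \<and>
     (\<forall>s\<in>{l..r}. \<sigma> s \<in> S2 \<and>
        cross3 (vector_derivative \<sigma> (at s)) (v (\<sigma> s)) \<noteq> 0 \<and>
        (\<sigma> s \<in> \<gamma> \<longleftrightarrow> s = 0))"

definition first_return ::
    "(real^3 \<Rightarrow> real^3) \<Rightarrow> (real^3) set \<Rightarrow> real^3 \<Rightarrow> real^3 \<Rightarrow> bool" where
  "first_return v G p q \<longleftrightarrow>
     (\<exists>\<phi> \<tau>. trajectory v \<phi> \<and> \<phi> 0 = p \<and> 0 < \<tau> \<and> \<phi> \<tau> = q \<and> q \<in> G \<and>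
        (\<forall>t. 0 < t \<and> t < \<tau> \<longrightarrow> \<phi> t \<notin> G))"

text \<open>\<open>P\<close> is, on the neighbourhood \<open>W\<close> of \<open>0\<close>, the Poincare map written in the chart of the
  cross-section.\<close>

definition poincare_map ::
    "(real^3 \<Rightarrow> real^3) \<Rightarrow> (real^3) set \<Rightarrow> (real \<Rightarrow> real^3) \<Rightarrow> real \<Rightarrow> real \<Rightarrow>
     real set \<Rightarrow> (real \<Rightarrow> real) \<Rightarrow> bool" where
  "poincare_map v \<gamma> \<sigma> l r W P \<longleftrightarrow>
     cross_section v \<gamma> \<sigma> l r \<and>
     open W \<and> 0 \<in> W \<and> W \<subseteq> {l..r} \<and> smooth_on W P \<and>
     (\<forall>s\<in>W. P s \<in> {l..r} \<and> first_return v (\<sigma> ` {l..r}) (\<sigma> s) (\<sigma> (P s)))"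

definition hyperbolic_cycle :: "(real^3 \<Rightarrow> real^3) \<Rightarrow> (real^3) set \<Rightarrow> bool" where
  "hyperbolic_cycle v \<gamma> \<longleftrightarrow>
     limit_cycle v \<gamma> \<and>
     (\<exists>\<sigma> l r W P. poincare_map v \<gamma> \<sigma> l r W P \<and> \<bar>deriv P 0\<bar> \<noteq> 1)"

definition parabolic_cycle_mult2 :: "(real^3 \<Rightarrow> real^3) \<Rightarrow> (real^3) set \<Rightarrow> bool" where
  "parabolic_cycle_mult2 v \<gamma> \<longleftrightarrow>
     limit_cycle v \<gamma> \<and>
     (\<exists>\<sigma> l r W P a. poincare_map v \<gamma> \<sigma> l r W P \<and> a \<noteq> 0 \<and>
        (\<lambda>x. P x - (x + a * x^2)) \<in> O[at 0](\<lambda>x. x^3))"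

definition PC_with_cycle :: "(real^3 \<Rightarrow> real^3) \<Rightarrow> (real^3) set \<Rightarrow> bool" where
  "PC_with_cycle v \<gamma> \<longleftrightarrow>
     sphere_vector_field v \<and>
     parabolic_cycle_mult2 v \<gamma> \<and>
     (\<forall>p\<in>singular_points v. hyperbolic_singular_point v p) \<and>
     (\<forall>\<gamma>'. limit_cycle v \<gamma>' \<and> \<gamma>' \<noteq> \<gamma> \<longrightarrow> hyperbolic_cycle v \<gamma>') \<and>
     \<not> (\<exists>\<phi>. saddle_connection v \<phi>)"

definition class_PC :: "(real^3 \<Rightarrow> real^3) \<Rightarrow> bool" where
  "class_PC v \<longleftrightarrow> (\<exists>\<gamma>. PC_with_cycle v \<gamma>)"


section \<open>Characteristic sets\<close>

text \<open>\<open>u\<close>, defined on an open interval \<open>J\<close> around \<open>0\<close>, represents the germ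
  \<open>x\<^sup>2 + \<dots>\<close> of vector field whose time-one map is \<open>P\<close> (on \<open>W\<close>).  Positivity says that \<open>J\<close> is
  small enough to contain no singular point of \<open>u\<close> other than \<open>0\<close>.\<close>

definition takens_generator ::
    "real set \<Rightarrow> (real \<Rightarrow> real) \<Rightarrow> real set \<Rightarrow> (real \<Rightarrow> real) \<Rightarrow> bool" where
  "takens_generator W P J u \<longleftrightarrow>
     open J \<and> is_interval J \<and> 0 \<in> J \<and> smooth_on J u \<and>
     (\<lambda>x. u x - x^2) \<in> O[at 0](\<lambda>x. x^3) \<and>
     (\<forall>x\<in>J - {0}. 0 < u x) \<and>
     (\<forall>s\<in>W. \<exists>\<psi>. \<psi> 0 = s \<and> \<psi> 1 = P s \<and>
        (\<forall>t\<in>{0..1}. \<psi> t \<in> J \<and>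
           (\<psi> has_real_derivative u (\<psi> t)) (at t within {0..1})))"

definition takens_time :: "(real \<Rightarrow> real) \<Rightarrow> real \<Rightarrow> real \<Rightarrow> real" where
  "takens_time u b\<^sub>0 b = (LBINT x=ereal b\<^sub>0..ereal b. 1 / u x)"

definition winding_separatrix ::
    "(real^3 \<Rightarrow> real^3) \<Rightarrow> (real^3) set \<Rightarrow> real^3 \<Rightarrow> (real \<Rightarrow> real^3) \<Rightarrow> bool" where
  "winding_separatrix v \<gamma> p \<phi> \<longleftrightarrow>
     unstable_separatrix v p \<phi> \<and> ((\<lambda>t. infdist (\<phi> t) \<gamma>) \<longlongrightarrow> 0) at_top \<or>
     stable_separatrix v p \<phi> \<and> ((\<lambda>t. infdist (\<phi> t) \<gamma>) \<longlongrightarrow> 0) at_bot"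

text \<open>Coordinates of the points at which the winding separatrices of the saddle \<open>p\<close> meet the
  segment \<open>[b, e)\<close> of the cross-section.\<close>

definition separatrix_points ::
    "(real^3 \<Rightarrow> real^3) \<Rightarrow> (real^3) set \<Rightarrow> (real \<Rightarrow> real^3) \<Rightarrow> real \<Rightarrow> real \<Rightarrow> real^3 \<Rightarrow> real set" where
  "separatrix_points v \<gamma> \<sigma> b e p =
     {s \<in> {b..<e}. \<exists>\<phi>. winding_separatrix v \<gamma> p \<phi> \<and> \<phi> 0 = \<sigma> s}"

definition charset ::
    "(real^3 \<Rightarrow> real^3) \<Rightarrow> (real^3) set \<Rightarrow> (real \<Rightarrow> real^3) \<Rightarrow> (real \<Rightarrow> real) \<Rightarrow> (real \<Rightarrow> real) \<Rightarrow>
     real \<Rightarrow> real set" where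
  "charset v \<gamma> \<sigma> P u b =
     (\<lambda>s. frac (takens_time u b s)) ` (\<Union>p. separatrix_points v \<gamma> \<sigma> b (P b) p)"

definition charset_rel ::
    "(real^3 \<Rightarrow> real^3) \<Rightarrow> (real^3) set \<Rightarrow> (real \<Rightarrow> real^3) \<Rightarrow> (real \<Rightarrow> real) \<Rightarrow> (real \<Rightarrow> real) \<Rightarrow>
     real \<Rightarrow> real rel" where
  "charset_rel v \<gamma> \<sigma> P u b =
     {(frac (takens_time u b s), frac (takens_time u b s')) | s s' p.
        s \<in> separatrix_points v \<gamma> \<sigma> b (P b) p \<and> s' \<in> separatrix_points v \<gamma> \<sigma> b (P b) p}"

text \<open>The characteristic sets are obtained from any choice of the auxiliary data
  (cross-section, chart normalizing the quadratic coefficient to \<open>1\<close>, \<open>b\<^sup>-\<close> and \<open>b\<^sup>+\<close>), and do not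
  depend on it up to a separate rotation of each circle.\<close>

definition characteristic_sets ::
    "(real^3 \<Rightarrow> real^3) \<Rightarrow> real set \<Rightarrow> real rel \<Rightarrow> real set \<Rightarrow> real rel \<Rightarrow> bool" where
  "characteristic_sets v Ap Ep Am Em \<longleftrightarrow>
     (\<exists>\<gamma> \<sigma> l r W P J u bm bp.
        PC_with_cycle v \<gamma> \<and>
        poincare_map v \<gamma> \<sigma> l r W P \<and>
        (\<lambda>x. P x - (x + x^2)) \<in> O[at 0](\<lambda>x. x^3) \<and>
        takens_generator W P J u \<and>
        bm < 0 \<and> 0 < bp \<and> {bm..bp} \<subseteq> W \<and>
        equal_mod_rotation (charset v \<gamma> \<sigma> P u bp) (charset_rel v \<gamma> \<sigma> P u bp) Ap Ep \<and>
        equal_mod_rotation (charset v \<gamma> \<sigma> P u bm) (charset_rel v \<gamma> \<sigma> P u bm) Am Em)"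

end

theory Submission
  imports Defs
begin

text \<open>Away from the poles the sphere is a cylinder with coordinates \<open>(\<theta>, h)\<close>, and the field is an upward drift
  \<open>h' = 1\<close> modified near the equator and in finitely many plugs. Near the equator it is \<open>(- 2 pi, h\<^sup>2)\<close>, so that
  the equator is a parabolic limit cycle of multiplicity 2 and the coordinate \<open>T\<close> on the section \<open>\<theta> = 0\<close> measures
  the angle at which an orbit leaves. Every class of \<open>A\<^sup>+\<close> gives a plug, one above the other in the upper hemisphere,
  containing one saddle and one node. For a two-point class the saddle is above a sink, and its two stable
  separatrices enter the plug at the two prescribed angles; for a one-point class it is below a source, and only one stable
  separatrix comes from below, the other one from the source. Shorter classes get lower plugs. As classes are not
  intermingled, the separatrices of a higher plug then pass beside the lower ones, vertically down to a neighbourhood of the equator,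
  and an orbit leaving a plug upwards does so over the arc of that plug, so that there are no saddle connections.
  The lower hemisphere is treated in the same way after time reversal.\<close>

section \<open>Smooth functions\<close>

text \<open>The height \<open>h\<close> is the Mercator coordinate: both hemispheres become
  infinitely tall, so there is room for any number of plugs, and the planar right-hand sides are
  bounded and Lipschitz, so all solutions are global. One plug is built in standard coordinates. The
  abscissa \<open>plug_entry\<close> at which its separatrix enters is only shown to exist; the
  scale of the arc chart is then chosen so that it falls on the two prescribed angles. Near the
  equator the field does not depend on the angle, so an orbit that starts on the section at height
  \<open>s\<close> arrives at height 2 at the angle \<open>2 * pi * (c - 1 / s)\<close>. As
  \<open>1 / b - 1 / s\<close> is the time coordinate of the field \<open>s\<^sup>2\<close>, the
  characteristic circle is the circle of arrival angles up to a rotation. Closed orbits off the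
  equator and connections are excluded by two monotonicities: the levels between plugs are crossed
  only upwards, and the square of the chart coordinate is monotone inside a plug. Time reversal
  combined with the reflection of \<open>h\<close> negates only the indices and the signs
  \<open>om\<close> and \<open>sg\<close>, so the lower hemisphere is a second instance of the
  locale for the upper one.\<close>

lemma Ck_on_cong:
  assumes "open S" "\<And>x. x \<in> S \<Longrightarrow> f x = g x" "Ck_on k S f"
  shows "Ck_on k S g"
  using assms(2,3)
proof (induction k arbitrary: f g)
  case 0
  then show ?case by (simp cong: continuous_on_cong)
next
  case (Suc k)
  have iff: "(f has_derivative D) (at x) \<longleftrightarrow> (g has_derivative D) (at x)" if "x \<in> S" for x D
    using has_derivative_transform_within_open[OF _ assms(1) that] Suc.prems(1) by metis
  have "g differentiable (at x)" if "x \<in> S" for x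
    using Suc.prems(2) iff[OF that] that unfolding differentiable_def by (metis Ck_on.simps(2) differentiable_def)
  moreover have "frechet_derivative f (at x) = frechet_derivative g (at x)" if "x \<in> S" for x
    using iff[OF that] unfolding frechet_derivative_def by presburger
  then have "Ck_on k S (\<lambda>x. frechet_derivative g (at x) i)" if "i \<in> Basis" for i
    using Suc.IH[of "\<lambda>x. frechet_derivative f (at x) i"] Suc.prems(2) that by simp
  ultimately show ?case by simp
qed

text \<open>\<open>frechet_derivative\<close> is a choice operator; uniqueness of the derivative on
  an open set lets any explicit derivative stand in for it.\<close>

lemma Ck_on_SucI:
  assumes "open S" "\<And>x. x \<in> S \<Longrightarrow> (f has_derivative f' x) (at x)"
    and "\<And>i. i \<in> Basis \<Longrightarrow> Ck_on k S (\<lambda>x. f' x i)"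
  shows "Ck_on (Suc k) S f"
proof -
  have "frechet_derivative f (at x) = f' x" if "x \<in> S" for x
    using frechet_derivative_at[OF assms(2)[OF that]] by simp
  then have "Ck_on k S (\<lambda>x. frechet_derivative f (at x) i)" if "i \<in> Basis" for i
    using assms(3)[OF that] by (intro Ck_on_cong[OF assms(1) _ assms(3)[OF that]]) auto
  moreover have "\<forall>x\<in>S. f differentiable (at x)"
    using assms(2) unfolding differentiable_def by blast
  ultimately show ?thesis by simp
qed

lemma Ck_on_SucD: "Ck_on (Suc k) S f \<Longrightarrow> Ck_on k S f"
proof (induction k arbitrary: f)
  case 0
  then show ?case
    by (auto intro!: continuous_at_imp_continuous_on differentiable_imp_continuous_within)
next
  case (Suc k)
  then show ?case using Ck_on.simps(2)[of "Suc k" S f] Ck_on.simps(2)[of k S f] by blast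
qed

lemma Ck_on_subset: "Ck_on k S f \<Longrightarrow> T \<subseteq> S \<Longrightarrow> Ck_on k T f"
  by (induction k arbitrary: f) (auto intro: continuous_on_subset)

text \<open>The gluing tool: the arc functions, functions of the angle and the field itself are
  smooth on overlapping open pieces for different reasons.\<close>

lemma Ck_on_local:
  assumes "\<And>x. x \<in> S \<Longrightarrow> \<exists>U. open U \<and> x \<in> U \<and> Ck_on k U f"
  shows "Ck_on k S f"
  using assms
proof (induction k arbitrary: f)
  case 0
  have "continuous (at x) f" if x: "x \<in> S" for x
    using 0[OF x] continuous_on_eq_continuous_at by auto
  then show ?case by (simp add: continuous_at_imp_continuous_on)
next
  case (Suc k)
  have "f differentiable (at x)" if "x \<in> S" for x
    using Suc.prems[OF that] by auto
  moreover have "Ck_on k S (\<lambda>x. frechet_derivative f (at x) i)" if "i \<in> Basis" for i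
    using Suc.prems that by (intro Suc.IH) (metis Ck_on.simps(2))
  ultimately show ?case by simp
qed

lemma Ck_on_const: "Ck_on k S (\<lambda>x. c)"
  by (induction k arbitrary: c) (auto simp: frechet_derivative_const)

lemma Ck_on_bounded_linear:
  assumes "open S" "bounded_linear f"
  shows "Ck_on k S f"
proof (cases k)
  case 0
  then show ?thesis using assms(2) by (simp add: linear_continuous_on)
next
  case (Suc n)
  show ?thesis unfolding Suc
    by (rule Ck_on_SucI[OF assms(1) bounded_linear_imp_has_derivative[OF assms(2)]])
       (rule Ck_on_const)
qed

lemma Ck_on_linear_compose:
  assumes "open S" "bounded_linear L" "Ck_on k S f"
  shows "Ck_on k S (\<lambda>x. L (f x))"
  using assms(3)
proof (induction k arbitrary: f)
  case 0
  then show ?case using assms(2) by (simp add: bounded_linear.continuous_on)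
next
  case (Suc k)
  show ?case
  proof (rule Ck_on_SucI[OF assms(1)])
    show "((\<lambda>x. L (f x)) has_derivative (\<lambda>h. L (frechet_derivative f (at x) h))) (at x)"
      if "x \<in> S" for x
      using Suc.prems that
      by (intro bounded_linear.has_derivative[OF assms(2)]) (simp add: iffD1[OF frechet_derivative_works])
  qed (use Suc in auto)
qed

lemma Ck_on_add:
  assumes "open S" "Ck_on k S f" "Ck_on k S g"
  shows "Ck_on k S (\<lambda>x. f x + g x)"
  using assms(2,3)
proof (induction k arbitrary: f g)
  case 0
  then show ?case by (simp add: continuous_on_add)
next
  case (Suc k)
  show ?case
  proof (rule Ck_on_SucI[OF assms(1)])
    show "((\<lambda>x. f x + g x) has_derivative
       (\<lambda>h. frechet_derivative f (at x) h + frechet_derivative g (at x) h)) (at x)"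
      if "x \<in> S" for x
      using Suc.prems that
      by (intro has_derivative_add) (simp_all add: iffD1[OF frechet_derivative_works])
  qed (use Suc in auto)
qed

lemma Ck_on_mult:
  fixes f g :: "'a::euclidean_space \<Rightarrow> real"
  assumes "open S" "Ck_on k S f" "Ck_on k S g"
  shows "Ck_on k S (\<lambda>x. f x * g x)"
  using assms(2,3)
proof (induction k arbitrary: f g)
  case 0
  then show ?case by (simp add: continuous_on_mult)
next
  case (Suc k)
  note fk = Ck_on_SucD[OF Suc.prems(1)] and gk = Ck_on_SucD[OF Suc.prems(2)]
  show ?case
  proof (rule Ck_on_SucI[OF assms(1)])
    show "((\<lambda>x. f x * g x) has_derivative
       (\<lambda>h. f x * frechet_derivative g (at x) h + frechet_derivative f (at x) h * g x)) (at x)"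
      if "x \<in> S" for x
      using Suc.prems that
      by (intro has_derivative_mult) (simp_all add: iffD1[OF frechet_derivative_works])
  qed (use Suc fk gk in \<open>auto intro!: Ck_on_add[OF assms(1)]\<close>)
qed

text \<open>The outer function lives on the reals, so its derivative is multiplication by its value
  at \<open>1\<close>. The derivative of the composite is then a product of scalar functions, and
  the induction needs only the product rule.\<close>

lemma Ck_on_compose:
  fixes f :: "'a::euclidean_space \<Rightarrow> real" and g :: "real \<Rightarrow> real"
  assumes "open S" "open T" "f ` S \<subseteq> T" "Ck_on k S f" "Ck_on k T g"
  shows "Ck_on k S (\<lambda>x. g (f x))"
  using assms(4,5)
proof (induction k arbitrary: g)
  case 0
  then show ?case using continuous_on_compose2[of T g S f] assms(3) by simp
next
  case (Suc k)
  note fk = Ck_on_SucD[OF Suc.prems(1)]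
  show ?case
  proof (rule Ck_on_SucI[OF assms(1)])
    fix x assume x: "x \<in> S"
    have g': "(g has_derivative frechet_derivative g (at (f x))) (at (f x))"
      using Suc.prems(2) x assms(3) by (auto intro: iffD1[OF frechet_derivative_works])
    have lin: "frechet_derivative g (at (f x)) y = frechet_derivative g (at (f x)) 1 * y" for y
      using linear_cmul[OF has_derivative_linear[OF g'], of y 1] by (metis mult.commute mult_1 real_scaleR_def)
    have f': "(f has_derivative frechet_derivative f (at x)) (at x)"
      using Suc.prems(1) x frechet_derivative_works by auto
    have "((\<lambda>x. g (f x)) has_derivative
        (\<lambda>h. frechet_derivative g (at (f x)) (frechet_derivative f (at x) h))) (at x)"
      by (rule has_derivative_compose[OF f' g'])
    moreover have "(\<lambda>h. frechet_derivative g (at (f x)) (frechet_derivative f (at x) h)) =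
        (\<lambda>h. frechet_derivative g (at (f x)) 1 * frechet_derivative f (at x) h)"
      by (rule ext) (rule lin)
    ultimately show "((\<lambda>x. g (f x)) has_derivative
        (\<lambda>h. frechet_derivative g (at (f x)) 1 * frechet_derivative f (at x) h)) (at x)"
      by simp
  next
    fix i :: 'a assume i: "i \<in> Basis"
    have "Ck_on k T (\<lambda>y. frechet_derivative g (at y) 1)" using Suc.prems(2) by simp
    note Suc.IH[OF fk this]
    moreover have "Ck_on k S (\<lambda>x. frechet_derivative f (at x) i)" using Suc.prems(1) i by simp
    ultimately show "Ck_on k S (\<lambda>x. frechet_derivative g (at (f x)) 1 * frechet_derivative f (at x) i)"
      by (rule Ck_on_mult[OF assms(1)])
  qed
qed

lemma Ck_on_SucI_real:
  fixes f :: "real \<Rightarrow> real"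
  assumes "open S" "\<And>x. x \<in> S \<Longrightarrow> (f has_real_derivative f' x) (at x)" "Ck_on k S f'"
  shows "Ck_on (Suc k) S f"
  using assms(3) by (intro Ck_on_SucI[OF assms(1) assms(2)[unfolded has_field_derivative_def]]) auto

lemma smooth_on_cong:
  "open S \<Longrightarrow> (\<And>x. x \<in> S \<Longrightarrow> f x = g x) \<Longrightarrow> smooth_on S f \<Longrightarrow> smooth_on S g"
  unfolding smooth_on_def using Ck_on_cong by metis

lemma smooth_on_subset: "smooth_on S f \<Longrightarrow> T \<subseteq> S \<Longrightarrow> smooth_on T f"
  unfolding smooth_on_def using Ck_on_subset by metis

lemma smooth_on_local:
  "(\<And>x. x \<in> S \<Longrightarrow> \<exists>U. open U \<and> x \<in> U \<and> smooth_on U f) \<Longrightarrow> smooth_on S f"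
  unfolding smooth_on_def by (intro allI Ck_on_local) metis

lemma smooth_on_const: "smooth_on S (\<lambda>x. c)"
  unfolding smooth_on_def using Ck_on_const by metis

lemma smooth_on_bounded_linear: "open S \<Longrightarrow> bounded_linear f \<Longrightarrow> smooth_on S f"
  unfolding smooth_on_def using Ck_on_bounded_linear by metis

lemma smooth_on_id: "open S \<Longrightarrow> smooth_on S (\<lambda>x. x)"
  by (rule smooth_on_bounded_linear) auto

lemma smooth_on_linear_compose:
  "open S \<Longrightarrow> bounded_linear L \<Longrightarrow> smooth_on S f \<Longrightarrow> smooth_on S (\<lambda>x. L (f x))"
  unfolding smooth_on_def using Ck_on_linear_compose by metis

lemma smooth_on_add:
  "open S \<Longrightarrow> smooth_on S f \<Longrightarrow> smooth_on S g \<Longrightarrow> smooth_on S (\<lambda>x. f x + g x)"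
  unfolding smooth_on_def using Ck_on_add by metis

lemma smooth_on_mult:
  fixes f g :: "'a::euclidean_space \<Rightarrow> real"
  shows "open S \<Longrightarrow> smooth_on S f \<Longrightarrow> smooth_on S g \<Longrightarrow> smooth_on S (\<lambda>x. f x * g x)"
  unfolding smooth_on_def using Ck_on_mult by metis

lemma smooth_on_compose:
  fixes f :: "'a::euclidean_space \<Rightarrow> real" and g :: "real \<Rightarrow> real"
  shows "open S \<Longrightarrow> open T \<Longrightarrow> f ` S \<subseteq> T \<Longrightarrow> smooth_on S f \<Longrightarrow> smooth_on T g \<Longrightarrow>
    smooth_on S (\<lambda>x. g (f x))"
  unfolding smooth_on_def using Ck_on_compose by metis

lemma smooth_on_uminus: "open S \<Longrightarrow> smooth_on S f \<Longrightarrow> smooth_on S (\<lambda>x. - f x)"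
  by (rule smooth_on_linear_compose[of S uminus]) (auto intro: bounded_linear_minus)

lemma smooth_on_diff:
  "open S \<Longrightarrow> smooth_on S f \<Longrightarrow> smooth_on S g \<Longrightarrow> smooth_on S (\<lambda>x. f x - g x)"
  using smooth_on_add[of S f "\<lambda>x. - g x"] smooth_on_uminus[of S g] by simp

lemma smooth_on_sum:
  "open S \<Longrightarrow> (\<And>i. i \<in> I \<Longrightarrow> smooth_on S (f i)) \<Longrightarrow> smooth_on S (\<lambda>x. \<Sum>i\<in>I. f i x)"
  by (induction I rule: infinite_finite_induct) (auto intro: smooth_on_add smooth_on_const)

lemma smooth_on_power:
  fixes f :: "'a::euclidean_space \<Rightarrow> real"
  shows "open S \<Longrightarrow> smooth_on S f \<Longrightarrow> smooth_on S (\<lambda>x. f x ^ n)"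
  by (induction n) (auto intro: smooth_on_mult smooth_on_const)

lemma smooth_on_real_antideriv:
  fixes f :: "real \<Rightarrow> real"
  assumes "open S" "\<And>x. x \<in> S \<Longrightarrow> (f has_real_derivative f' x) (at x)" "smooth_on S f'"
  shows "smooth_on S f"
  unfolding smooth_on_def
proof
  fix k
  show "Ck_on k S f"
    using Ck_on_SucD[OF Ck_on_SucI_real[OF assms(1,2)]] assms(3) unfolding smooth_on_def by blast
qed

text \<open>For functions that satisfy a differential equation: if \<open>f'\<close> is an
  expression in \<open>f\<close>, it is as regular as \<open>f\<close>, and each step of the
  induction gains one derivative.\<close>

lemma smooth_on_real_bootstrap:
  fixes f :: "real \<Rightarrow> real"
  assumes "open S" "\<And>x. x \<in> S \<Longrightarrow> (f has_real_derivative f' x) (at x)"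
    and "\<And>k. Ck_on k S f \<Longrightarrow> Ck_on k S f'"
  shows "smooth_on S f"
proof -
  have "Ck_on k S f" for k
  proof (induction k)
    case 0
    then show ?case
      using assms(2) by (auto intro!: continuous_at_imp_continuous_on DERIV_isCont)
  next
    case (Suc k)
    then show ?case using Ck_on_SucI_real[OF assms(1,2) assms(3)] by blast
  qed
  then show ?thesis unfolding smooth_on_def by blast
qed

lemma smooth_on_inverse_real: "smooth_on (- {0}) (inverse :: real \<Rightarrow> real)"
proof (rule smooth_on_real_bootstrap)
  show "(inverse has_real_derivative (-1) * (inverse x * inverse x)) (at x)"
    if "x \<in> - {0}" for x :: real
    using that by (auto intro!: derivative_eq_intros simp: power2_eq_square)
  show "Ck_on k (- {0}) (\<lambda>x::real. (-1) * (inverse x * inverse x))"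
    if "Ck_on k (- {0}) (inverse :: real \<Rightarrow> real)" for k
    using that by (intro Ck_on_mult Ck_on_const) auto
qed auto

lemma smooth_on_inverse:
  fixes f :: "'a::euclidean_space \<Rightarrow> real"
  assumes "open S" "smooth_on S f" "\<And>x. x \<in> S \<Longrightarrow> f x \<noteq> 0"
  shows "smooth_on S (\<lambda>x. inverse (f x))"
  using assms by (intro smooth_on_compose[OF _ _ _ _ smooth_on_inverse_real]) auto

lemma smooth_on_divide:
  fixes f g :: "'a::euclidean_space \<Rightarrow> real"
  assumes "open S" "smooth_on S f" "smooth_on S g" "\<And>x. x \<in> S \<Longrightarrow> g x \<noteq> 0"
  shows "smooth_on S (\<lambda>x. f x / g x)"
  using assms by (simp add: divide_inverse smooth_on_mult smooth_on_inverse)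

lemma smooth_on_exp_real: "smooth_on UNIV (exp :: real \<Rightarrow> real)"
  by (rule smooth_on_real_bootstrap[where f' = exp]) (auto intro: DERIV_exp)

text \<open>Differentiation shifts the phase by a quarter turn, so the family over all phases
  \<open>c\<close> is closed under it; sine is the member with phase
  \<open>- pi / 2\<close>.\<close>

lemma smooth_on_cos_sin_shift: "smooth_on UNIV (\<lambda>x::real. cos (x + c))"
proof -
  have "Ck_on k UNIV (\<lambda>x::real. cos (x + c))" for k c
  proof (induction k arbitrary: c)
    case 0
    show ?case by (auto intro!: continuous_intros)
  next
    case (Suc k)
    show ?case
      by (rule Ck_on_SucI_real[OF _ _ Suc.IH[of "c + pi / 2"]])
         (auto intro!: derivative_eq_intros simp: cos_add algebra_simps sin_add)
  qed
  then show ?thesis unfolding smooth_on_def by blast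
qed

lemma smooth_on_cos_real: "smooth_on UNIV (\<lambda>x::real. cos (x - c))"
  using smooth_on_cos_sin_shift[of "-c"] by simp

lemma smooth_on_sin_real: "smooth_on UNIV (\<lambda>x::real. sin (x - c))"
  using smooth_on_cos_sin_shift[of "- c - pi / 2"]
  by (simp add: cos_diff sin_diff cos_add sin_add algebra_simps)

lemma smooth_on_arctan: "smooth_on UNIV (arctan :: real \<Rightarrow> real)"
proof (rule smooth_on_real_antideriv)
  show "(arctan has_real_derivative inverse (1 + x\<^sup>2)) (at x)" for x :: real
    by (rule DERIV_arctan)
  have "1 + x\<^sup>2 \<noteq> 0" for x :: real
    by (metis add_nonneg_eq_0_iff zero_le_one zero_le_power2 zero_neq_one)
  then show "smooth_on UNIV (\<lambda>x::real. inverse (1 + x\<^sup>2))"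
    by (intro smooth_on_inverse smooth_on_add smooth_on_power smooth_on_const smooth_on_id) auto
qed auto

lemma smooth_on_artanh: "smooth_on {-1<..<1} (artanh :: real \<Rightarrow> real)"
proof (rule smooth_on_real_antideriv)
  show "(artanh has_real_derivative 1 / (1 - x\<^sup>2)) (at x)" if "x \<in> {-1<..<1}" for x :: real
    using that by (intro artanh_real_has_field_derivative) auto
  have "1 - x\<^sup>2 \<noteq> 0" if "x \<in> {-1<..<1}" for x :: real
    using that by (auto simp: power2_eq_1_iff)
  then show "smooth_on {-1<..<1} (\<lambda>x::real. 1 / (1 - x\<^sup>2))"
    by (intro smooth_on_divide smooth_on_diff smooth_on_power smooth_on_const smooth_on_id) auto
qed auto

section \<open>Flat functions, cutoffs and the vertical profile of a plug\<close>

definition flat :: "real \<Rightarrow> real" where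
  "flat x = (if x > 0 then exp (- (1 / x)) else 0)"

text \<open>The polynomial factors make the family closed under differentiation.\<close>

definition flat_poly :: "real poly \<Rightarrow> real \<Rightarrow> real" where
  "flat_poly q x = (if x > 0 then poly q (1 / x) * exp (- (1 / x)) else 0)"

lemma poly_times_exp_tendsto_0: "((\<lambda>t::real. poly q t * exp (- t)) \<longlongrightarrow> 0) at_top"
proof -
  have "((\<lambda>t. \<Sum>i\<le>degree q. coeff q i * (t ^ i / exp t)) \<longlongrightarrow> (\<Sum>i\<le>degree q. coeff q i * 0)) at_top"
    by (intro tendsto_sum tendsto_mult tendsto_const tendsto_power_div_exp_0)
  then show ?thesis
    by (simp add: poly_altdef sum_divide_distrib exp_minus field_simps)
qed

lemma flat_poly_has_derivative:
  "(flat_poly q has_real_derivative flat_poly ([:0, 0, 1:] * (q - pderiv q)) x) (at x)"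
proof -
  consider "x > 0" | "x < 0" | "x = 0" by linarith
  then show ?thesis
  proof cases
    case 1
    have "((\<lambda>x. poly q (1 / x) * exp (- (1 / x))) has_real_derivative
        flat_poly ([:0, 0, 1:] * (q - pderiv q)) x) (at x)"
      using 1 by (auto intro!: derivative_eq_intros DERIV_chain2[OF poly_DERIV]
          simp: flat_poly_def power2_eq_square field_simps)
    then show ?thesis
      by (rule has_field_derivative_transform_within_open[where S = "{0<..}"])
        (use 1 in \<open>auto simp: flat_poly_def\<close>)
  next
    case 2
    have "((\<lambda>x. 0) has_real_derivative flat_poly ([:0, 0, 1:] * (q - pderiv q)) x) (at x)"
      using 2 by (simp add: flat_poly_def)
    then show ?thesis
      by (rule has_field_derivative_transform_within_open[where S = "{..<0}"])
        (use 2 in \<open>auto simp: flat_poly_def\<close>)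
  next
    case 3
    have "((\<lambda>h. flat_poly q h / h) \<longlongrightarrow> 0) (at 0)"
    proof (rule filterlim_split_at)
      have "((\<lambda>h. flat_poly q h / h) \<longlongrightarrow> 0) (at_left 0) \<longleftrightarrow> ((\<lambda>h::real. 0) \<longlongrightarrow> (0::real)) (at_left 0)"
        by (intro filterlim_cong) (auto simp: flat_poly_def eventually_at_filter)
      then show "((\<lambda>h. flat_poly q h / h) \<longlongrightarrow> 0) (at_left 0)" by simp
      \<comment> \<open>With \<open>t = 1 / h\<close> the division by \<open>h\<close> becomes a
        factor \<open>t\<close>, that is, the polynomial \<open>pCons 0 q\<close>.\<close>
      have "((\<lambda>h. poly (pCons 0 q) (inverse h) * exp (- inverse h)) \<longlongrightarrow> 0) (at_right 0)"
        by (rule filterlim_compose[OF poly_times_exp_tendsto_0 filterlim_inverse_at_top_right])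
      moreover have "((\<lambda>h. flat_poly q h / h) \<longlongrightarrow> 0) (at_right 0) \<longleftrightarrow>
        ((\<lambda>h. poly (pCons 0 q) (inverse h) * exp (- inverse h)) \<longlongrightarrow> 0) (at_right 0)"
        by (intro filterlim_cong) (auto simp: flat_poly_def eventually_at_filter field_simps)
      ultimately show "((\<lambda>h. flat_poly q h / h) \<longlongrightarrow> 0) (at_right 0)" by blast
    qed
    then show ?thesis using 3 by (simp add: DERIV_def flat_poly_def)
  qed
qed

lemma smooth_on_flat: "smooth_on UNIV flat"
proof -
  have "Ck_on k UNIV (flat_poly q)" for k q
  proof (induction k arbitrary: q)
    case 0
    show ?case
      using flat_poly_has_derivative by (auto intro!: continuous_at_imp_continuous_on DERIV_isCont)
  next
    case (Suc k)
    show ?case by (rule Ck_on_SucI_real[OF _ flat_poly_has_derivative Suc.IH]) auto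
  qed
  then have "smooth_on UNIV (flat_poly 1)" unfolding smooth_on_def by blast
  moreover have "flat = flat_poly 1" by (auto simp: flat_def flat_poly_def)
  ultimately show ?thesis by simp
qed

lemma flat_nonneg: "0 \<le> flat x" by (simp add: flat_def)

lemma flat_pos_iff: "0 < flat x \<longleftrightarrow> 0 < x" by (simp add: flat_def)

lemma flat_eq_0_iff: "flat x = 0 \<longleftrightarrow> x \<le> 0" by (simp add: flat_def)

definition smooth_step :: "real \<Rightarrow> real" where
  "smooth_step x = flat x / (flat x + flat (1 - x))"

lemma smooth_step_denominator_pos: "0 < flat x + flat (1 - x)"
  using flat_nonneg[of x] flat_nonneg[of "1 - x"] flat_pos_iff[of x] flat_pos_iff[of "1 - x"]
  by (cases "x > 0") (auto intro: add_pos_nonneg add_nonneg_pos)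

lemma smooth_on_smooth_step: "smooth_on UNIV smooth_step"
proof -
  have "smooth_on UNIV (\<lambda>x. flat (1 - x))"
    by (intro smooth_on_compose[OF _ _ _ _ smooth_on_flat] smooth_on_diff smooth_on_const smooth_on_id) auto
  then have "smooth_on UNIV (\<lambda>x. flat x / (flat x + flat (1 - x)))"
    using smooth_step_denominator_pos
    by (intro smooth_on_divide smooth_on_add smooth_on_flat) (auto simp: less_le)
  then show ?thesis unfolding smooth_step_def[abs_def] .
qed

lemma smooth_step_eq_0: "x \<le> 0 \<Longrightarrow> smooth_step x = 0"
  by (simp add: smooth_step_def flat_def)

lemma smooth_step_eq_1: "1 \<le> x \<Longrightarrow> smooth_step x = 1"
  using smooth_step_denominator_pos[of x] by (simp add: smooth_step_def flat_eq_0_iff[of "1 - x"])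

lemma smooth_step_nonneg: "0 \<le> smooth_step x"
  using smooth_step_denominator_pos[of x] flat_nonneg[of x] by (simp add: smooth_step_def)

lemma smooth_step_le_1: "smooth_step x \<le> 1"
  using smooth_step_denominator_pos[of x] flat_nonneg by (simp add: smooth_step_def)

text \<open>A cutoff in \<open>x\<^sup>2\<close> is smooth at \<open>0\<close> and even; evenness
  makes the plugs symmetric under reflection of the angle and of the height.\<close>

definition plateau :: "real \<Rightarrow> real \<Rightarrow> real" where
  "plateau r x = smooth_step (r - x\<^sup>2)"

lemma smooth_on_plateau: "smooth_on UNIV (plateau r)"
  unfolding plateau_def[abs_def]
  by (intro smooth_on_compose[OF _ _ _ _ smooth_on_smooth_step] smooth_on_diff smooth_on_power
      smooth_on_const smooth_on_id) auto

lemma plateau_eq_1: "x\<^sup>2 \<le> r - 1 \<Longrightarrow> plateau r x = 1"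
  by (simp add: plateau_def smooth_step_eq_1)

lemma plateau_eq_0: "r \<le> x\<^sup>2 \<Longrightarrow> plateau r x = 0"
  by (simp add: plateau_def smooth_step_eq_0)

lemma plateau_nonneg: "0 \<le> plateau r x"
  by (simp add: plateau_def smooth_step_nonneg)

lemma plateau_le_1: "plateau r x \<le> 1"
  by (simp add: plateau_def smooth_step_le_1)

lemma plateau_minus [simp]: "plateau r (- x) = plateau r x"
  by (simp add: plateau_def)

text \<open>The factor \<open>exp 2\<close> puts the level \<open>1\<close> at the regular points \<open>x = \<plusminus> 1 / sqrt 2\<close>.\<close>

definition dip :: "real \<Rightarrow> real" where
  "dip x = exp 2 * flat (1 - x\<^sup>2)"

lemma smooth_on_dip: "smooth_on UNIV dip"
  unfolding dip_def[abs_def]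
  by (intro smooth_on_mult smooth_on_compose[OF _ _ _ _ smooth_on_flat] smooth_on_diff smooth_on_power
      smooth_on_const smooth_on_id) auto

lemma dip_nonneg: "0 \<le> dip x"
  by (simp add: dip_def flat_nonneg)

lemma dip_eq_0: "1 \<le> x\<^sup>2 \<Longrightarrow> dip x = 0"
  by (simp add: dip_def flat_eq_0_iff)

lemma dip_minus [simp]: "dip (- x) = dip x"
  by (simp add: dip_def)

lemma dip_eq_exp: "x\<^sup>2 < 1 \<Longrightarrow> dip x = exp (2 - 1 / (1 - x\<^sup>2))"
  by (simp add: dip_def flat_def flip: exp_add)

lemma dip_less_1_iff: "dip x < 1 \<longleftrightarrow> 1 / 2 < x\<^sup>2"
proof (cases "x\<^sup>2 < 1")
  case True
  then have "dip x < 1 \<longleftrightarrow> 2 - 1 / (1 - x\<^sup>2) < 0" by (simp add: dip_eq_exp)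
  also have "\<dots> \<longleftrightarrow> 1 / 2 < x\<^sup>2" using True by (simp add: field_simps)
  finally show ?thesis .
qed (auto simp: dip_eq_0)

lemma dip_eq_1_iff: "dip x = 1 \<longleftrightarrow> x\<^sup>2 = 1 / 2"
proof (cases "x\<^sup>2 < 1")
  case True
  then have "dip x = 1 \<longleftrightarrow> 2 - 1 / (1 - x\<^sup>2) = 0" by (simp add: dip_eq_exp)
  also have "\<dots> \<longleftrightarrow> x\<^sup>2 = 1 / 2" using True by (auto simp add: field_simps)
  finally show ?thesis .
qed (auto simp: dip_eq_0)

text \<open>The nonzero slope makes the singular points of a plug hyperbolic in the vertical
  direction; its sign tells the upper one from the lower one.\<close>

lemma dip_has_derivative_critical:
  assumes "x\<^sup>2 = 1 / 2"
  shows "(dip has_real_derivative - 8 * x) (at x)"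
proof -
  have h: "1 - x\<^sup>2 = 1 / 2" using assms by simp
  have "((\<lambda>x. exp (2 - 1 / (1 - x\<^sup>2))) has_real_derivative - 8 * x) (at x)"
    by (auto intro!: derivative_eq_intros simp: h exp_zero)
  moreover have "open {x::real. x\<^sup>2 < 1}"
    by (intro open_Collect_less continuous_intros)
  ultimately show ?thesis
    by (rule has_field_derivative_transform_within_open) (use assms in \<open>auto simp: dip_eq_exp\<close>)
qed

section \<open>Global bounds and Lipschitz constants\<close>

lemma smooth_on_real_has_derivative:
  fixes f :: "real \<Rightarrow> real"
  assumes "smooth_on UNIV f"
  shows "(f has_real_derivative deriv f x) (at x)" "continuous_on UNIV (deriv f)"
proof -
  have C: "Ck_on (Suc 0) UNIV f" using assms unfolding smooth_on_def by blast
  then have d: "f differentiable (at x)" for x by simp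
  have D: "(f has_real_derivative deriv f x) (at x)" for x
    using d[of x] by (metis DERIV_deriv_iff_real_differentiable)
  then show "(f has_real_derivative deriv f x) (at x)" .
  have "frechet_derivative f (at x) 1 = deriv f x" for x
    using frechet_derivative_at[OF D[of x, unfolded has_field_derivative_def]] by (metis mult.right_neutral)
  then show "continuous_on UNIV (deriv f)" using C by simp
qed

lemma lipschitz_of_bounded_deriv:
  fixes f :: "real \<Rightarrow> real"
  assumes "\<And>x. (f has_real_derivative f' x) (at x)" "\<And>x. \<bar>f' x\<bar> \<le> B"
  shows "\<bar>f x - f y\<bar> \<le> B * \<bar>x - y\<bar>"
  using field_differentiable_bound[of UNIV f f' B x y] assms by (auto simp: has_field_derivative_at_within)

text \<open>The hypothesis under which planar systems will have unique global solutions. The class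
  is closed under sums and products, from which the right-hand sides are assembled.\<close>

definition bounded_lipschitz :: "('a::metric_space \<Rightarrow> real) \<Rightarrow> bool" where
  "bounded_lipschitz f \<longleftrightarrow> (\<exists>B\<ge>0. \<forall>x y. \<bar>f x\<bar> \<le> B \<and> \<bar>f x - f y\<bar> \<le> B * dist x y)"

lemma bounded_lipschitzI:
  assumes "\<And>x. \<bar>f x\<bar> \<le> B" "\<And>x y. \<bar>f x - f y\<bar> \<le> C * dist x y"
  shows "bounded_lipschitz f"
proof -
  have "\<bar>f x - f y\<bar> \<le> max B C * dist x y" for x y
    using assms(2)[of x y] mult_right_mono[of C "max B C" "dist x y"] by force
  moreover have "\<bar>f x\<bar> \<le> max B C" for x using assms(1)[of x] by simp
  moreover have "0 \<le> max B C" using assms(1)[of undefined] by linarith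
  ultimately show ?thesis unfolding bounded_lipschitz_def by blast
qed

text \<open>For functions of the angle: the function and its derivative take all their values on one
  period, where compactness bounds them.\<close>

lemma bounded_lipschitz_periodic:
  assumes "smooth_on UNIV f" "\<And>x::real. f (x + 2 * pi) = f x"
  shows "bounded_lipschitz f"
proof -
  have per: "f x = f (x - 2 * pi * of_int \<lfloor>x / (2 * pi)\<rfloor>)" for x
  proof -
    interpret periodic_fun_simple f "2 * pi" by standard (rule assms(2))
    show ?thesis using minus_of_int[of x "\<lfloor>x / (2 * pi)\<rfloor>"] by (simp add: mult.commute)
  qed
  have perd: "deriv f (x + 2 * pi) = deriv f x" for x
  proof -
    have "((\<lambda>x. f (x + 2 * pi)) has_real_derivative deriv f (x + 2 * pi)) (at x)"
      using DERIV_shift[of f "deriv f (x + 2 * pi)" x "2 * pi"] smooth_on_real_has_derivative(1)[OF assms(1)]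
      by blast
    then have "(f has_real_derivative deriv f (x + 2 * pi)) (at x)" using assms(2) by simp
    then show ?thesis using DERIV_imp_deriv by metis
  qed
  have perd': "deriv f x = deriv f (x - 2 * pi * of_int \<lfloor>x / (2 * pi)\<rfloor>)" for x
  proof -
    interpret periodic_fun_simple "deriv f" "2 * pi" by standard (rule perd)
    show ?thesis using minus_of_int[of x "\<lfloor>x / (2 * pi)\<rfloor>"] by (simp add: mult.commute)
  qed
  have rng: "x - 2 * pi * of_int \<lfloor>x / (2 * pi)\<rfloor> \<in> {0..2 * pi}" for x
    using floor_divide_lower[of "2 * pi" x] floor_divide_upper[of "2 * pi" x] by (simp add: algebra_simps)
  have "compact (f ` {0..2 * pi})"
    using smooth_on_real_has_derivative(1)[OF assms(1)]
    by (intro compact_continuous_image continuous_at_imp_continuous_on) (auto intro: DERIV_isCont)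
  then obtain B where B: "\<And>x. x \<in> {0..2 * pi} \<Longrightarrow> \<bar>f x\<bar> \<le> B"
    by (metis bounded_iff compact_imp_bounded image_eqI real_norm_def)
  have "compact (deriv f ` {0..2 * pi})"
    using smooth_on_real_has_derivative(2)[OF assms(1)]
    by (intro compact_continuous_image) (auto intro: continuous_on_subset)
  then obtain C where C: "\<And>x. x \<in> {0..2 * pi} \<Longrightarrow> \<bar>deriv f x\<bar> \<le> C"
    by (metis bounded_iff compact_imp_bounded image_eqI real_norm_def)
  show ?thesis
  proof (rule bounded_lipschitzI)
    show "\<bar>f x\<bar> \<le> B" for x using B[OF rng] per by metis
    show "\<bar>f x - f y\<bar> \<le> C * dist x y" for x y
      using lipschitz_of_bounded_deriv[OF smooth_on_real_has_derivative(1)[OF assms(1)], of C]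
        C[OF rng] perd' unfolding dist_real_def by metis
  qed
qed

text \<open>The counterpart for functions of the height: the derivative vanishes outside a compact
  interval.\<close>

lemma bounded_lipschitz_compact_support:
  assumes "smooth_on UNIV f" "\<And>x::real. r \<le> \<bar>x\<bar> \<Longrightarrow> f x = c"
  shows "bounded_lipschitz f"
proof -
  have d0: "deriv f x = 0" if "r < \<bar>x\<bar>" for x
  proof -
    have "((\<lambda>x. c) has_real_derivative 0) (at x)" by simp
    moreover have "open {x. r < \<bar>x\<bar>}" by (intro open_Collect_less continuous_intros)
    ultimately have "(f has_real_derivative 0) (at x)"
      by (rule has_field_derivative_transform_within_open) (use that assms(2) in auto)
    then show ?thesis by (rule DERIV_imp_deriv)
  qed
  have "compact (f ` {-r..r})"
    using smooth_on_real_has_derivative(1)[OF assms(1)]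
    by (intro compact_continuous_image continuous_at_imp_continuous_on) (auto intro: DERIV_isCont)
  then obtain B where B: "\<And>x. x \<in> {-r..r} \<Longrightarrow> \<bar>f x\<bar> \<le> B"
    by (metis bounded_iff compact_imp_bounded image_eqI real_norm_def)
  have "compact (deriv f ` {-r..r})"
    using smooth_on_real_has_derivative(2)[OF assms(1)]
    by (intro compact_continuous_image) (auto intro: continuous_on_subset)
  then obtain C where C: "\<And>x. x \<in> {-r..r} \<Longrightarrow> \<bar>deriv f x\<bar> \<le> C"
    by (metis bounded_iff compact_imp_bounded image_eqI real_norm_def)
  show ?thesis
  proof (rule bounded_lipschitzI)
    show "\<bar>f x\<bar> \<le> max B \<bar>c\<bar>" for x
      using B[of x] assms(2)[of x] by (cases "r \<le> \<bar>x\<bar>") force+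
    have "\<bar>deriv f x\<bar> \<le> max C 0" for x
      using C[of x] d0[of x] by (cases "r < \<bar>x\<bar>") force+
    then show "\<bar>f x - f y\<bar> \<le> max C 0 * dist x y" for x y
      using lipschitz_of_bounded_deriv[OF smooth_on_real_has_derivative(1)[OF assms(1)], of "max C 0"]
      unfolding dist_real_def by metis
  qed
qed

lemma bounded_lipschitz_const: "bounded_lipschitz (\<lambda>x. c)"
  by (rule bounded_lipschitzI[of _ "\<bar>c\<bar>" 0]) auto

lemma bounded_lipschitz_add:
  assumes "bounded_lipschitz f" "bounded_lipschitz g"
  shows "bounded_lipschitz (\<lambda>x. f x + g x)"
proof -
  obtain B C where B: "\<And>x. \<bar>f x\<bar> \<le> B" "\<And>x y. \<bar>f x - f y\<bar> \<le> B * dist x y"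
    and C: "\<And>x. \<bar>g x\<bar> \<le> C" "\<And>x y. \<bar>g x - g y\<bar> \<le> C * dist x y"
    using assms unfolding bounded_lipschitz_def by metis
  show ?thesis
  proof (rule bounded_lipschitzI)
    show "\<bar>f x + g x\<bar> \<le> B + C" for x using B(1)[of x] C(1)[of x] by linarith
    show "\<bar>(f x + g x) - (f y + g y)\<bar> \<le> (B + C) * dist x y" for x y
      using B(2)[of x y] C(2)[of x y] by (simp add: distrib_right)
  qed
qed

lemma bounded_lipschitz_mult:
  assumes "bounded_lipschitz f" "bounded_lipschitz g"
  shows "bounded_lipschitz (\<lambda>x. f x * g x)"
proof -
  obtain B C where B: "B \<ge> 0" "\<And>x. \<bar>f x\<bar> \<le> B" "\<And>x y. \<bar>f x - f y\<bar> \<le> B * dist x y"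
    and C: "C \<ge> 0" "\<And>x. \<bar>g x\<bar> \<le> C" "\<And>x y. \<bar>g x - g y\<bar> \<le> C * dist x y"
    using assms unfolding bounded_lipschitz_def by metis
  show ?thesis
  proof (rule bounded_lipschitzI)
    show "\<bar>f x * g x\<bar> \<le> B * C" for x
      using mult_mono[OF B(2) C(2) B(1)] by (simp add: abs_mult)
    show "\<bar>f x * g x - f y * g y\<bar> \<le> (B * C + B * C) * dist x y" for x y
    proof -
      have "f x * g x - f y * g y = f x * (g x - g y) + (f x - f y) * g y"
        by (simp add: algebra_simps)
      then have "\<bar>f x * g x - f y * g y\<bar> \<le> \<bar>f x\<bar> * \<bar>g x - g y\<bar> + \<bar>f x - f y\<bar> * \<bar>g y\<bar>"
        using abs_triangle_ineq[of "f x * (g x - g y)" "(f x - f y) * g y"]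
        by (simp only: abs_mult)
      also have "\<dots> \<le> B * (C * dist x y) + (B * dist x y) * C"
        using B C by (intro add_mono mult_mono) auto
      finally show ?thesis by (simp add: algebra_simps)
    qed
  qed
qed

lemma bounded_lipschitz_sum:
  "(\<And>i. i \<in> I \<Longrightarrow> bounded_lipschitz (f i)) \<Longrightarrow> bounded_lipschitz (\<lambda>x. \<Sum>i\<in>I. f i x)"
  by (induction I rule: infinite_finite_induct) (auto intro: bounded_lipschitz_add bounded_lipschitz_const)

lemma bounded_lipschitz_compose_nonexpansive:
  assumes "bounded_lipschitz f" "\<And>x y. dist (g x) (g y) \<le> dist x y"
  shows "bounded_lipschitz (\<lambda>x. f (g x))"
proof -
  obtain B where B: "B \<ge> 0" "\<And>x. \<bar>f x\<bar> \<le> B" "\<And>x y. \<bar>f x - f y\<bar> \<le> B * dist x y"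
    using assms unfolding bounded_lipschitz_def by metis
  have "\<bar>f (g x) - f (g y)\<bar> \<le> B * dist x y" for x y
    using B(3)[of "g x" "g y"] mult_left_mono[OF assms(2)[of x y] B(1)] by linarith
  then show ?thesis using B(2) by (intro bounded_lipschitzI[of _ B B]) auto
qed

section \<open>Ordinary differential equations\<close>

lemma DERIV_leI:
  fixes f :: "real \<Rightarrow> real"
  assumes "a \<le> b" "\<And>t. t \<in> {a..b} \<Longrightarrow> (f has_real_derivative f' t) (at t)"
    and "\<And>t. t \<in> {a..b} \<Longrightarrow> m \<le> f' t"
  shows "f a + m * (b - a) \<le> f b"
proof -
  have "f a - m * a \<le> f b - m * b"
  proof (rule DERIV_nonneg_imp_nondecreasing[OF assms(1)])
    fix x assume x: "a \<le> x" "x \<le> b"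
    have "((\<lambda>x. f x - m * x) has_real_derivative f' x - m) (at x)"
      using x by (auto intro!: derivative_eq_intros assms(2))
    then show "\<exists>y. ((\<lambda>x. f x - m * x) has_real_derivative y) (at x) \<and> 0 \<le> y"
      using assms(3) x by force
  qed
  then show ?thesis by (simp add: algebra_simps)
qed

lemma DERIV_geI:
  fixes f :: "real \<Rightarrow> real"
  assumes "a \<le> b" "\<And>t. t \<in> {a..b} \<Longrightarrow> (f has_real_derivative f' t) (at t)"
    and "\<And>t. t \<in> {a..b} \<Longrightarrow> f' t \<le> m"
  shows "f b \<le> f a + m * (b - a)"
proof -
  have "- f a + (- m) * (b - a) \<le> - f b"
    using assms(3) by (intro DERIV_leI[OF assms(1) DERIV_minus[OF assms(2)]]) auto
  then show ?thesis by simp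
qed

text \<open>A barrier argument: take the last time at or above the level before some time strictly
  below it. The function equals \<open>l\<close> there, and its positive derivative contradicts that
  this time is the last.\<close>

lemma stays_above_level:
  fixes h h' :: "real \<Rightarrow> real"
  assumes der: "\<And>s. s \<in> {t0..t} \<Longrightarrow> (h has_real_derivative h' s) (at s)"
    and pos: "\<And>s. s \<in> {t0..t} \<Longrightarrow> h s = l \<Longrightarrow> 0 < h' s"
    and t: "l \<le> h t0" "t0 < t"
  shows "l < h t"
proof (rule ccontr)
  assume neg: "\<not> l < h t"
  have cont: "continuous_on A h" if "A \<subseteq> {t0..t}" for A
    using that by (intro continuous_at_imp_continuous_on ballI DERIV_isCont[OF der]) auto
  \<comment> \<open>A time strictly below the level is needed. If \<open>h t = l\<close>, the
    positive derivative at \<open>t\<close> supplies one just before \<open>t\<close>.\<close>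
  obtain t1 where t1: "t0 < t1" "h t1 < l" "t1 \<le> t"
  proof (cases "h t = l")
    case True
    obtain d where d: "d > 0" "\<And>e. 0 < e \<Longrightarrow> e < d \<Longrightarrow> h (t - e) < h t"
      using DERIV_pos_inc_left[OF der pos[OF _ True]] t(2) by auto
    define e where "e = min (d / 2) ((t - t0) / 2)"
    have "e > 0" "e < d" "t0 < t - e" using d(1) t(2) by (auto simp: e_def min_def field_simps)
    then show ?thesis using d(2)[of e] True by (intro that[of "t - e"]) auto
  next
    case False
    then show ?thesis using neg t by (intro that[of t]) auto
  qed
  define A where "A = {t0..t1} \<inter> {s. l \<le> h s}"
  have "closed A"
    using continuous_closed_preimage[OF cont, of "{t0..t1}" "{l..}"] t1(3)
    by (simp add: A_def vimage_def)
  then have "compact A" unfolding A_def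
    by (metis bounded_Int bounded_closed_interval compact_eq_bounded_closed)
  moreover have "t0 \<in> A" using t t1 by (simp add: A_def)
  ultimately obtain s where s: "s \<in> A" "\<And>u. u \<in> A \<Longrightarrow> u \<le> s"
    using compact_attains_sup[of A] by auto
  have s1: "s < t1" using s(1) t1(2) by (cases "s = t1") (auto simp: A_def)
  have "h s = l"
  proof (rule ccontr)
    assume "h s \<noteq> l"
    then have "l < h s" using s(1) by (simp add: A_def)
    then obtain u where "s \<le> u" "u \<le> t1" "h u = l"
      using IVT2'[of h t1 l s, OF _ _ _ cont] t1 s1 s(1) by (auto simp: A_def)
    then show False using s(2)[of u] s(1) \<open>l < h s\<close> by (auto simp: A_def)
  qed
  moreover have "s \<in> {t0..t}" using s(1) t1(3) by (simp add: A_def)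
  ultimately obtain d where d: "d > 0" "\<And>e. 0 < e \<Longrightarrow> e < d \<Longrightarrow> h s < h (s + e)"
    using DERIV_pos_inc_right[OF der[of s] pos[of s]] by blast
  define e where "e = min (d / 2) ((t1 - s) / 2)"
  have "e > 0" "e < d" "s + e < t1" using d(1) s1 by (auto simp: e_def min_def field_simps)
  then have "s + e \<in> A" using d(2)[of e] s(1) \<open>h s = l\<close> by (auto simp: A_def)
  then show False using s(2)[of "s + e"] \<open>e > 0\<close> by simp
qed

lemma stays_below_level_backwards:
  fixes h h' :: "real \<Rightarrow> real"
  assumes der: "\<And>s. s \<in> {t..t0} \<Longrightarrow> (h has_real_derivative h' s) (at s)"
    and pos: "\<And>s. s \<in> {t..t0} \<Longrightarrow> h s = l \<Longrightarrow> 0 < h' s"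
    and t: "h t0 \<le> l" "t < t0"
  shows "h t < l"
proof (rule ccontr)
  assume "\<not> h t < l"
  then have "l \<le> h t" by simp
  have "l < h t0"
    by (rule stays_above_level[where h = h and h' = h' and ?t0.0 = t and t = t0])
      (fact der pos t(2) \<open>l \<le> h t\<close>)+
  then show False using t(1) by linarith
qed

lemma reaches_level:
  fixes h h' :: "real \<Rightarrow> real"
  assumes der: "\<And>t. t0 \<le> t \<Longrightarrow> (h has_real_derivative h' t) (at t)"
    and m: "0 < m" "\<And>t. t0 \<le> t \<Longrightarrow> h t \<le> l \<Longrightarrow> m \<le> h' t"
    and h0: "h t0 \<le> l"
  shows "\<exists>t\<ge>t0. h t = l"
proof -
  \<comment> \<open>By this time the minimal speed \<open>m\<close> has made up for the initial
    deficit \<open>l - h t0\<close>.\<close>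
  define T where "T = t0 + (l - h t0) / m"
  have T: "t0 \<le> T" using m h0 by (simp add: T_def)
  have cont: "continuous_on {t0..t} h" for t
    by (intro continuous_at_imp_continuous_on ballI DERIV_isCont[OF der]) auto
  show ?thesis
  proof (cases "\<forall>t\<in>{t0..T}. h t \<le> l")
    case True
    then have "h t0 + m * (T - t0) \<le> h T"
      using m(2) by (intro DERIV_leI[OF T der]) auto
    then have "l \<le> h T" using m(1) by (simp add: T_def)
    then show ?thesis using IVT'[of h t0 l T, OF h0 _ T cont] by auto
  next
    case False
    then obtain t where "t0 \<le> t" "l \<le> h t" by auto
    then show ?thesis using IVT'[of h t0 l t, OF h0 _ _ cont] by auto
  qed
qed

text \<open>The weight \<open>exp (- 2 * L * t)\<close> makes the squared distance nonincreasing to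
  the right of \<open>t0\<close>, the inverse weight makes it nondecreasing to the left. The
  Lipschitz estimate is demanded only along the two given curves, so the lemma also compares a curve
  with a constant.\<close>

lemma gronwall_unique:
  fixes x y :: "real \<Rightarrow> 'a::real_inner"
  assumes x: "\<And>t. t \<in> {a..b} \<Longrightarrow> (x has_vector_derivative x' t) (at t)"
    and y: "\<And>t. t \<in> {a..b} \<Longrightarrow> (y has_vector_derivative y' t) (at t)"
    and L: "\<And>t. t \<in> {a..b} \<Longrightarrow> norm (x' t - y' t) \<le> L * norm (x t - y t)"
    and t0: "t0 \<in> {a..b}" "x t0 = y t0" and t: "t \<in> {a..b}"
  shows "x t = y t"
proof -
  define w where "w t = (x t - y t) \<bullet> (x t - y t)" for t
  define w' where "w' t = 2 * ((x t - y t) \<bullet> (x' t - y' t))" for t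
  have w': "(w has_real_derivative w' s) (at s)" if "s \<in> {a..b}" for s
  proof -
    have "((\<lambda>s. x s - y s) has_derivative (\<lambda>h. h *\<^sub>R (x' s - y' s))) (at s)"
      using has_vector_derivative_diff[OF x[OF that] y[OF that]]
      by (simp add: has_vector_derivative_def)
    from has_derivative_inner[OF this this] show ?thesis
      unfolding w_def w'_def has_field_derivative_def
      by (rule has_derivative_eq_rhs) (auto simp: inner_commute algebra_simps)
  qed
  have w'_le: "\<bar>w' s\<bar> \<le> 2 * L * w s" if "s \<in> {a..b}" for s
  proof -
    have "\<bar>w' s\<bar> \<le> 2 * (norm (x s - y s) * norm (x' s - y' s))"
      unfolding w'_def by (simp add: abs_mult Cauchy_Schwarz_ineq2)
    also have "\<dots> \<le> 2 * (norm (x s - y s) * (L * norm (x s - y s)))"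
      using L[OF that] by (simp add: mult_left_mono)
    finally show ?thesis by (simp add: w_def dot_square_norm power2_eq_square algebra_simps)
  qed
  have "w t \<le> 0"
  proof (cases "t0 \<le> t")
    case True
    have "exp (- 2 * L * t) * w t \<le> exp (- 2 * L * t0) * w t0 + 0 * (t - t0)"
    proof (rule DERIV_geI[OF True])
      fix s assume "s \<in> {t0..t}"
      then have s: "s \<in> {a..b}" using t t0 by auto
      show "((\<lambda>s. exp (- 2 * L * s) * w s) has_real_derivative
          exp (- 2 * L * s) * (w' s - 2 * L * w s)) (at s)"
        by (auto intro!: derivative_eq_intros w'[OF s] simp: algebra_simps)
      show "exp (- 2 * L * s) * (w' s - 2 * L * w s) \<le> 0"
        using w'_le[OF s] by (simp add: mult_le_0_iff)
    qed
    then show ?thesis using t0(2) by (simp add: w_def mult_le_0_iff)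
  next
    case False
    then have le: "t \<le> t0" by simp
    have "exp (2 * L * t) * w t + 0 * (t0 - t) \<le> exp (2 * L * t0) * w t0"
    proof (rule DERIV_leI[OF le])
      fix s assume "s \<in> {t..t0}"
      then have s: "s \<in> {a..b}" using t t0 by auto
      show "((\<lambda>s. exp (2 * L * s) * w s) has_real_derivative
          exp (2 * L * s) * (w' s + 2 * L * w s)) (at s)"
        by (auto intro!: derivative_eq_intros w'[OF s] simp: algebra_simps)
      show "0 \<le> exp (2 * L * s) * (w' s + 2 * L * w s)"
        using w'_le[OF s] by simp
    qed
    then show ?thesis using t0(2) by (simp add: w_def mult_le_0_iff)
  qed
  then show ?thesis unfolding w_def by (metis eq_iff_diff_eq_0 inner_gt_zero_iff not_less)
qed

text \<open>Serves both estimates of the Picard operator; negative times are reflected to positive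
  ones.\<close>

lemma norm_le_of_derivative_bound:
  fixes f :: "real \<Rightarrow> 'a::real_normed_vector"
  assumes f: "\<And>t. (f has_vector_derivative f' t) (at t)" "f 0 = 0"
    and phi: "\<And>s. (\<phi> has_real_derivative \<phi>' s) (at s)"
    and le: "\<And>t. norm (f' t) \<le> \<phi>' \<bar>t\<bar>"
  shows "norm (f t) \<le> \<phi> \<bar>t\<bar> - \<phi> 0"
proof -
  have gen: "norm (g t) \<le> \<phi> t - \<phi> 0"
    if g: "\<And>t. (g has_vector_derivative g' t) (at t)" "g 0 = 0" "\<And>t. norm (g' t) \<le> \<phi>' \<bar>t\<bar>" "t > 0"
    for g :: "real \<Rightarrow> 'a" and g' t
  proof -
    have "norm (g t - g 0) \<le> \<phi> t - \<phi> 0"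
    proof (rule differentiable_bound_general[of 0 t g \<phi> g' \<phi>'])
      show "continuous_on {0..t} g"
        using g(1) by (intro continuous_at_imp_continuous_on)
          (auto intro: has_vector_derivative_continuous)
      show "continuous_on {0..t} \<phi>"
        using phi by (intro continuous_at_imp_continuous_on) (auto intro: DERIV_isCont)
      show "(g has_vector_derivative g' s) (at s)" for s by (rule g)
      show "(\<phi> has_vector_derivative \<phi>' s) (at s)" for s
        using phi by (simp add: has_real_derivative_iff_has_vector_derivative)
      show "norm (g' s) \<le> \<phi>' s" if "0 < s" for s using g(3)[of s] that by simp
    qed (use g in auto)
    then show ?thesis using g(2) by simp
  qed
  consider "t = 0" | "t > 0" | "t < 0" by linarith
  then show ?thesis
  proof cases
    case 1
    then show ?thesis using f(2) by simp
  next
    case 2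
    then show ?thesis using gen[OF f le 2] by simp
  next
    case 3
    have "((\<lambda>s. f (- s)) has_vector_derivative - f' (- s)) (at s)" for s
    proof -
      have "(uminus has_vector_derivative - 1) (at s)"
        by (auto intro!: derivative_eq_intros)
      from vector_diff_chain_at[OF this f(1)] show ?thesis by (simp add: o_def)
    qed
    note d = this
    have "norm (- f' (- s)) \<le> \<phi>' \<bar>s\<bar>" for s using le[of "- s"] by simp
    from gen[OF d _ this, of "- t"] show ?thesis using f(2) 3 by simp
  qed
qed

text \<open>Picard iteration on the whole time axis at once. The unknown is
  \<open>exp (- 2 * L * \<bar>t\<bar>)\<close> times the deviation from \<open>x0\<close>; in this
  weighted supremum norm the integral operator contracts by one half, which gives a global solution
  without continuing local ones.\<close>

lemma ode_exists:
  fixes G :: "'a::euclidean_space \<Rightarrow> 'a"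
  assumes L: "L > 0" "\<And>u v. norm (G u - G v) \<le> L * norm (u - v)" and M: "\<And>u. norm (G u) \<le> M"
  shows "\<exists>x. x 0 = x0 \<and> (\<forall>t. (x has_vector_derivative G (x t)) (at t))"
proof -
  \<comment> \<open>\<open>F g\<close> is the right-hand side along the curve encoded by
    \<open>g\<close>, with the weight undone.\<close>
  define F where "F g s = G (x0 + exp (2 * L * \<bar>s\<bar>) *\<^sub>R apply_bcontfun g s)"
    for g :: "(real, 'a) bcontfun" and s :: real
  have "continuous_on UNIV G"
    using L by (intro lipschitz_on_continuous_on[of L] lipschitz_onI) (auto simp: dist_norm)
  have contF: "continuous_on UNIV (F g)" for g
  proof -
    have "continuous_on UNIV (\<lambda>s. x0 + exp (2 * L * \<bar>s\<bar>) *\<^sub>R apply_bcontfun g s)"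
      by (intro continuous_on_add continuous_on_const continuous_on_scaleR continuous_on_exp
          continuous_on_mult continuous_on_rabs continuous_on_id continuous_on_apply_bcontfun)
    then show ?thesis unfolding F_def[abs_def]
      by (rule continuous_on_compose2[OF \<open>continuous_on UNIV G\<close>]) simp
  qed
  have "\<exists>A. A 0 = 0 \<and> (\<forall>t. (A has_vector_derivative F g t) (at t))" for g
  proof -
    obtain A where A: "\<And>t. (A has_vector_derivative F g t) (at t)"
      using einterval_antiderivative[of "-\<infinity>" \<infinity> "F g"] contF[of g]
      by (auto simp: continuous_on_eq_continuous_at)
    have "((\<lambda>t. A t - A 0) has_vector_derivative F g t) (at t)" for t
      using A by (auto intro!: derivative_eq_intros)
    then show ?thesis by (intro exI[of _ "\<lambda>t. A t - A 0"]) auto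
  qed
  then obtain A where A: "\<And>g. A g 0 = 0" "\<And>g t. (A g has_vector_derivative F g t) (at t)"
    by metis
  have A_bound: "norm (A g t) \<le> M * \<bar>t\<bar>" for g t
    using norm_le_of_derivative_bound[OF A(2,1), of "\<lambda>s. M * s" "\<lambda>s. M"] M
    by (auto simp: F_def intro!: derivative_eq_intros)
  \<comment> \<open>Integrating the bound \<open>L * exp (2 * L * \<bar>t\<bar>) * dist g h\<close>
    yields the factor \<open>1 / 2\<close> of the contraction.\<close>
  have A_diff: "norm (A g t - A h t) \<le> dist g h * exp (2 * L * \<bar>t\<bar>) / 2" for g h t
  proof -
    have "norm (A g t - A h t) \<le> dist g h * exp (2 * L * \<bar>t\<bar>) / 2 - dist g h * exp (2 * L * 0) / 2"
    proof (rule norm_le_of_derivative_bound)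
      show "((\<lambda>t. A g t - A h t) has_vector_derivative F g t - F h t) (at t)" for t
        by (rule has_vector_derivative_diff[OF A(2) A(2)])
      show "((\<lambda>s. dist g h * exp (2 * L * s) / 2) has_real_derivative
          L * (exp (2 * L * s) * dist g h)) (at s)" for s
        by (auto intro!: derivative_eq_intros)
      show "norm (F g t - F h t) \<le> L * (exp (2 * L * \<bar>t\<bar>) * dist g h)" for t
      proof -
        have "norm (F g t - F h t) \<le> L * (exp (2 * L * \<bar>t\<bar>) * norm (apply_bcontfun g t - apply_bcontfun h t))"
          using L(2)[of "x0 + exp (2 * L * \<bar>t\<bar>) *\<^sub>R apply_bcontfun g t"
              "x0 + exp (2 * L * \<bar>t\<bar>) *\<^sub>R apply_bcontfun h t"]
          by (simp add: F_def flip: scaleR_diff_right)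
        also have "\<dots> \<le> L * (exp (2 * L * \<bar>t\<bar>) * dist g h)"
          using L(1) dist_bounded[of g t h] by (simp add: dist_norm)
        finally show ?thesis .
      qed
    qed (simp add: A)
    then show ?thesis by (smt (verit) divide_nonneg_nonneg exp_ge_zero mult_nonneg_nonneg zero_le_dist)
  qed
  define T where "T g t = exp (- (2 * L * \<bar>t\<bar>)) *\<^sub>R A g t" for g t
  have "T g \<in> bcontfun" for g
  proof (rule bcontfun_normI)
    show "continuous_on UNIV (T g)" unfolding T_def[abs_def]
      using A(2) by (intro continuous_intros continuous_at_imp_continuous_on)
        (auto intro: has_vector_derivative_continuous)
    show "norm (T g t) \<le> M / (2 * L)" for t
    proof -
      have "norm (T g t) \<le> exp (- (2 * L * \<bar>t\<bar>)) * (M * \<bar>t\<bar>)"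
        unfolding T_def using A_bound[of g t] by simp
      also have "\<dots> = M / (2 * L) * (exp (- (2 * L * \<bar>t\<bar>)) * (2 * L * \<bar>t\<bar>))"
        using L(1) by simp
      also have "\<dots> \<le> M / (2 * L) * 1"
      proof (rule mult_left_mono)
        have "2 * L * \<bar>t\<bar> \<le> exp (2 * L * \<bar>t\<bar>)"
          using exp_ge_add_one_self[of "2 * L * \<bar>t\<bar>"] by linarith
        then show "exp (- (2 * L * \<bar>t\<bar>)) * (2 * L * \<bar>t\<bar>) \<le> 1"
          by (simp add: exp_minus field_simps)
        show "0 \<le> M / (2 * L)" using L(1) M[of x0] norm_ge_zero[of "G x0"] by (simp del: norm_ge_zero)
      qed
      finally show ?thesis by simp
    qed
  qed
  then have app: "apply_bcontfun (Bcontfun (T g)) = T g" for g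
    by (simp add: Bcontfun_inverse)
  have "\<exists>!g. Bcontfun (T g) = g"
  proof (rule banach_fix_type[of "1 / 2"])
    show "\<forall>g h. dist (Bcontfun (T g)) (Bcontfun (T h)) \<le> 1 / 2 * dist g h"
    proof (intro allI dist_bound)
      fix g h t
      have "dist (T g t) (T h t) = exp (- (2 * L * \<bar>t\<bar>)) * norm (A g t - A h t)"
        by (simp add: T_def dist_norm flip: scaleR_diff_right)
      also have "\<dots> \<le> exp (- (2 * L * \<bar>t\<bar>)) * (dist g h * exp (2 * L * \<bar>t\<bar>) / 2)"
        using A_diff[of g t h] by simp
      also have "\<dots> = 1 / 2 * dist g h" by (simp add: exp_minus field_simps)
      finally show "dist (apply_bcontfun (Bcontfun (T g)) t) (apply_bcontfun (Bcontfun (T h)) t)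
        \<le> 1 / 2 * dist g h" by (simp add: app)
    qed
  qed auto
  then obtain g where "Bcontfun (T g) = g" by auto
  then have g: "apply_bcontfun g = T g" using app by metis
  have eq: "exp (2 * L * \<bar>s\<bar>) *\<^sub>R apply_bcontfun g s = A g s" for s
    by (simp add: g T_def exp_minus)
  have "((\<lambda>t. x0 + A g t) has_vector_derivative G (x0 + A g t)) (at t)" for t
  proof -
    have "F g t = G (x0 + A g t)" by (simp add: F_def eq)
    then show ?thesis using A(2)[of g t] by (auto intro!: derivative_eq_intros)
  qed
  then show ?thesis by (intro exI[of _ "\<lambda>t. x0 + A g t"]) (simp add: A)
qed

section \<open>Planar systems\<close>

definition planar_solution ::
    "(real \<Rightarrow> real \<Rightarrow> real) \<Rightarrow> (real \<Rightarrow> real \<Rightarrow> real) \<Rightarrow> (real \<Rightarrow> real) \<Rightarrow> (real \<Rightarrow> real) \<Rightarrow> real \<Rightarrow> bool" where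
  "planar_solution f g x y t \<longleftrightarrow>
     (x has_real_derivative f (x t) (y t)) (at t) \<and> (y has_real_derivative g (x t) (y t)) (at t)"

lemma planar_solution_shift:
  assumes "planar_solution f g x y (t + c)"
  shows "planar_solution f g (\<lambda>t. x (t + c)) (\<lambda>t. y (t + c)) t"
  using assms unfolding planar_solution_def by (simp add: DERIV_shift)

lemma planar_lipschitz:
  assumes "bounded_lipschitz (\<lambda>p. f (fst p) (snd p))" "bounded_lipschitz (\<lambda>p. g (fst p) (snd p))"
  obtains L where "L > 0"
    "\<And>u v. norm ((f (fst u) (snd u), g (fst u) (snd u)) - (f (fst v) (snd v), g (fst v) (snd v)))
       \<le> L * norm (u - v :: real \<times> real)"
    "\<And>u. norm (f (fst u) (snd u), g (fst u) (snd u)) \<le> L"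
proof -
  obtain B C where B: "B \<ge> 0" "\<And>p. \<bar>f (fst p) (snd p)\<bar> \<le> B"
      "\<And>p q. \<bar>f (fst p) (snd p) - f (fst q) (snd q)\<bar> \<le> B * dist p q"
    and C: "C \<ge> 0" "\<And>p. \<bar>g (fst p) (snd p)\<bar> \<le> C"
      "\<And>p q. \<bar>g (fst p) (snd p) - g (fst q) (snd q)\<bar> \<le> C * dist p q"
    using assms unfolding bounded_lipschitz_def by metis
  show ?thesis
  proof (rule that[of "B + C + 1"])
    fix u v :: "real \<times> real"
    have "norm ((f (fst u) (snd u), g (fst u) (snd u)) - (f (fst v) (snd v), g (fst v) (snd v)))
       \<le> B * norm (u - v) + C * norm (u - v)"
      using norm_Pair_le[of "f (fst u) (snd u) - f (fst v) (snd v)" "g (fst u) (snd u) - g (fst v) (snd v)"]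
        B(3)[of u v] C(3)[of u v] by (simp add: dist_norm)
    also have "\<dots> \<le> (B + C + 1) * norm (u - v)" by (simp add: distrib_right)
    finally show "norm ((f (fst u) (snd u), g (fst u) (snd u)) - (f (fst v) (snd v), g (fst v) (snd v)))
       \<le> (B + C + 1) * norm (u - v)" .
    show "norm (f (fst u) (snd u), g (fst u) (snd u)) \<le> B + C + 1"
      using norm_Pair_le[of "f (fst u) (snd u)" "g (fst u) (snd u)"] B(2)[of u] C(2)[of u] by simp
  qed (use B C in simp)
qed

text \<open>Both curves have to solve the system on the interval only. This matters for the
  coordinates of a plug, which obey the standard equations just while the orbit is in its
  window.\<close>

lemma planar_unique:
  assumes bl: "bounded_lipschitz (\<lambda>p. f (fst p) (snd p))" "bounded_lipschitz (\<lambda>p. g (fst p) (snd p))"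
    and sol: "\<And>t. t \<in> {a..b} \<Longrightarrow> planar_solution f g x y t"
      "\<And>t. t \<in> {a..b} \<Longrightarrow> planar_solution f g x' y' t"
    and t0: "t0 \<in> {a..b}" "x t0 = x' t0" "y t0 = y' t0" and t: "t \<in> {a..b}"
  shows "x t = x' t \<and> y t = y' t"
proof -
  obtain L where L: "\<And>u v. norm ((f (fst u) (snd u), g (fst u) (snd u)) - (f (fst v) (snd v), g (fst v) (snd v)))
       \<le> L * norm (u - v :: real \<times> real)"
    using planar_lipschitz[OF bl] by metis
  have "(x t, y t) = (x' t, y' t)"
  proof (rule gronwall_unique[where x = "\<lambda>t. (x t, y t)" and y = "\<lambda>t. (x' t, y' t)" and t = t
        and x' = "\<lambda>t. (f (x t) (y t), g (x t) (y t))" and y' = "\<lambda>t. (f (x' t) (y' t), g (x' t) (y' t))" and L = L and ?t0.0 = t0 and a = a and b = b])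
    fix t assume t: "t \<in> {a..b}"
    show "((\<lambda>t. (x t, y t)) has_vector_derivative (f (x t) (y t), g (x t) (y t))) (at t)"
      using sol(1)[OF t] unfolding planar_solution_def
      by (auto intro!: has_vector_derivative_Pair simp: has_real_derivative_iff_has_vector_derivative)
    show "((\<lambda>t. (x' t, y' t)) has_vector_derivative (f (x' t) (y' t), g (x' t) (y' t))) (at t)"
      using sol(2)[OF t] unfolding planar_solution_def
      by (auto intro!: has_vector_derivative_Pair simp: has_real_derivative_iff_has_vector_derivative)
    show "norm ((f (x t) (y t), g (x t) (y t)) - (f (x' t) (y' t), g (x' t) (y' t))) \<le>
        L * norm ((x t, y t) - (x' t, y' t))"
      using L[of "(x t, y t)" "(x' t, y' t)"] by simp
  qed (use t0 t in auto)
  then show ?thesis by simp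
qed

lemma planar_exists:
  assumes "bounded_lipschitz (\<lambda>p. f (fst p) (snd p))" "bounded_lipschitz (\<lambda>p. g (fst p) (snd p))"
  obtains x y where "x t0 = x0" "y t0 = y0" "\<And>t. planar_solution f g x y t"
proof -
  obtain L where L: "L > 0" "\<And>u v. norm ((f (fst u) (snd u), g (fst u) (snd u)) - (f (fst v) (snd v), g (fst v) (snd v)))
       \<le> L * norm (u - v :: real \<times> real)" "\<And>u. norm (f (fst u) (snd u), g (fst u) (snd u)) \<le> L"
    using planar_lipschitz[OF assms] by metis
  obtain z :: "real \<Rightarrow> real \<times> real" where z: "z 0 = (x0, y0)"
      "\<And>t. (z has_vector_derivative (f (fst (z t)) (snd (z t)), g (fst (z t)) (snd (z t)))) (at t)"
    using ode_exists[OF L, of "(x0, y0)"] by auto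
  have "planar_solution f g (\<lambda>t. fst (z t)) (\<lambda>t. snd (z t)) t" for t
    using bounded_linear.has_vector_derivative[OF bounded_linear_fst z(2)[of t]]
      bounded_linear.has_vector_derivative[OF bounded_linear_snd z(2)[of t]]
    unfolding planar_solution_def by (simp add: has_real_derivative_iff_has_vector_derivative)
  then have "planar_solution f g (\<lambda>t. fst (z (t + - t0))) (\<lambda>t. snd (z (t + - t0))) t" for t
    by (rule planar_solution_shift)
  then show ?thesis using z(1) by (intro that[of "\<lambda>t. fst (z (t + - t0))" "\<lambda>t. snd (z (t + - t0))"]) auto
qed

section \<open>The standard plug\<close>

definition crit :: real where "crit = sqrt (1 / 2)"

lemma crit_squared: "crit\<^sup>2 = 1 / 2" by (simp add: crit_def)

lemma crit_bounds: "1 / 2 < crit" "crit < 1"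
proof -
  show "1 / 2 < crit" unfolding crit_def by (rule real_less_rsqrt) (simp add: power2_eq_square)
  show "crit < 1" unfolding crit_def by simp
qed

lemma dip_crit [simp]: "dip crit = 1" "dip (- crit) = 1"
  by (simp_all add: dip_eq_1_iff crit_squared)

lemma dip_less_1: "crit < \<bar>y\<bar> \<Longrightarrow> dip y < 1"
  using crit_bounds power_strict_mono[of crit "\<bar>y\<bar>" 2]
  by (simp add: dip_less_1_iff crit_squared)

lemma dip_greater_1: "\<bar>y\<bar> < crit \<Longrightarrow> 1 < dip y"
  using power_strict_mono[of "\<bar>y\<bar>" crit 2] dip_less_1_iff[of y] dip_eq_1_iff[of y]
  by (simp add: crit_squared)

text \<open>The standard plug: a vertical unit drift slowed down by \<open>dip\<close>, together
  with a contraction towards the axis \<open>x = 0\<close>. On the axis the vertical speed is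
  \<open>1 - dip y\<close>, which gives a sink at \<open>- crit\<close> and a saddle at
  \<open>crit\<close>. The contraction has rate 1 for \<open>x\<^sup>2 \<le> 2\<close> and
  \<open>y\<^sup>2 \<le> 2\<close>, hence wherever the drift can fail to point upwards; so there are
  no singular points off the axis.\<close>

definition plug_x :: "real \<Rightarrow> real \<Rightarrow> real" where
  "plug_x x y = - x * plateau 3 x * plateau 3 y"

definition plug_y :: "real \<Rightarrow> real \<Rightarrow> real" where
  "plug_y x y = 1 - plateau 2 x * dip y"

lemma bounded_lipschitz_fst: "bounded_lipschitz f \<Longrightarrow> bounded_lipschitz (\<lambda>p. f (fst p))"
  by (rule bounded_lipschitz_compose_nonexpansive) (simp_all add: dist_fst_le)

lemma bounded_lipschitz_snd: "bounded_lipschitz f \<Longrightarrow> bounded_lipschitz (\<lambda>p. f (snd p))"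
  by (rule bounded_lipschitz_compose_nonexpansive) (simp_all add: dist_snd_le)

lemma two_le_abs_imp: "2 \<le> \<bar>x\<bar> \<Longrightarrow> 4 \<le> (x::real)\<^sup>2"
  using power_mono[of 2 "\<bar>x\<bar>" 2] by simp

lemma bounded_lipschitz_plateau: "r \<le> 4 \<Longrightarrow> bounded_lipschitz (plateau r)"
  using two_le_abs_imp
  by (intro bounded_lipschitz_compact_support[of _ 2 0] smooth_on_plateau plateau_eq_0) force

lemma bounded_lipschitz_dip: "bounded_lipschitz dip"
  using two_le_abs_imp
  by (intro bounded_lipschitz_compact_support[of _ 2 0] smooth_on_dip dip_eq_0) force

lemma bounded_lipschitz_plug_x: "bounded_lipschitz (\<lambda>p. plug_x (fst p) (snd p))"
proof -
  have "bounded_lipschitz (\<lambda>x. - x * plateau 3 x)"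
    using two_le_abs_imp
    by (intro bounded_lipschitz_compact_support[of _ 2 0] smooth_on_mult smooth_on_plateau smooth_on_uminus smooth_on_id)
      (force simp: plateau_eq_0)+
  from bounded_lipschitz_mult[OF bounded_lipschitz_fst[OF this]
      bounded_lipschitz_snd[OF bounded_lipschitz_plateau[of 3]]]
  show ?thesis by (simp add: plug_x_def)
qed

lemma bounded_lipschitz_plug_y: "bounded_lipschitz (\<lambda>p. plug_y (fst p) (snd p))"
proof -
  have "bounded_lipschitz (\<lambda>p::real \<times> real. 1 + (- 1) * (plateau 2 (fst p) * dip (snd p)))"
    by (intro bounded_lipschitz_add bounded_lipschitz_mult bounded_lipschitz_const
        bounded_lipschitz_fst bounded_lipschitz_snd bounded_lipschitz_plateau bounded_lipschitz_dip) auto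
  then show ?thesis by (simp add: plug_y_def)
qed

lemmas plug_unique = planar_unique[OF bounded_lipschitz_plug_x bounded_lipschitz_plug_y]
  and plug_exists = planar_exists[OF bounded_lipschitz_plug_x bounded_lipschitz_plug_y]

abbreviation plug_solution :: "(real \<Rightarrow> real) \<Rightarrow> (real \<Rightarrow> real) \<Rightarrow> real \<Rightarrow> bool" where
  "plug_solution \<equiv> planar_solution plug_x plug_y"

lemma plug_y_le_1: "plug_y x y \<le> 1"
  by (simp add: plug_y_def plateau_nonneg dip_nonneg)

lemma plug_y_eq_1: "1 \<le> \<bar>y\<bar> \<Longrightarrow> plug_y x y = 1"
  using power_mono[of 1 "\<bar>y\<bar>" 2] by (simp add: plug_y_def dip_eq_0)

lemma plug_y_pos: "crit < \<bar>y\<bar> \<Longrightarrow> 0 < plug_y x y"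
  using dip_less_1[of y] plateau_le_1[of 2 x] plateau_nonneg[of 2 x] dip_nonneg[of y]
    mult_right_mono[of "plateau 2 x" 1 "dip y"] by (simp add: plug_y_def)

lemma plug_inner:
  assumes "\<bar>x\<bar> \<le> 1" "\<bar>y\<bar> \<le> 1"
  shows "plug_x x y = - x" "plug_y x y = 1 - dip y"
proof -
  have "x\<^sup>2 \<le> 1" "y\<^sup>2 \<le> 1" using assms by (simp_all add: abs_square_le_1)
  then show "plug_x x y = - x" "plug_y x y = 1 - dip y"
    by (simp_all add: plug_x_def plug_y_def plateau_eq_1)
qed

lemma plug_solution_minus: "plug_solution x y t \<Longrightarrow> plug_solution (\<lambda>t. - x t) y t"
  unfolding planar_solution_def plug_x_def plug_y_def by (auto intro!: derivative_eq_intros)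

lemma plug_solution_square_mono:
  assumes "\<And>s. s \<in> {a..b} \<Longrightarrow> plug_solution x y s" "a \<le> b"
  shows "(x b)\<^sup>2 \<le> (x a)\<^sup>2"
proof -
  have "(x b)\<^sup>2 \<le> (x a)\<^sup>2 + 0 * (b - a)"
  proof (rule DERIV_geI[OF assms(2)])
    fix s assume "s \<in> {a..b}"
    then show "((\<lambda>t. (x t)\<^sup>2) has_real_derivative - (2 * (x s)\<^sup>2 * plateau 3 (x s) * plateau 3 (y s))) (at s)"
      using assms(1)[of s] unfolding planar_solution_def plug_x_def
      by (auto intro!: derivative_eq_intros simp: power2_eq_square)
    show "- (2 * (x s)\<^sup>2 * plateau 3 (x s) * plateau 3 (y s)) \<le> 0"
      by (simp add: plateau_nonneg)
  qed
  then show ?thesis by simp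
qed

text \<open>The saddle of the plug is \<open>(0, crit)\<close>; the plug is entered from below at \<open>y = - 2\<close>.\<close>

definition plug_separatrix :: "real \<Rightarrow> (real \<Rightarrow> real) \<Rightarrow> (real \<Rightarrow> real) \<Rightarrow> real \<Rightarrow> bool" where
  "plug_separatrix r x y \<tau> \<longleftrightarrow>
     (\<forall>t. plug_solution x y t) \<and> x 0 = r \<and> y 0 = - 2 \<and> 0 < \<tau> \<and>
     (\<forall>t\<le>\<tau>. 1 \<le> x t \<and> y t \<le> crit) \<and> (\<forall>t\<ge>\<tau>. x t = exp (\<tau> - t) \<and> y t = crit)"

text \<open>Near the saddle its stable manifold is the segment \<open>y = crit\<close>,
  \<open>\<bar>x\<bar> \<le> 1\<close>, so the branch is followed backwards from
  \<open>(1, crit)\<close>. Within half a time unit it leaves the strip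
  \<open>x\<^sup>2 < 2\<close>; beyond it the drift has unit speed, so the branch goes straight down
  to \<open>y = - 2\<close>.\<close>

lemma plug_separatrix_exists: "\<exists>r x y \<tau>. plug_separatrix r x y \<tau>"
proof -
  obtain x y where x0: "x 0 = 1" and y0: "y 0 = crit" and sol: "\<And>t. plug_solution x y t"
    using plug_exists[of 0 1 crit] by metis
  note dx = sol[unfolded planar_solution_def, THEN conjunct1]
    and dy = sol[unfolded planar_solution_def, THEN conjunct2]
  have fwd: "x t = exp (- t) \<and> y t = crit" if "0 \<le> t" for t
  proof (rule plug_unique[of 0 t x y "\<lambda>t. exp (- t)" "\<lambda>t. crit" 0 t])
    show "plug_solution (\<lambda>t. exp (- t)) (\<lambda>t. crit) s" if "s \<in> {0..t}" for s
    proof -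
      have "exp (- s) \<le> 1" using that by simp
      then show ?thesis using plug_inner[of "exp (- s)" crit] crit_bounds
        unfolding planar_solution_def by (auto intro!: derivative_eq_intros)
    qed
  qed (use sol that x0 y0 in auto)
  have sq: "1 \<le> (x t)\<^sup>2" if "t \<le> 0" for t
    using plug_solution_square_mono[OF sol that] x0 by simp
  have contx: "continuous_on A x" for A
    by (intro continuous_at_imp_continuous_on ballI DERIV_isCont[OF dx])
  have x1: "1 \<le> x t" if tle: "t \<le> 0" for t
  proof (rule ccontr)
    assume "\<not> 1 \<le> x t"
    then have "\<bar>x t\<bar> \<noteq> x t" using sq[OF tle] abs_square_less_1[of "x t"] by linarith
    then have "x t \<le> 0" by linarith
    then obtain s where "s \<le> 0" "x s = 0"
      using IVT'[of x t 0 0, OF _ _ tle contx] x0 by auto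
    then show False using sq[of s] by simp
  qed
  have y1: "y t \<le> crit" if "t \<le> 0" for t
  proof (cases "t = 0")
    case False
    then have t: "t < 0" using that by simp
    show ?thesis
    \<comment> \<open>At height \<open>crit\<close> itself the vertical speed may vanish, so the
      barrier argument is applied to all higher levels instead.\<close>
    proof (rule dense_ge)
      fix l assume l: "crit < l"
      have "y t < l"
      proof (rule stays_below_level_backwards[OF dy _ _ t])
        show "0 < plug_y (x s) (y s)" if "y s = l" for s
          using plug_y_pos[of "y s"] l that crit_bounds by auto
      qed (use l y0 in auto)
      then show "y t \<le> l" by simp
    qed
  qed (simp add: y0)
  have ylow: "crit - 1 / 2 \<le> y t" if "t \<in> {-1/2..0}" for t
  proof -
    have "y 0 \<le> y t + 1 * (0 - t)"
      using that plug_y_le_1 by (intro DERIV_geI[OF _ dy]) auto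
    then show ?thesis using that y0 by simp
  qed
  \<comment> \<open>Inside the strip the equation would be \<open>x' = - x\<close>, and going back
    by \<open>1 / 2\<close> would multiply \<open>x\<close> by \<open>exp (1 / 2)\<close>, whose
    square is \<open>exp 1 \<ge> 2\<close>.\<close>
  have x2: "2 \<le> (x (-1/2))\<^sup>2"
  proof (rule ccontr)
    assume neg: "\<not> 2 \<le> (x (-1/2))\<^sup>2"
    have d: "((\<lambda>t. exp t * x t) has_real_derivative 0) (at t)" if t: "t \<in> {-1/2..0}" for t
    proof -
      have "(x t)\<^sup>2 \<le> 2" using plug_solution_square_mono[OF sol, of "-1/2" t] t neg by simp
      moreover have "\<bar>y t\<bar> \<le> 1" using y1[of t] ylow[OF t] t crit_bounds by auto
      then have "(y t)\<^sup>2 \<le> 2" using abs_square_le_1[of "y t"] by simp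
      ultimately have "plug_x (x t) (y t) = - x t" by (simp add: plug_x_def plateau_eq_1)
      then show ?thesis using dx[of t] by (auto intro!: derivative_eq_intros)
    qed
    have "exp (-1/2) * x (-1/2) + 0 * (0 - (-1/2)) \<le> exp 0 * x 0"
        "exp 0 * x 0 \<le> exp (-1/2) * x (-1/2) + 0 * (0 - (-1/2))"
      by (rule DERIV_leI[OF _ d] DERIV_geI[OF _ d]; simp)+
    then have "exp (-1/2) * x (-1/2) = 1" using x0 by simp
    then have "x (-1/2) = exp (1/2)" by (simp add: exp_minus field_simps)
    then have "(x (-1/2))\<^sup>2 = exp 1" by (simp add: power2_eq_square flip: exp_add)
    then show False using neg exp_ge_add_one_self[of 1] by simp
  qed
  have yback: "y t = y (-1/2) + (t + 1/2)" if "t \<le> -1/2" for t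
  proof -
    have d: "(y has_real_derivative 1) (at s)" if "s \<in> {t..-1/2}" for s
    proof -
      have "2 \<le> (x s)\<^sup>2" using plug_solution_square_mono[OF sol, of s "-1/2"] x2 that by simp
      then have "plug_y (x s) (y s) = 1" by (simp add: plug_y_def plateau_eq_0)
      then show ?thesis using dy[of s] by simp
    qed
    have "y t + 1 * (-1/2 - t) \<le> y (-1/2)" "y (-1/2) \<le> y t + 1 * (-1/2 - t)"
      by (rule DERIV_leI[OF that d] DERIV_geI[OF that d]; simp)+
    then show ?thesis by simp
  qed
  \<comment> \<open>At unit speed, the descent from \<open>y (-1/2)\<close> at time
    \<open>- 1 / 2\<close> is at height \<open>- 2\<close> at time \<open>- \<tau>\<close>.\<close>
  define \<tau> where "\<tau> = y (-1/2) + 5/2"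
  have \<tau>: "1/2 < \<tau>" using ylow[of "-1/2"] crit_bounds by (simp add: \<tau>_def)
  have "plug_separatrix (x (- \<tau>)) (\<lambda>t. x (t + - \<tau>)) (\<lambda>t. y (t + - \<tau>)) \<tau>"
    unfolding plug_separatrix_def
  proof (intro conjI allI impI)
    show "plug_solution (\<lambda>t. x (t + - \<tau>)) (\<lambda>t. y (t + - \<tau>)) t" for t
      by (rule planar_solution_shift[OF sol])
    show "y (0 + - \<tau>) = - 2" using yback[of "- \<tau>"] \<tau> by (simp add: \<tau>_def)
  qed (use \<tau> fwd x1 y1 in auto)
  then show ?thesis by blast
qed

text \<open>Defined by choice, as the abscissa has no evident closed form. What is used of it: it is
  at least 1, and up to sign it is the only abscissa at height \<open>- 2\<close> from which the
  saddle is reached.\<close>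

definition plug_entry :: real where
  "plug_entry = (SOME r. \<exists>x y \<tau>. plug_separatrix r x y \<tau>)"

lemma plug_entry_separatrix:
  obtains x y \<tau> where "plug_separatrix plug_entry x y \<tau>"
  using plug_separatrix_exists someI_ex[of "\<lambda>r. \<exists>x y \<tau>. plug_separatrix r x y \<tau>"]
  unfolding plug_entry_def by metis

lemma plug_entry_ge_1: "1 \<le> plug_entry"
proof -
  obtain x y \<tau> where "plug_separatrix plug_entry x y \<tau>" by (rule plug_entry_separatrix)
  then show ?thesis unfolding plug_separatrix_def by (metis less_imp_le)
qed

lemma plug_solution_level:
  assumes sol: "\<And>t. plug_solution x y t" and "y t = - 2"
  shows "t < s \<Longrightarrow> - 2 < y s" "s < t \<Longrightarrow> y s < - 2"
proof -
  note dy = sol[unfolded planar_solution_def, THEN conjunct2]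
  show "- 2 < y s" if "t < s"
    using assms(2) plug_y_eq_1 by (intro stays_above_level[OF dy _ _ that]) auto
  show "y s < - 2" if "s < t"
    using assms(2) plug_y_eq_1 by (intro stays_below_level_backwards[OF dy _ _ that]) auto
qed

text \<open>A solution that meets the segment \<open>y = crit\<close>, \<open>0 < x \<le> 1\<close>
  is a time shift of the chosen separatrix, and height \<open>- 2\<close> is passed only once, so
  both pass it at the same point.\<close>

lemma plug_separatrix_unique_aux:
  assumes sol: "\<And>t. plug_solution x y t" and t0: "y t0 = - 2"
    and t1: "t0 \<le> t1" "y t1 = crit" "0 < x t1" "x t1 \<le> 1"
  shows "x t0 = plug_entry"
proof -
  obtain X Y \<tau> where sep: "plug_separatrix plug_entry X Y \<tau>" by (rule plug_entry_separatrix)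
  then have S: "\<And>t. plug_solution X Y t" "X 0 = plug_entry" "Y 0 = - 2"
      "\<And>t. t \<ge> \<tau> \<Longrightarrow> X t = exp (\<tau> - t) \<and> Y t = crit"
    unfolding plug_separatrix_def by auto
  \<comment> \<open>The shift solves \<open>exp (\<tau> - (t1 + c)) = x t1\<close>.\<close>
  define c where "c = \<tau> - ln (x t1) - t1"
  have "ln (x t1) \<le> 0" using t1 by simp
  then have "X (t1 + c) = x t1" "Y (t1 + c) = y t1"
    using S(4)[of "t1 + c"] t1 by (simp_all add: c_def)
  then have eq: "x t0 = X (t0 + c) \<and> y t0 = Y (t0 + c)"
    using t1(1) by (intro plug_unique[of t0 t1, OF sol planar_solution_shift[OF S(1)]]) auto
  then have "t0 + c = 0"
    using t0 plug_solution_level[OF S(1,3), of "t0 + c"] by (cases "t0 + c" "0::real" rule: linorder_cases) auto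
  then show ?thesis using eq S(2) by simp
qed

text \<open>Late in time the orbit is where \<open>y' = 1 - dip y\<close>, which pushes
  \<open>y\<close> away from \<open>crit\<close> on either side; convergence thus forces
  \<open>y = crit\<close> exactly. The square in the conclusion accounts for the mirror symmetry in
  \<open>x\<close>.\<close>

lemma plug_separatrix_unique:
  assumes sol: "\<And>t. plug_solution x y t" and t0: "y t0 = - 2"
    and lim: "(x \<longlongrightarrow> 0) at_top" "(y \<longlongrightarrow> crit) at_top"
  shows "(x t0)\<^sup>2 = plug_entry\<^sup>2"
proof -
  note dy = sol[unfolded planar_solution_def, THEN conjunct2]
  have "\<forall>\<^sub>F t in at_top. \<bar>x t\<bar> < 1"
    using order_tendstoD(2)[OF tendsto_rabs[OF lim(1)], of 1] by simp
  moreover have "\<forall>\<^sub>F t in at_top. 0 < y t" "\<forall>\<^sub>F t in at_top. y t < 1"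
    using order_tendstoD[OF lim(2)] crit_bounds by auto
  moreover have "\<forall>\<^sub>F t in at_top. t0 < t" by (rule eventually_gt_at_top)
  ultimately have "\<forall>\<^sub>F t in at_top. \<bar>x t\<bar> < 1 \<and> 0 < y t \<and> y t < 1 \<and> t0 < t"
    by eventually_elim auto
  then obtain t1 where t1: "\<And>t. t1 \<le> t \<Longrightarrow> \<bar>x t\<bar> < 1 \<and> 0 < y t \<and> y t < 1 \<and> t0 < t"
    unfolding eventually_at_top_linorder by auto
  have inner: "plug_y (x t) (y t) = 1 - dip (y t)" if "t1 \<le> t" for t
    using plug_inner[of "x t" "y t"] t1[OF that] by auto
  have y1: "y t1 = crit"
  proof (rule ccontr)
    assume "y t1 \<noteq> crit"
    then consider "crit < y t1" | "y t1 < crit" by linarith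
    then show False
    proof cases
      case 1
      have "y t1 < y t" if "t1 < t" for t
        using 1 crit_bounds plug_y_pos by (intro stays_above_level[OF dy _ _ that]) auto
      then have "y t1 \<le> crit"
        by (intro tendsto_lowerbound[OF lim(2)] eventually_mono[OF eventually_gt_at_top[of t1]]) (auto intro: less_imp_le)
      then show False using 1 by simp
    next
      case 2
      have "- y t1 < - y t" if "t1 < t" for t
      proof (rule stays_above_level[OF DERIV_minus[OF dy] _ _ that])
        show "0 < - plug_y (x s) (y s)" if "s \<in> {t1..t}" "- y s = - y t1" for s
          using inner[of s] that dip_greater_1[of "y s"] 2 t1[of t1] by auto
      qed auto
      then have "crit \<le> y t1"
        by (intro tendsto_upperbound[OF lim(2)] eventually_mono[OF eventually_gt_at_top[of t1]]) (auto intro: less_imp_le)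
      then show False using 2 by simp
    qed
  qed
  have t01: "t0 \<le> t1" and x1: "\<bar>x t1\<bar> \<le> 1" using t1[of t1] by auto
  consider "x t1 = 0" | "x t1 > 0" | "x t1 < 0" by linarith
  then show ?thesis
  proof cases
    \<comment> \<open>On the axis the orbit would be the saddle at rest and could not have been at
      height \<open>- 2\<close>.\<close>
    case 1
    have "plug_solution (\<lambda>t. 0) (\<lambda>t. crit) t" for t
      using plug_inner[of 0 crit] crit_bounds unfolding planar_solution_def by simp
    then have "y t0 = crit"
      using plug_unique[of t0 t1 x y "\<lambda>t. 0" "\<lambda>t. crit" t1 t0] sol t01 1 y1 by auto
    then show ?thesis using t0 crit_bounds by simp
  next
    case 2
    then show ?thesis using plug_separatrix_unique_aux[OF sol t0 t01 y1] x1 by auto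
  next
    case 3
    then show ?thesis
      using plug_separatrix_unique_aux[OF plug_solution_minus[OF sol] t0 t01 y1] x1
      by (metis abs_le_D2 neg_0_less_iff_less power2_minus)
  qed
qed

text \<open>In the standard plug this orbit ends in the sink. The contraction is zero on the axis,
  so it is also an orbit of the reversed plug, where it is the separatrix that enters the saddle
  from below.\<close>

lemma plug_axis_orbit:
  obtains y where "y 0 = - 2" "\<And>t. (y has_real_derivative 1 - dip (y t)) (at t)"
    "\<And>t. 0 \<le> t \<Longrightarrow> - 2 \<le> y t \<and> y t < - crit" "(y \<longlongrightarrow> - crit) at_top"
proof -
  have "bounded_lipschitz (\<lambda>p. plug_y 0 (snd p))"
    unfolding plug_y_def using bounded_lipschitz_add[OF bounded_lipschitz_const[of 1]
      bounded_lipschitz_mult[OF bounded_lipschitz_const[of "- plateau 2 0"] bounded_lipschitz_snd[OF bounded_lipschitz_dip]]]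
    by simp
  from planar_exists[OF bounded_lipschitz_const[of 0] this, of 0 0 "- 2"]
  obtain y where y0: "y 0 = - 2" and dy0: "\<And>t. (y has_real_derivative plug_y 0 (y t)) (at t)"
    unfolding planar_solution_def by metis
  have sol: "plug_solution (\<lambda>t. 0) y t" for t
    using dy0 unfolding planar_solution_def by (simp add: plug_x_def)
  have dy: "(y has_real_derivative 1 - dip (y t)) (at t)" for t
    using dy0[of t] by (simp add: plug_y_def plateau_eq_1)
  have cont: "continuous_on {0..t} y" for t
    by (intro continuous_at_imp_continuous_on ballI DERIV_isCont[OF dy])
  have low: "- 2 \<le> y t" if "0 \<le> t" for t
    using plug_solution_level(1)[OF sol y0, of t] that y0 by (cases "t = 0") auto
  have up: "y t < - crit" if tge: "0 \<le> t" for t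
  proof (rule ccontr)
    assume "\<not> y t < - crit"
    then obtain s where s: "0 \<le> s" "y s = - crit"
      using IVT'[of y 0 "- crit" t, OF _ _ tge cont] y0 crit_bounds by auto
    have "plug_solution (\<lambda>t. 0) (\<lambda>t. - crit) t" for t
      using plug_inner[of 0 "- crit"] crit_bounds unfolding planar_solution_def by simp
    then have "y 0 = - crit"
      using plug_unique[of 0 s "\<lambda>t. 0" y "\<lambda>t. 0" "\<lambda>t. - crit" s 0] sol s by auto
    then show False using y0 crit_bounds by simp
  qed
  have "\<forall>\<^sub>F t in at_top. l < y t" if l: "l < - crit" for l
  proof (cases "l < - 2")
    case True
    then show ?thesis using low by (auto simp: eventually_at_top_linorder intro: less_le_trans)
  next
    case False
    \<comment> \<open>On \<open>[- 2, l]\<close> the speed \<open>1 - dip\<close> has a positive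
      minimum, so the level \<open>l\<close> is reached, and it is not crossed downwards
      again.\<close>
    have "Ck_on 0 UNIV dip" using smooth_on_dip unfolding smooth_on_def by blast
    then have cont': "continuous_on {-2..l} (\<lambda>z. 1 - dip z)"
      by (intro continuous_intros) (auto intro: continuous_on_subset)
    have ne: "{-2..l} \<noteq> {}" using False by simp
    obtain z where z: "z \<in> {-2..l}" "\<And>w. w \<in> {-2..l} \<Longrightarrow> 1 - dip z \<le> 1 - dip w"
      using continuous_attains_inf[OF compact_Icc ne cont'] by blast
    have "0 < 1 - dip z" using dip_less_1[of z] z(1) l crit_bounds by auto
    then obtain t where t: "t \<ge> 0" "y t = l"
      using reaches_level[of 0 y "\<lambda>t. 1 - dip (y t)" "1 - dip z" l] dy z(2) low False y0 by auto
    have "l < y s" if "t < s" for s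
    proof (rule stays_above_level[OF dy _ _ that])
      show "0 < 1 - dip (y s)" if "y s = l" for s
        using dip_less_1[of "y s"] that l crit_bounds by auto
    qed (use t in auto)
    then show ?thesis using eventually_gt_at_top[of t] by (rule eventually_mono[rotated])
  qed
  moreover have "\<forall>\<^sub>F t in at_top. y t < l" if l: "- crit < l" for l
    using up l by (auto simp: eventually_at_top_linorder intro: less_trans)
  ultimately have "(y \<longlongrightarrow> - crit) at_top" by (intro order_tendstoI)
  then show ?thesis using that y0 dy low up by blast
qed

section \<open>Charts on arcs\<close>

text \<open>The chart \<open>\<delta> \<mapsto> q sin \<delta> / (cos \<delta> - cos W)\<close> maps the arc \<open>\<bar>\<delta>\<bar> < W\<close> onto the real line;
  formulated through \<open>cos\<close> and \<open>sin\<close>, everything is periodic in \<open>\<delta>\<close>.\<close>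

definition arc_chart :: "real \<Rightarrow> real \<Rightarrow> real \<Rightarrow> real" where
  "arc_chart W q d = q * sin d / (cos d - cos W)"

definition arc_chart' :: "real \<Rightarrow> real \<Rightarrow> real \<Rightarrow> real" where
  "arc_chart' W q d = q * (1 - cos d * cos W) / (cos d - cos W)\<^sup>2"

text \<open>The angular velocity that becomes \<open>x * plateau 3 x\<close> in the chart. It
  vanishes near the ends of the arc, where the chart is unbounded, so the extension by 0 is
  smooth.\<close>

definition arc_speed :: "real \<Rightarrow> real \<Rightarrow> real \<Rightarrow> real" where
  "arc_speed W q d =
     (if cos W < cos d then arc_chart W q d * plateau 3 (arc_chart W q d) / arc_chart' W q d else 0)"

definition arc_bump :: "real \<Rightarrow> real \<Rightarrow> real \<Rightarrow> real" where
  "arc_bump W q d = (if cos W < cos d then plateau 2 (arc_chart W q d) else 0)"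

text \<open>\<open>W < pi\<close> keeps part of the circle outside the arc. The scale
  \<open>q\<close> is free and will move the value \<open>plug_entry\<close> of the chart to a
  prescribed angle.\<close>

locale arc =
  fixes W q :: real
  assumes W: "0 < W" "W < pi" and q: "0 < q"
begin

lemma cos_W: "- 1 < cos W" "cos W < 1"
  using W cos_monotone_0_pi[of W pi] cos_monotone_0_pi[of 0 W] by auto

lemma cos_prod_less_1: "cos d * cos W < 1"
proof -
  have "\<bar>cos d * cos W\<bar> \<le> \<bar>cos W\<bar>"
    by (simp add: abs_mult mult_left_le_one_le)
  also have "\<dots> < 1" using cos_W by simp
  finally show ?thesis by simp
qed

lemma chart'_pos: "cos W < cos d \<Longrightarrow> 0 < arc_chart' W q d"
  using q cos_prod_less_1[of d] by (simp add: arc_chart'_def)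

lemma chart_has_derivative:
  assumes "cos W < cos d"
  shows "(arc_chart W q has_real_derivative arc_chart' W q d) (at d)"
proof -
  have "(arc_chart W q has_real_derivative
      (q * cos d * (cos d - cos W) - q * sin d * (- sin d)) / ((cos d - cos W) * (cos d - cos W))) (at d)"
    unfolding arc_chart_def[abs_def] using assms by (auto intro!: derivative_eq_intros)
  moreover have "q * cos d * (cos d - cos W) - q * sin d * (- sin d) = q * (1 - cos d * cos W)"
    using sin_cos_squared_add3[of d] by algebra
  ultimately show ?thesis by (simp add: arc_chart'_def power2_eq_square)
qed

lemma chart_squared: "(arc_chart W q d)\<^sup>2 * (cos d - cos W)\<^sup>2 = q\<^sup>2 * (1 - (cos d)\<^sup>2)"
  if "cos W < cos d"
  using that by (simp add: arc_chart_def power_divide power_mult_distrib sin_squared_eq)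

text \<open>Ensures that no angles other than the two prescribed ones lead into the saddle. It is
  phrased by \<open>cos d\<close>, which ignores the sign of \<open>d\<close> and multiples of
  \<open>2 * pi\<close>.\<close>

lemma chart_squared_inj:
  assumes "cos W < cos d" "cos W < cos e" "(arc_chart W q d)\<^sup>2 = (arc_chart W q e)\<^sup>2"
  shows "cos d = cos e"
proof (rule ccontr)
  let ?C = "cos W" and ?x = "cos d" and ?y = "cos e"
  assume ne: "?x \<noteq> ?y"
  have "(1 - ?x\<^sup>2) * (?y - ?C)\<^sup>2 * q\<^sup>2 = (1 - ?y\<^sup>2) * (?x - ?C)\<^sup>2 * q\<^sup>2"
    using chart_squared[OF assms(1)] chart_squared[OF assms(2)] assms(3)
    by algebra
  then have "(1 - ?x\<^sup>2) * (?y - ?C)\<^sup>2 = (1 - ?y\<^sup>2) * (?x - ?C)\<^sup>2" using q by simp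
  \<comment> \<open>The difference of the two sides factors, and the second factor is a sum of two
    positive terms.\<close>
  then have "(?y - ?x) * ((?x - ?C) * (1 - ?C * ?y) + (?y - ?C) * (1 - ?C * ?x)) = 0"
    by algebra
  moreover have "0 < (?x - ?C) * (1 - ?C * ?y)" "0 < (?y - ?C) * (1 - ?C * ?x)"
    using assms cos_prod_less_1[of d] cos_prod_less_1[of e] by (simp_all add: mult.commute)
  ultimately show False using ne by auto
qed

lemma chart_eq_0: "cos W < cos d \<Longrightarrow> arc_chart W q d = 0 \<longleftrightarrow> cos d = 1"
proof -
  assume a: "cos W < cos d"
  have "sin d = 0 \<longleftrightarrow> cos d = 1"
    using a cos_W sin_cos_squared_add3[of d] cos_one_sin_zero sin_zero_abs_cos_one[of d] by force
  then show ?thesis using a q by (simp add: arc_chart_def)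
qed

text \<open>A quantitative form of the fact that the chart vanishes only on the axis; it lets
  convergence of the chart to 0 control the angle.\<close>

lemma one_minus_cos_le:
  assumes "cos W < cos d"
  shows "1 - cos d \<le> 4 / (q\<^sup>2 * (1 + cos W)) * (arc_chart W q d)\<^sup>2"
proof -
  have "(cos d - cos W)\<^sup>2 \<le> 2\<^sup>2"
    using assms cos_W cos_le_one[of d] by (intro power_mono) linarith+
  then have "q\<^sup>2 * (1 - (cos d)\<^sup>2) \<le> (arc_chart W q d)\<^sup>2 * 4"
    unfolding chart_squared[OF assms, symmetric] by (intro mult_left_mono) auto
  moreover have "(1 - cos d) * (1 + cos W) \<le> 1 - (cos d)\<^sup>2"
    using assms mult_left_mono[of "1 + cos W" "1 + cos d" "1 - cos d"]
    by (simp add: power2_eq_square algebra_simps)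
  then have "q\<^sup>2 * ((1 - cos d) * (1 + cos W)) \<le> q\<^sup>2 * (1 - (cos d)\<^sup>2)"
    by (intro mult_left_mono) auto
  ultimately have "(1 - cos d) * (q\<^sup>2 * (1 + cos W)) \<le> 4 * (arc_chart W q d)\<^sup>2"
    by (simp add: algebra_simps)
  then show ?thesis using q cos_W by (simp add: pos_le_divide_eq)
qed

lemma chart_tendsto_0_iff:
  assumes "\<forall>\<^sub>F t in F. cos W < cos (g t)"
  shows "((\<lambda>t. arc_chart W q (g t)) \<longlongrightarrow> 0) F \<longleftrightarrow> ((\<lambda>t. cos (g t)) \<longlongrightarrow> 1) F"
proof
  assume lim: "((\<lambda>t. arc_chart W q (g t)) \<longlongrightarrow> 0) F"
  have "((\<lambda>t. 4 / (q\<^sup>2 * (1 + cos W)) * (arc_chart W q (g t))\<^sup>2) \<longlongrightarrow> 4 / (q\<^sup>2 * (1 + cos W)) * 0\<^sup>2) F"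
    by (intro tendsto_intros lim)
  then have lim0: "((\<lambda>t. 4 / (q\<^sup>2 * (1 + cos W)) * (arc_chart W q (g t))\<^sup>2) \<longlongrightarrow> 0) F" by simp
  have "((\<lambda>t. 1 - cos (g t)) \<longlongrightarrow> 0) F"
  proof (rule tendsto_sandwich[OF _ _ tendsto_const lim0])
    show "\<forall>\<^sub>F t in F. 1 - cos (g t) \<le> 4 / (q\<^sup>2 * (1 + cos W)) * (arc_chart W q (g t))\<^sup>2"
      using assms by (rule eventually_mono) (rule one_minus_cos_le)
  qed simp
  from tendsto_diff[OF tendsto_const[of 1] this] show "((\<lambda>t. cos (g t)) \<longlongrightarrow> 1) F" by simp
next
  assume lim: "((\<lambda>t. cos (g t)) \<longlongrightarrow> 1) F"
  have "((\<lambda>t. q\<^sup>2 * (1 - (cos (g t))\<^sup>2) / (cos (g t) - cos W)\<^sup>2) \<longlongrightarrow> q\<^sup>2 * (1 - 1\<^sup>2) / (1 - cos W)\<^sup>2) F"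
    using cos_W by (intro tendsto_intros lim) auto
  moreover have "\<forall>\<^sub>F t in F. q\<^sup>2 * (1 - (cos (g t))\<^sup>2) / (cos (g t) - cos W)\<^sup>2 = (arc_chart W q (g t))\<^sup>2"
    using assms by (rule eventually_mono) (simp add: chart_squared[symmetric])
  ultimately have "((\<lambda>t. (arc_chart W q (g t))\<^sup>2) \<longlongrightarrow> 0) F"
    using tendsto_cong by fastforce
  then show "((\<lambda>t. arc_chart W q (g t)) \<longlongrightarrow> 0) F"
    by (simp add: power_tendsto_0_iff)
qed

lemma open_arc: "open {d. cos W < cos d}"
  by (intro open_Collect_less continuous_intros)

lemma smooth_on_chart: "smooth_on {d. cos W < cos d} (arc_chart W q)"
  unfolding arc_chart_def[abs_def]
  using smooth_on_cos_real[of 0] smooth_on_sin_real[of 0]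
  by (intro smooth_on_divide smooth_on_diff smooth_on_mult smooth_on_const open_arc)
    (auto intro: smooth_on_subset)

lemma smooth_on_chart': "smooth_on {d. cos W < cos d} (arc_chart' W q)"
  unfolding arc_chart'_def[abs_def]
  using smooth_on_cos_real[of 0]
  by (intro smooth_on_divide smooth_on_diff smooth_on_mult smooth_on_power smooth_on_const open_arc)
    (auto intro: smooth_on_subset)

lemma smooth_on_plateau_chart: "smooth_on {d. cos W < cos d} (\<lambda>d. plateau r (arc_chart W q d))"
  by (rule smooth_on_compose[OF open_arc _ _ smooth_on_chart smooth_on_plateau]) auto

text \<open>At an endpoint of the arc the numerator \<open>q * sin d\<close> of the chart is nonzero
  and its denominator is zero, so the chart is large on the part of the arc near this point and the
  function is 0 on a whole neighbourhood.\<close>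

lemma smooth_on_arc_cover:
  assumes "smooth_on {d. cos W < cos d} f"
    and "\<And>d. \<lbrakk>cos W < cos d; 3 < (arc_chart W q d)\<^sup>2\<rbrakk> \<Longrightarrow> f d = 0"
    and "\<And>d. cos d \<le> cos W \<Longrightarrow> f d = 0"
  shows "smooth_on UNIV (f :: real \<Rightarrow> real)"
proof (rule smooth_on_local)
  fix d :: real
  \<comment> \<open>\<open>?U\<close> contains the complement of the open arc and, on the arc, the points with \<open>3 < (arc_chart W q d)\<^sup>2\<close>.\<close>
  let ?U = "{d. cos d < cos W} \<union> {d. 3 * (cos d - cos W)\<^sup>2 < q\<^sup>2 * (sin d)\<^sup>2}"
  show "\<exists>U. open U \<and> d \<in> U \<and> smooth_on U f"
  proof (cases "cos W < cos d")
    case True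
    then show ?thesis using open_arc assms(1) by blast
  next
    case False
    have U: "open ?U"
      by (intro open_Un open_Collect_less continuous_intros)
    moreover have "d \<in> ?U"
    proof (cases "cos d = cos W")
      case True
      then have "sin d \<noteq> 0"
        using cos_W sin_zero_abs_cos_one[of d] by auto
      then show ?thesis using True q by simp
    qed (use False in auto)
    moreover have "f d = 0" if "d \<in> ?U" for d
    proof (cases "cos W < cos d")
      case True
      then have "3 < (arc_chart W q d)\<^sup>2"
        using that by (auto simp: arc_chart_def power_divide power_mult_distrib pos_less_divide_eq)
      then show ?thesis using True assms(2) by blast
    qed (use assms(3) in auto)
    then have "smooth_on ?U f"
      by (intro smooth_on_cong[OF U _ smooth_on_const[of _ 0]]) auto
    ultimately show ?thesis by blast
  qed
qed

lemma smooth_on_arc_speed: "smooth_on UNIV (arc_speed W q)"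
proof (rule smooth_on_arc_cover)
  have "smooth_on {d. cos W < cos d} (\<lambda>d. arc_chart W q d * plateau 3 (arc_chart W q d) / arc_chart' W q d)"
    using chart'_pos
    by (intro smooth_on_divide smooth_on_mult smooth_on_chart smooth_on_plateau_chart smooth_on_chart' open_arc)
      force
  then show "smooth_on {d. cos W < cos d} (arc_speed W q)"
    by (rule smooth_on_cong[OF open_arc, rotated]) (simp add: arc_speed_def)
qed (auto simp: arc_speed_def plateau_eq_0)

lemma smooth_on_arc_bump: "smooth_on UNIV (arc_bump W q)"
proof (rule smooth_on_arc_cover)
  show "smooth_on {d. cos W < cos d} (arc_bump W q)"
    by (rule smooth_on_cong[OF open_arc _ smooth_on_plateau_chart[of 2]]) (simp add: arc_bump_def)
qed (auto simp: arc_bump_def plateau_eq_0)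

lemma bounded_lipschitz_arc_speed: "bounded_lipschitz (arc_speed W q)"
  by (rule bounded_lipschitz_periodic[OF smooth_on_arc_speed])
    (simp add: arc_speed_def arc_chart_def arc_chart'_def)

lemma bounded_lipschitz_arc_bump: "bounded_lipschitz (arc_bump W q)"
  by (rule bounded_lipschitz_periodic[OF smooth_on_arc_bump])
    (simp add: arc_bump_def arc_chart_def)

text \<open>On the axis the chart vanishes, so in the product rule only \<open>arc_chart'\<close>
  times its own inverse survives: the rate is 1 whatever the width and the scale. Up to sign this is
  the horizontal eigenvalue.\<close>

lemma arc_speed_has_derivative:
  assumes "cos d = 1"
  shows "(arc_speed W q has_real_derivative 1) (at d)"
proof -
  have d: "cos W < cos d" using assms cos_W by simp
  then have c0: "arc_chart W q d = 0" using chart_eq_0 assms by blast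
  define g where "g d = plateau 3 (arc_chart W q d) / arc_chart' W q d" for d
  have "smooth_on {d. cos W < cos d} g"
    unfolding g_def[abs_def] using chart'_pos
    by (intro smooth_on_divide smooth_on_plateau_chart smooth_on_chart' open_arc) force
  then have "Ck_on (Suc 0) {d. cos W < cos d} g" unfolding smooth_on_def by blast
  then obtain D where D: "(g has_real_derivative D) (at d)"
    using d real_differentiable_def by auto
  have "((\<lambda>d. arc_chart W q d * g d) has_real_derivative 1) (at d)"
    using chart'_pos[OF d] DERIV_mult[OF chart_has_derivative[OF d] D]
    by (simp add: c0 g_def plateau_eq_1)
  then show ?thesis
    by (rule has_field_derivative_transform_within_open[OF _ open_arc])
      (use d in \<open>auto simp: arc_speed_def g_def\<close>)
qed

lemma arc_bump_has_derivative:
  assumes "cos d = 1"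
  shows "(arc_bump W q has_real_derivative 0) (at d)"
proof -
  have d: "cos W < cos d" using assms cos_W by simp
  then have c0: "arc_chart W q d = 0" using chart_eq_0 assms by blast
  have cont: "continuous_on {d. cos W < cos d} (arc_chart W q)"
    using smooth_on_chart unfolding smooth_on_def by (metis Ck_on.simps(1))
  have "open ({d. cos W < cos d} \<inter> arc_chart W q -` {-1<..<1})"
    by (rule continuous_open_preimage[OF cont open_arc]) auto
  moreover have "((\<lambda>d. 1::real) has_real_derivative 0) (at d)" by simp
  moreover have "1 = arc_bump W q e" if "e \<in> {d. cos W < cos d} \<inter> arc_chart W q -` {-1<..<1}" for e
    using that abs_square_le_1[of "arc_chart W q e"] by (auto simp: arc_bump_def plateau_eq_1)
  ultimately show ?thesis
    using has_field_derivative_transform_within_open[of "\<lambda>d. 1" 0 d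
        "{d. cos W < cos d} \<inter> arc_chart W q -` {-1<..<1}" "arc_bump W q"] d c0 by simp
qed

end

section \<open>Fields with plugs on the cylinder\<close>

lemma sum_single:
  fixes g :: "'a \<Rightarrow> real"
  assumes "finite K" "k \<in> K" "\<And>j. j \<in> K \<Longrightarrow> j \<noteq> k \<Longrightarrow> g j = 0"
  shows "(\<Sum>j\<in>K. g j) = g k"
  using sum.mono_neutral_right[of K "{k}" g] assms by auto

lemma tendsto_at_top_eqI:
  fixes x y :: "real \<Rightarrow> real"
  assumes "(x \<longlongrightarrow> c) at_top" "\<And>t. t0 \<le> t \<Longrightarrow> y t = x t"
  shows "(y \<longlongrightarrow> c) at_top"
  by (rule Lim_transform_eventually[OF assms(1) eventually_at_top_linorderI[of t0]]) (simp add: assms(2))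

text \<open>\<open>th k\<close> is the centre of the arc of plug \<open>k\<close>,
  \<open>W k\<close> its half-width, \<open>kp k\<close> the scale of its chart, and
  \<open>om\<close> the sense of rotation along the equator. \<open>0 \<notin> K\<close> keeps the
  band around the equator free of plugs. The family is closed under time reversal with reflection in
  \<open>h\<close>.\<close>

locale plug_field =
  fixes K :: "int set" and om :: real and th W kp sg :: "int \<Rightarrow> real"
  assumes K: "finite K" "0 \<notin> K"
    and om: "om = 1 \<or> om = - 1"
    and arc_param: "k \<in> K \<Longrightarrow> arc (W k) (kp k)"
    and sg: "k \<in> K \<Longrightarrow> sg k = 1 \<or> sg k = - 1"
begin

text \<open>On the cylinder the field is \<open>\<theta>' = al \<theta> h\<close>, \<open>h' = be \<theta> h\<close>. For \<open>\<bar>h\<bar> \<le> 1\<close> it is \<open>(- 2 pi om, h\<^sup>2)\<close>, which has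
  the return map \<open>s \<mapsto> s / (1 - s)\<close>, the time-one map of \<open>s\<^sup>2\<close>, when \<open>om = 1\<close>. The plug with index \<open>k\<close>, time-reversed and
  reflected in \<open>h = 4 k\<close> if \<open>sg k = - 1\<close>, occupies the heights \<open>\<bar>h - 4 k\<bar> \<le> 2\<close>.\<close>

definition al :: "real \<Rightarrow> real \<Rightarrow> real" where
  "al \<theta> h = - 2 * pi * om * plateau 2 h -
     (\<Sum>k\<in>K. sg k * arc_speed (W k) (kp k) (\<theta> - th k) * plateau 3 (h - 4 * real_of_int k))"

definition be :: "real \<Rightarrow> real \<Rightarrow> real" where
  "be \<theta> h = 1 - plateau 2 h * (1 - h\<^sup>2) -
     (\<Sum>k\<in>K. arc_bump (W k) (kp k) (\<theta> - th k) * dip (h - 4 * real_of_int k))"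

abbreviation in_arc :: "int \<Rightarrow> real \<Rightarrow> bool" where
  "in_arc k \<theta> \<equiv> k \<in> K \<and> cos (W k) < cos (\<theta> - th k)"

abbreviation xi :: "int \<Rightarrow> real \<Rightarrow> real" where
  "xi k \<theta> \<equiv> arc_chart (W k) (kp k) (\<theta> - th k)"

definition flow :: "(real \<Rightarrow> real) \<Rightarrow> (real \<Rightarrow> real) \<Rightarrow> bool" where
  "flow \<theta> h \<longleftrightarrow> (\<forall>t. planar_solution al be \<theta> h t)"

text \<open>Convergence to the saddle of plug \<open>k\<close>, written on the cylinder; the angle
  enters through \<open>cos\<close> because it matters only modulo \<open>2 * pi\<close>.\<close>

definition tends :: "int \<Rightarrow> (real \<Rightarrow> real) \<Rightarrow> (real \<Rightarrow> real) \<Rightarrow> real filter \<Rightarrow> bool" where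
  "tends k \<theta> h F \<longleftrightarrow>
     k \<in> K \<and> ((\<lambda>t. cos (\<theta> t - th k)) \<longlongrightarrow> 1) F \<and> (h \<longlongrightarrow> 4 * real_of_int k + sg k * crit) F"

text \<open>The stable separatrices of saddle \<open>k\<close> enter its plug from below at these angles; for \<open>sg k = - 1\<close> the saddle
  is below the source and only the separatrix on the axis of the plug does.\<close>

definition hits :: "int \<Rightarrow> real \<Rightarrow> bool" where
  "hits k \<theta> \<longleftrightarrow> in_arc k \<theta> \<and> (xi k \<theta>)\<^sup>2 = (if sg k = 1 then plug_entry\<^sup>2 else 0)"

lemma bounded_lipschitz_al: "bounded_lipschitz (\<lambda>p. al (fst p) (snd p))"
proof -
  have s: "bounded_lipschitz (\<lambda>p::real \<times> real. arc_speed (W k) (kp k) (fst p - th k))" if "k \<in> K" for k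
    by (rule bounded_lipschitz_fst[OF bounded_lipschitz_compose_nonexpansive[OF arc.bounded_lipschitz_arc_speed[OF arc_param[OF that]]]])
      (simp add: dist_real_def)
  have p: "bounded_lipschitz (\<lambda>p::real \<times> real. plateau 3 (snd p - 4 * real_of_int k))" for k :: int
    by (rule bounded_lipschitz_snd[OF bounded_lipschitz_compose_nonexpansive[OF bounded_lipschitz_plateau]])
      (simp_all add: dist_real_def)
  have "bounded_lipschitz (\<lambda>p::real \<times> real. (- 2 * pi * om) * plateau 2 (snd p) + (- 1) *
     (\<Sum>k\<in>K. sg k * arc_speed (W k) (kp k) (fst p - th k) * plateau 3 (snd p - 4 * real_of_int k)))"
    by (intro bounded_lipschitz_add bounded_lipschitz_mult bounded_lipschitz_sum bounded_lipschitz_const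
        bounded_lipschitz_snd[OF bounded_lipschitz_plateau] s p) auto
  then show ?thesis by (simp add: al_def)
qed

lemma bounded_lipschitz_be: "bounded_lipschitz (\<lambda>p. be (fst p) (snd p))"
proof -
  have s: "bounded_lipschitz (\<lambda>p::real \<times> real. arc_bump (W k) (kp k) (fst p - th k))" if "k \<in> K" for k
    by (rule bounded_lipschitz_fst[OF bounded_lipschitz_compose_nonexpansive[OF arc.bounded_lipschitz_arc_bump[OF arc_param[OF that]]]])
      (simp add: dist_real_def)
  have p: "bounded_lipschitz (\<lambda>p::real \<times> real. dip (snd p - 4 * real_of_int k))" for k :: int
    by (rule bounded_lipschitz_snd[OF bounded_lipschitz_compose_nonexpansive[OF bounded_lipschitz_dip]])
      (simp_all add: dist_real_def)
  have "bounded_lipschitz (\<lambda>h. plateau 2 h * (1 - h\<^sup>2))"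
    using two_le_abs_imp
    by (intro bounded_lipschitz_compact_support[of _ 2 0] smooth_on_mult smooth_on_plateau smooth_on_diff
        smooth_on_const smooth_on_power smooth_on_id) (force simp: plateau_eq_0)+
  then have "bounded_lipschitz (\<lambda>p::real \<times> real. 1 + (- 1) * (plateau 2 (snd p) * (1 - (snd p)\<^sup>2)) + (- 1) *
     (\<Sum>k\<in>K. arc_bump (W k) (kp k) (fst p - th k) * dip (snd p - 4 * real_of_int k)))"
    by (intro bounded_lipschitz_add bounded_lipschitz_mult[OF bounded_lipschitz_const] bounded_lipschitz_sum
        bounded_lipschitz_const bounded_lipschitz_mult[OF s p] bounded_lipschitz_snd) auto
  then show ?thesis by (simp add: be_def)
qed

lemmas flow_unique = planar_unique[OF bounded_lipschitz_al bounded_lipschitz_be]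

lemma flow_exists:
  obtains \<theta> h where "\<theta> t0 = \<theta>0" "h t0 = h0" "flow \<theta> h"
  using planar_exists[OF bounded_lipschitz_al bounded_lipschitz_be, of t0 \<theta>0 h0] unfolding flow_def by metis

lemma flow_deriv:
  assumes "flow \<theta> h"
  shows "(\<theta> has_real_derivative al (\<theta> t) (h t)) (at t)" "(h has_real_derivative be (\<theta> t) (h t)) (at t)"
  using assms unfolding flow_def planar_solution_def by auto

lemma flow_eqI:
  assumes "flow \<theta> h" "flow \<theta>' h'" "\<theta> t0 = \<theta>' t0" "h t0 = h' t0"
  shows "\<theta> t = \<theta>' t" "h t = h' t"
  using flow_unique[of "min t t0" "max t t0" \<theta> h \<theta>' h' t0 t] assms unfolding flow_def by auto

lemma flow_continuous: "flow \<theta> h \<Longrightarrow> continuous_on A \<theta>" "flow \<theta> h \<Longrightarrow> continuous_on A h"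
  by (intro continuous_at_imp_continuous_on ballI DERIV_isCont[OF flow_deriv(1)] DERIV_isCont[OF flow_deriv(2)]; assumption)+

text \<open>The windows \<open>\<bar>h - 4 * k\<bar> \<le> 2\<close> cover the height axis and meet
  only at their ends, and all cutoffs of a plug vanish outside its own window. So in each window at
  most one term of the sums survives.\<close>

lemma window_disjoint:
  assumes "\<bar>h - 4 * real_of_int k\<bar> \<le> 2" "j \<noteq> k"
  shows "plateau 3 (h - 4 * real_of_int j) = 0" "dip (h - 4 * real_of_int j) = 0"
proof -
  have "1 \<le> \<bar>real_of_int j - real_of_int k\<bar>" using assms(2) by linarith
  then have "2 \<le> \<bar>h - 4 * real_of_int j\<bar>" using assms(1) by linarith
  then have "4 \<le> (h - 4 * real_of_int j)\<^sup>2" by (rule two_le_abs_imp)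
  then show "plateau 3 (h - 4 * real_of_int j) = 0" "dip (h - 4 * real_of_int j) = 0" by (simp_all add: plateau_eq_0 dip_eq_0)
qed

lemma window_base:
  assumes "\<bar>h - 4 * real_of_int k\<bar> \<le> 2" "k \<noteq> 0"
  shows "plateau 2 h = 0"
proof -
  have "1 \<le> \<bar>real_of_int k\<bar>" using assms(2) by linarith
  then have "2 \<le> \<bar>h\<bar>" using assms(1) by linarith
  then have "4 \<le> h\<^sup>2" by (rule two_le_abs_imp)
  then show ?thesis by (simp add: plateau_eq_0)
qed

lemma field_plug:
  assumes "k \<in> K" "\<bar>h - 4 * real_of_int k\<bar> \<le> 2"
  shows "al \<theta> h = - sg k * arc_speed (W k) (kp k) (\<theta> - th k) * plateau 3 (h - 4 * real_of_int k)"
    and "be \<theta> h = 1 - arc_bump (W k) (kp k) (\<theta> - th k) * dip (h - 4 * real_of_int k)"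
proof -
  have "k \<noteq> 0" using assms(1) K by auto
  note b = window_base[OF assms(2) this]
  have "(\<Sum>j\<in>K. sg j * arc_speed (W j) (kp j) (\<theta> - th j) * plateau 3 (h - 4 * real_of_int j)) =
      sg k * arc_speed (W k) (kp k) (\<theta> - th k) * plateau 3 (h - 4 * real_of_int k)"
    using window_disjoint[OF assms(2)] by (intro sum_single K assms(1)) auto
  then show "al \<theta> h = - sg k * arc_speed (W k) (kp k) (\<theta> - th k) * plateau 3 (h - 4 * real_of_int k)"
    by (simp add: al_def b)
  have "(\<Sum>j\<in>K. arc_bump (W j) (kp j) (\<theta> - th j) * dip (h - 4 * real_of_int j)) =
      arc_bump (W k) (kp k) (\<theta> - th k) * dip (h - 4 * real_of_int k)"
    using window_disjoint[OF assms(2)] by (intro sum_single K assms(1)) auto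
  then show "be \<theta> h = 1 - arc_bump (W k) (kp k) (\<theta> - th k) * dip (h - 4 * real_of_int k)"
    by (simp add: be_def b)
qed

lemma field_no_plug:
  assumes "k \<notin> K" "\<bar>h - 4 * real_of_int k\<bar> \<le> 2"
  shows "al \<theta> h = - 2 * pi * om * plateau 2 h" "be \<theta> h = 1 - plateau 2 h * (1 - h\<^sup>2)"
proof -
  have "plateau 3 (h - 4 * real_of_int j) = 0 \<and> dip (h - 4 * real_of_int j) = 0" if "j \<in> K" for j
    using window_disjoint[OF assms(2)] that assms(1) by metis
  then show "al \<theta> h = - 2 * pi * om * plateau 2 h" "be \<theta> h = 1 - plateau 2 h * (1 - h\<^sup>2)"
    by (simp_all add: al_def be_def)
qed

lemma field_base:
  assumes "\<bar>h\<bar> \<le> 2"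
  shows "al \<theta> h = - 2 * pi * om * plateau 2 h" "be \<theta> h = 1 - plateau 2 h * (1 - h\<^sup>2)"
  using field_no_plug[of 0 h] K assms by auto

lemma field_empty:
  assumes "k \<notin> K" "k \<noteq> 0" "\<bar>h - 4 * real_of_int k\<bar> \<le> 2"
  shows "al \<theta> h = 0" "be \<theta> h = 1"
  using field_no_plug[OF assms(1,3)] window_base[OF assms(3,2)] by simp_all

lemma field_core: "\<bar>h\<bar> \<le> 1 \<Longrightarrow> al \<theta> h = - 2 * pi * om" "\<bar>h\<bar> \<le> 1 \<Longrightarrow> be \<theta> h = h\<^sup>2"
  using field_base[of h] abs_square_le_1[of h] by (simp_all add: plateau_eq_1)

lemma be_base_pos:
  assumes "\<bar>h\<bar> \<le> 2" "h \<noteq> 0"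
  shows "0 < be \<theta> h"
proof (cases "h\<^sup>2 \<le> 1")
  case True
  then show ?thesis using assms by (simp add: field_base plateau_eq_1)
next
  case False
  then have "plateau 2 h * (1 - h\<^sup>2) \<le> 0" by (simp add: mult_nonneg_nonpos plateau_nonneg)
  then show ?thesis using assms by (simp add: field_base)
qed

lemma window_exists:
  obtains k :: int where "\<bar>h - 4 * real_of_int k\<bar> \<le> 2"
proof -
  have "\<bar>h - 4 * real_of_int (round (h / 4))\<bar> \<le> 2"
    using of_int_round_abs_le[of "h / 4"] by linarith
  then show ?thesis by (rule that)
qed

text \<open>These heights separate the windows. Being crossed at speed 1 whatever the windows
  contain, they act as one-way gates for every orbit.\<close>

lemma be_level: "be \<theta> (4 * real_of_int k + 2) = 1"
proof (cases "k = 0")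
  case True
  then show ?thesis using field_base[of 2] by (simp add: plateau_eq_0)
next
  case False
  show ?thesis
  proof (cases "k \<in> K")
    case True
    then show ?thesis using field_plug(2)[OF True, of "4 * real_of_int k + 2"] by (simp add: dip_eq_0)
  next
    case F: False
    then show ?thesis using field_empty(2)[OF F False, of "4 * real_of_int k + 2"] by simp
  qed
qed

lemma level_up:
  assumes "flow \<theta> h" "4 * real_of_int k + 2 \<le> h t0" "t0 < t"
  shows "4 * real_of_int k + 2 < h t"
  by (rule stays_above_level[OF flow_deriv(2)[OF assms(1)] _ assms(2,3)]) (simp add: be_level)

lemma level_down:
  assumes "flow \<theta> h" "h t0 \<le> 4 * real_of_int k + 2" "t < t0"
  shows "h t < 4 * real_of_int k + 2"
  by (rule stays_below_level_backwards[OF flow_deriv(2)[OF assms(1)] _ assms(2,3)]) (simp add: be_level)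

lemma flow_rest:
  assumes "flow \<theta> h" "al (\<theta> t0) (h t0) = 0" "be (\<theta> t0) (h t0) = 0"
  shows "\<theta> t = \<theta> t0" "h t = h t0"
proof -
  have "flow (\<lambda>t. \<theta> t0) (\<lambda>t. h t0)"
    using assms(2,3) unfolding flow_def planar_solution_def by simp
  from flow_eqI[OF assms(1) this, of t0 t] show "\<theta> t = \<theta> t0" "h t = h t0" by simp_all
qed

lemma flow_zero:
  assumes "flow \<theta> h" "h t0 = 0"
  shows "h t = 0" "\<theta> t = \<theta> t0 - 2 * pi * om * (t - t0)"
proof -
  have "flow (\<lambda>t. \<theta> t0 - 2 * pi * om * (t - t0)) (\<lambda>t. 0)"
    unfolding flow_def planar_solution_def
    by (auto simp: field_core intro!: derivative_eq_intros)
  from flow_eqI[OF assms(1) this, of t0 t] assms(2)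
  show "h t = 0" "\<theta> t = \<theta> t0 - 2 * pi * om * (t - t0)" by simp_all
qed

lemma flow_pos:
  assumes "flow \<theta> h" "0 < h t0"
  shows "0 < h t"
proof (rule ccontr)
  assume "\<not> 0 < h t"
  then obtain s where "h s = 0"
    using assms(2) IVT'[of h t 0 t0, OF _ _ _ flow_continuous(2)[OF assms(1)]]
      IVT2'[of h t 0 t0, OF _ _ _ flow_continuous(2)[OF assms(1)]]
    by (cases "t \<le> t0") auto
  then show False using flow_zero(1)[OF assms(1), of s t0] assms(2) by simp
qed

text \<open>The explicit solution of \<open>h' = h\<^sup>2\<close>. The last hypothesis says that it
  stays within \<open>\<bar>h\<bar> \<le> 1\<close>, where the field has this form.\<close>

lemma flow_core:
  assumes "flow \<theta> h" "h 0 = s" "0 \<in> {a..b}" "t \<in> {a..b}"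
    and "\<And>t. t \<in> {a..b} \<Longrightarrow> \<bar>s\<bar> \<le> 1 - s * t \<and> 0 < 1 - s * t"
  shows "\<theta> t = \<theta> 0 - 2 * pi * om * t" "h t = s / (1 - s * t)"
proof -
  have "planar_solution al be (\<lambda>t. \<theta> 0 - 2 * pi * om * t) (\<lambda>t. s / (1 - s * t)) t" if "t \<in> {a..b}" for t
  proof -
    have "\<bar>s / (1 - s * t)\<bar> \<le> 1" using assms(5)[OF that] by simp
    then show ?thesis unfolding planar_solution_def using assms(5)[OF that]
      by (auto simp: field_core power2_eq_square intro!: derivative_eq_intros)
  qed
  from flow_unique[OF _ this, of a b \<theta> h 0 t] assms(1-4)
  show "\<theta> t = \<theta> 0 - 2 * pi * om * t" "h t = s / (1 - s * t)" unfolding flow_def by auto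
qed

text \<open>At the angle \<open>\<theta> t0\<close> the horizontal speed is zero at all heights of
  the window, so elsewhere it is at most a constant times the distance of the angles. Gronwall then
  applies without any knowledge of how \<open>h\<close> moves.\<close>

lemma outside_arc_const:
  assumes fl: "flow \<theta> h" and k: "k \<noteq> 0" "\<not> in_arc k (\<theta> t0)"
    and win: "\<And>t. t \<in> {a..b} \<Longrightarrow> \<bar>h t - 4 * real_of_int k\<bar> \<le> 2"
    and t: "t0 \<in> {a..b}" "t \<in> {a..b}"
  shows "\<theta> t = \<theta> t0"
proof -
  obtain B where B: "B \<ge> 0" "\<And>p q. \<bar>al (fst p) (snd p) - al (fst q) (snd q)\<bar> \<le> B * dist p q"
    using bounded_lipschitz_al unfolding bounded_lipschitz_def by metis
  show ?thesis
  proof (rule gronwall_unique[where x = \<theta> and x' = "\<lambda>s. al (\<theta> s) (h s)" and t = t and L = B and y' = "\<lambda>_. 0" and y = "\<lambda>_. \<theta> t0" and a = a and b = b and ?t0.0 = t0])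
    fix s assume s: "s \<in> {a..b}"
    show "(\<theta> has_vector_derivative al (\<theta> s) (h s)) (at s)"
      using flow_deriv(1)[OF fl] by (simp add: has_real_derivative_iff_has_vector_derivative)
    have "al (\<theta> t0) (h s) = 0"
    proof (cases "k \<in> K")
      case True
      then show ?thesis using field_plug(1)[OF True win[OF s]] k by (simp add: arc_speed_def)
    next
      case False
      then show ?thesis using field_empty(1)[OF False k(1) win[OF s]] by simp
    qed
    then show "norm (al (\<theta> s) (h s) - 0) \<le> B * norm (\<theta> s - \<theta> t0)"
      using B(2)[of "(\<theta> s, h s)" "(\<theta> t0, h s)"] by (simp add: dist_Pair_Pair dist_norm)
  qed (use t in auto)
qed

text \<open>The previous lemma read from \<open>t\<close> back to \<open>t0\<close>: an orbit
  outside the arc at some time keeps its angle, so it was outside all along.\<close>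

lemma arc_invariant:
  assumes fl: "flow \<theta> h" and k: "in_arc k (\<theta> t0)"
    and win: "\<And>t. t \<in> {a..b} \<Longrightarrow> \<bar>h t - 4 * real_of_int k\<bar> \<le> 2"
    and t: "t0 \<in> {a..b}" "t \<in> {a..b}"
  shows "in_arc k (\<theta> t)"
proof (rule ccontr)
  assume neg: "\<not> in_arc k (\<theta> t)"
  have "k \<noteq> 0" using k K by auto
  from outside_arc_const[OF fl this neg win t(2,1)] show False using neg k by simp
qed

text \<open>In the coordinates \<open>xi\<close> and \<open>h - 4 * k\<close> the field is the
  standard plug with only its horizontal part multiplied by \<open>sg k\<close>. The vertical part
  is even in the height, so reversal with reflection preserves it and both kinds of plug have the
  same upward drift.\<close>

lemma plug_coordinates_deriv:
  assumes fl: "flow \<theta> h" and k: "in_arc k (\<theta> t)" and win: "\<bar>h t - 4 * real_of_int k\<bar> \<le> 2"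
  shows "((\<lambda>t. xi k (\<theta> t)) has_real_derivative sg k * plug_x (xi k (\<theta> t)) (h t - 4 * real_of_int k)) (at t)"
    and "((\<lambda>t. h t - 4 * real_of_int k) has_real_derivative plug_y (xi k (\<theta> t)) (h t - 4 * real_of_int k)) (at t)"
proof -
  interpret arc "W k" "kp k" using arc_param k by blast
  have "((\<lambda>t. \<theta> t - th k) has_real_derivative al (\<theta> t) (h t)) (at t)"
    using flow_deriv(1)[OF fl] by (auto intro!: derivative_eq_intros)
  from DERIV_chain2[OF chart_has_derivative this]
  have "((\<lambda>t. xi k (\<theta> t)) has_real_derivative arc_chart' (W k) (kp k) (\<theta> t - th k) * al (\<theta> t) (h t)) (at t)"
    using k by simp
  moreover have "arc_chart' (W k) (kp k) (\<theta> t - th k) * al (\<theta> t) (h t) = sg k * plug_x (xi k (\<theta> t)) (h t - 4 * real_of_int k)"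
    using chart'_pos[of "\<theta> t - th k"] field_plug(1)[of k "h t" "\<theta> t"] k win
    by (simp add: arc_speed_def plug_x_def)
  ultimately show "((\<lambda>t. xi k (\<theta> t)) has_real_derivative sg k * plug_x (xi k (\<theta> t)) (h t - 4 * real_of_int k)) (at t)"
    by simp
  have "((\<lambda>t. h t - 4 * real_of_int k) has_real_derivative be (\<theta> t) (h t)) (at t)"
    using flow_deriv(2)[OF fl] by (auto intro!: derivative_eq_intros)
  then show "((\<lambda>t. h t - 4 * real_of_int k) has_real_derivative plug_y (xi k (\<theta> t)) (h t - 4 * real_of_int k)) (at t)"
    using field_plug(2)[of k "h t" "\<theta> t"] k win by (simp add: plug_y_def arc_bump_def)
qed

lemma xi_square_deriv:
  assumes fl: "flow \<theta> h" and k: "in_arc k (\<theta> t)" and win: "\<bar>h t - 4 * real_of_int k\<bar> \<le> 2"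
  shows "((\<lambda>t. sg k * (xi k (\<theta> t))\<^sup>2) has_real_derivative
      - (2 * (xi k (\<theta> t))\<^sup>2 * plateau 3 (xi k (\<theta> t)) * plateau 3 (h t - 4 * real_of_int k))) (at t)"
proof -
  have "sg k * (2 * xi k (\<theta> t) * (sg k * plug_x (xi k (\<theta> t)) (h t - 4 * real_of_int k))) =
    - (2 * (xi k (\<theta> t))\<^sup>2 * plateau 3 (xi k (\<theta> t)) * plateau 3 (h t - 4 * real_of_int k))"
    using sg[of k] k by (auto simp: plug_x_def power2_eq_square)
  moreover have "((\<lambda>t. sg k * (xi k (\<theta> t))\<^sup>2) has_real_derivative
      sg k * (2 * xi k (\<theta> t) * (sg k * plug_x (xi k (\<theta> t)) (h t - 4 * real_of_int k)))) (at t)"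
    using plug_coordinates_deriv(1)[OF assms] by (auto intro!: derivative_eq_intros)
  ultimately show ?thesis by (simp only:)
qed

lemma xi_square_mono:
  assumes fl: "flow \<theta> h" and "a \<le> b"
    and k: "\<And>t. t \<in> {a..b} \<Longrightarrow> in_arc k (\<theta> t)"
    and win: "\<And>t. t \<in> {a..b} \<Longrightarrow> \<bar>h t - 4 * real_of_int k\<bar> \<le> 2"
  shows "sg k * (xi k (\<theta> b))\<^sup>2 \<le> sg k * (xi k (\<theta> a))\<^sup>2"
proof -
  have "sg k * (xi k (\<theta> b))\<^sup>2 \<le> sg k * (xi k (\<theta> a))\<^sup>2 + 0 * (b - a)"
    by (rule DERIV_geI[OF assms(2) xi_square_deriv[OF fl]]) (use k win in \<open>auto simp: plateau_nonneg\<close>)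
  then show ?thesis by simp
qed

lemma plug_solution_coordinates:
  assumes fl: "flow \<theta> h" and k: "in_arc k (\<theta> t)" and win: "\<bar>h t - 4 * real_of_int k\<bar> \<le> 2"
    and "sg k = 1 \<or> xi k (\<theta> t) = 0"
  shows "plug_solution (\<lambda>t. xi k (\<theta> t)) (\<lambda>t. h t - 4 * real_of_int k) t"
  using plug_coordinates_deriv[OF assms(1-3)] assms(4) unfolding planar_solution_def
  by (auto simp: plug_x_def)

section \<open>Entering a plug from below and tending to its saddle\<close>

lemma tends_in_arc:
  assumes "tends k \<theta> h F"
  shows "\<forall>\<^sub>F t in F. in_arc k (\<theta> t)"
proof -
  interpret arc "W k" "kp k" using arc_param assms unfolding tends_def by blast
  have "\<forall>\<^sub>F t in F. cos (W k) < cos (\<theta> t - th k)"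
    using assms order_tendstoD(1)[of "\<lambda>t. cos (\<theta> t - th k)" 1 F "cos (W k)"] cos_W unfolding tends_def by blast
  then show ?thesis using assms unfolding tends_def by (auto elim: eventually_mono)
qed

lemma sg_crit: "k \<in> K \<Longrightarrow> \<bar>sg k * crit\<bar> < 1"
  using sg[of k] crit_bounds by auto

lemma tends_window:
  assumes "tends k \<theta> h F"
  shows "\<forall>\<^sub>F t in F. \<bar>h t - 4 * real_of_int k\<bar> < 2"
proof -
  have "((\<lambda>t. \<bar>h t - 4 * real_of_int k\<bar>) \<longlongrightarrow> \<bar>4 * real_of_int k + sg k * crit - 4 * real_of_int k\<bar>) F"
    using assms unfolding tends_def by (intro tendsto_intros) auto
  then show ?thesis
    by (rule order_tendstoD(2)) (use sg_crit[of k] assms in \<open>auto simp: tends_def\<close>)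
qed

text \<open>The gates at both ends of the window are one-way: an orbit that left through the upper
  one could not return to its limit inside.\<close>

lemma forward_window:
  assumes fl: "flow \<theta> h" and h0: "4 * real_of_int k - 2 \<le> h t0" and lim: "tends k \<theta> h at_top" and t: "t0 \<le> t"
  shows "\<bar>h t - 4 * real_of_int k\<bar> \<le> 2"
proof -
  have "4 * real_of_int k - 2 \<le> h t" using level_up[OF fl, of "k - 1" t0 t] h0 t by (cases "t = t0") auto
  moreover have "h t \<le> 4 * real_of_int k + 2"
  proof (rule ccontr)
    assume "\<not> h t \<le> 4 * real_of_int k + 2"
    then have "4 * real_of_int k + 2 < h s" if "t < s" for s
      using level_up[OF fl, of k t s] that by simp
    then have "\<forall>\<^sub>F s in at_top. 4 * real_of_int k + 2 < h s"
      by (intro eventually_at_top_linorderI[of "t + 1"]) simp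
    with tends_window[OF lim] have "\<forall>\<^sub>F s in (at_top :: real filter). False"
      by eventually_elim auto
    then show False by simp
  qed
  ultimately show ?thesis by linarith
qed

lemma forward_in_arc:
  assumes fl: "flow \<theta> h" and h0: "4 * real_of_int k - 2 \<le> h t0" and lim: "tends k \<theta> h at_top" and t: "t0 \<le> t"
  shows "in_arc k (\<theta> t)"
proof -
  obtain T where T: "in_arc k (\<theta> T)" "t \<le> T"
    using eventually_happens[OF eventually_conj[OF tends_in_arc[OF lim] eventually_ge_at_top[of t]]] by auto
  show ?thesis
    by (rule arc_invariant[OF fl T(1), of t0 T]) (use forward_window[OF fl h0 lim] T t in auto)
qed

lemma tends_xi:
  assumes "tends k \<theta> h F"
  shows "((\<lambda>t. xi k (\<theta> t)) \<longlongrightarrow> 0) F"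
proof -
  interpret arc "W k" "kp k" using arc_param assms unfolding tends_def by blast
  show ?thesis
    using chart_tendsto_0_iff[of "\<lambda>t. \<theta> t - th k" F] tends_in_arc[OF assms] assms
    unfolding tends_def by (auto elim: eventually_mono)
qed

text \<open>For \<open>sg k = 1\<close> the orbit is a solution of the standard plug that tends to
  its saddle. For \<open>sg k = - 1\<close> the plug expands horizontally: the square of
  \<open>xi\<close> never decreases but tends to 0, so it is 0 from the start.\<close>

lemma tends_imp_hits:
  assumes fl: "flow \<theta> h" and h0: "h t0 = 4 * real_of_int k - 2" and lim: "tends k \<theta> h at_top"
  shows "hits k (\<theta> t0)"
proof -
  have k: "k \<in> K" using lim unfolding tends_def by blast
  have win: "\<bar>h t - 4 * real_of_int k\<bar> \<le> 2" if "t0 \<le> t" for t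
    using forward_window[OF fl _ lim that] h0 by simp
  have arc: "in_arc k (\<theta> t)" if "t0 \<le> t" for t
    using forward_in_arc[OF fl _ lim that] h0 by simp
  show ?thesis
  proof (cases "sg k = 1")
    case True
    obtain x y where xy: "x t0 = xi k (\<theta> t0)" "y t0 = h t0 - 4 * real_of_int k" "\<And>t. plug_solution x y t"
      using plug_exists by metis
    have eq: "x t = xi k (\<theta> t) \<and> y t = h t - 4 * real_of_int k" if "t0 \<le> t" for t
      by (rule plug_unique[of t0 t x y "\<lambda>t. xi k (\<theta> t)" "\<lambda>t. h t - 4 * real_of_int k" t0 t,
            OF xy(3) plug_solution_coordinates[OF fl arc win]]) (use xy that True in auto)
    have "(x \<longlongrightarrow> 0) at_top"
      using tendsto_at_top_eqI[OF tends_xi[OF lim], of t0 x] eq by simp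
    moreover have "((\<lambda>t. h t - 4 * real_of_int k) \<longlongrightarrow> 4 * real_of_int k + sg k * crit - 4 * real_of_int k) at_top"
      using lim unfolding tends_def by (intro tendsto_intros) auto
    then have "(y \<longlongrightarrow> crit) at_top"
      using tendsto_at_top_eqI[of "\<lambda>t. h t - 4 * real_of_int k" crit t0 y] eq True by simp
    ultimately have "(x t0)\<^sup>2 = plug_entry\<^sup>2"
      using plug_separatrix_unique[OF xy(3)] xy(2) h0 by auto
    then show ?thesis using arc[of t0] xy(1) True by (simp add: hits_def)
  next
    case False
    then have sgk: "sg k = - 1" using sg k by blast
    have "((\<lambda>t. (xi k (\<theta> t))\<^sup>2) \<longlongrightarrow> 0\<^sup>2) at_top"
      by (intro tendsto_intros tends_xi[OF lim])
    moreover have "\<forall>\<^sub>F t in at_top. (xi k (\<theta> t0))\<^sup>2 \<le> (xi k (\<theta> t))\<^sup>2"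
      using eventually_ge_at_top[of t0]
    proof (rule eventually_mono)
      show "(xi k (\<theta> t0))\<^sup>2 \<le> (xi k (\<theta> t))\<^sup>2" if "t0 \<le> t" for t
        using xi_square_mono[OF fl that, of k] arc win sgk by auto
    qed
    ultimately have "(xi k (\<theta> t0))\<^sup>2 \<le> 0\<^sup>2"
      by (intro tendsto_lowerbound) auto
    then show ?thesis using arc[of t0] False by (simp add: hits_def)
  qed
qed

text \<open>Model orbits for the converse: the separatrix of the standard plug or its mirror image,
  and for \<open>sg k = - 1\<close> the axis. The bound \<open>y t < 2\<close> will keep the true
  orbit from the top of the window.\<close>

lemma hits_entry_orbit:
  assumes "hits k \<theta>"
  obtains x y where "\<And>t. plug_solution x y t" "x 0 = xi k \<theta>" "y 0 = - 2"
    "\<And>t. 0 \<le> t \<Longrightarrow> y t < 2" "(x \<longlongrightarrow> 0) at_top" "(y \<longlongrightarrow> sg k * crit) at_top"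
    "sg k \<noteq> 1 \<Longrightarrow> x = (\<lambda>_. 0)"
proof (cases "sg k = 1")
  case True
  obtain X Y \<tau> where sep: "plug_separatrix plug_entry X Y \<tau>" by (rule plug_entry_separatrix)
  then have S: "\<And>t. plug_solution X Y t" "X 0 = plug_entry" "Y 0 = - 2"
      "\<And>t. t \<ge> \<tau> \<Longrightarrow> X t = exp (\<tau> - t)" "\<And>t. t \<ge> \<tau> \<Longrightarrow> Y t = crit" "\<And>t. t \<le> \<tau> \<Longrightarrow> Y t \<le> crit"
    unfolding plug_separatrix_def by auto
  have "LIM t at_top. t + - \<tau> :> at_top"
    using filterlim_tendsto_add_at_top[OF tendsto_const[of "- \<tau>"] filterlim_ident] by (simp add: add.commute)
  then have "LIM t at_top. \<tau> - t :> at_bot"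
    using filterlim_uminus_at_bot[of "\<lambda>t. \<tau> - t" at_top] by simp
  then have "((\<lambda>t. exp (\<tau> - t)) \<longlongrightarrow> 0) at_top"
    by (rule filterlim_compose[OF exp_at_bot])
  then have "(X \<longlongrightarrow> 0) at_top"
    by (rule tendsto_at_top_eqI) (rule S(4))
  moreover have "(Y \<longlongrightarrow> crit) at_top"
    by (rule tendsto_at_top_eqI[OF tendsto_const]) (rule S(5))
  moreover have "Y t < 2" for t
    using S(5,6)[of t] crit_bounds by (cases "t \<le> \<tau>") auto
  moreover have "xi k \<theta> = plug_entry \<or> xi k \<theta> = - plug_entry"
    using assms True by (auto simp: hits_def power2_eq_iff)
  moreover have "((\<lambda>t. - X t) \<longlongrightarrow> 0) at_top" if "(X \<longlongrightarrow> 0) at_top"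
    using tendsto_minus[OF that] by simp
  ultimately show ?thesis
    using that[of X Y] that[of "\<lambda>t. - X t" Y] S(1-3) plug_solution_minus[OF S(1)] True by auto
next
  case False
  then have "sg k = - 1" using assms sg unfolding hits_def by blast
  obtain y where y: "y 0 = - 2" "\<And>t. (y has_real_derivative 1 - dip (y t)) (at t)"
    "\<And>t. 0 \<le> t \<Longrightarrow> - 2 \<le> y t \<and> y t < - crit" "(y \<longlongrightarrow> - crit) at_top"
    using plug_axis_orbit by metis
  have "plug_solution (\<lambda>_. 0) y t" for t
    using y(2) unfolding planar_solution_def by (simp add: plug_x_def plug_y_def plateau_eq_1)
  moreover have "y t < 2" if "0 \<le> t" for t using y(3)[OF that] crit_bounds by simp
  ultimately show ?thesis
    using that[of "\<lambda>_. 0" y] y \<open>sg k = - 1\<close> assms by (simp add: hits_def)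
qed

text \<open>The flow agrees with the model orbit as long as the window is not left, and the model
  stays below the top of the window; so the agreement up to a first exit would be
  contradictory.\<close>

lemma hits_imp_tends:
  assumes fl: "flow \<theta> h" and h0: "h t0 = 4 * real_of_int k - 2" and hit: "hits k (\<theta> t0)"
  shows "tends k \<theta> h at_top"
proof -
  obtain x y where xy: "\<And>t. plug_solution x y t" "x 0 = xi k (\<theta> t0)" "y 0 = - 2"
    "\<And>t. 0 \<le> t \<Longrightarrow> y t < 2" "(x \<longlongrightarrow> 0) at_top" "(y \<longlongrightarrow> sg k * crit) at_top"
    "sg k \<noteq> 1 \<Longrightarrow> x = (\<lambda>_. 0)"
    using hits_entry_orbit[OF hit] by metis
  have arc0: "in_arc k (\<theta> t0)" using hit by (simp add: hits_def)
  then have k: "k \<in> K" by simp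
  have agree: "xi k (\<theta> t) = x (t - t0) \<and> h t - 4 * real_of_int k = y (t - t0) \<and> in_arc k (\<theta> t)"
    if T: "t0 \<le> t" and win: "\<And>s. s \<in> {t0..t} \<Longrightarrow> \<bar>h s - 4 * real_of_int k\<bar> \<le> 2" for t
  proof -
    have arc: "in_arc k (\<theta> s)" if "s \<in> {t0..t}" for s
      by (rule arc_invariant[OF fl arc0 win _ that]) (use T in auto)
    \<comment> \<open>In the reversed plug the standard equations hold only on the axis; comparison
      with the constant 0 shows that the orbit does not leave it.\<close>
    have "sg k = 1 \<or> xi k (\<theta> s) = 0" if s: "s \<in> {t0..t}" for s
    proof (rule disjCI)
      assume neq: "xi k (\<theta> s) \<noteq> 0"
      show "sg k = 1"
      proof (rule ccontr)
        assume n1: "sg k \<noteq> 1"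
        have "xi k (\<theta> s) = 0"
        proof (rule gronwall_unique[where x = "\<lambda>t. xi k (\<theta> t)" and t = s and y = "\<lambda>_. 0" and y' = "\<lambda>_. 0" and L = 1
              and x' = "\<lambda>t. sg k * plug_x (xi k (\<theta> t)) (h t - 4 * real_of_int k)" and a = t0 and b = t and ?t0.0 = t0])
          fix u assume u: "u \<in> {t0..t}"
          show "((\<lambda>t. xi k (\<theta> t)) has_vector_derivative sg k * plug_x (xi k (\<theta> u)) (h u - 4 * real_of_int k)) (at u)"
            using plug_coordinates_deriv(1)[OF fl arc[OF u] win[OF u]]
            by (simp add: has_real_derivative_iff_has_vector_derivative)
          have "\<bar>plateau 3 (xi k (\<theta> u)) * plateau 3 (h u - 4 * real_of_int k)\<bar> \<le> 1"
            by (simp add: abs_mult plateau_nonneg plateau_le_1 mult_le_one)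
          then show "norm (sg k * plug_x (xi k (\<theta> u)) (h u - 4 * real_of_int k) - 0) \<le> 1 * norm (xi k (\<theta> u) - 0)"
            using sg[OF k] n1 by (simp add: plug_x_def abs_mult mult.assoc mult_left_le)
        qed (use s T xy(2) xy(7)[OF n1] in auto)
        then show False using neq by simp
      qed
    qed
    note ps = plug_solution_coordinates[OF fl arc win this]
    have "xi k (\<theta> t) = x (t + - t0) \<and> h t - 4 * real_of_int k = y (t + - t0)"
      by (rule plug_unique[of t0 t "\<lambda>t. xi k (\<theta> t)" "\<lambda>t. h t - 4 * real_of_int k" "\<lambda>t. x (t + - t0)" "\<lambda>t. y (t + - t0)" t0 t,
            OF ps planar_solution_shift[OF xy(1)]]) (use T xy h0 in auto)
    then show ?thesis using arc[of t] T by simp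
  qed
  have win: "\<bar>h t - 4 * real_of_int k\<bar> \<le> 2" if "t0 \<le> t" for t
  proof -
    have low: "4 * real_of_int k - 2 \<le> h s" if "t0 \<le> s" for s
      using level_up[OF fl, of "k - 1" t0 s] h0 that by (cases "s = t0") auto
    have "h t \<le> 4 * real_of_int k + 2"
    proof (rule ccontr)
      assume "\<not> h t \<le> 4 * real_of_int k + 2"
      then obtain t1 where t1: "t0 \<le> t1" "t1 \<le> t" "h t1 = 4 * real_of_int k + 2"
        using IVT'[of h t0 "4 * real_of_int k + 2" t, OF _ _ \<open>t0 \<le> t\<close> flow_continuous(2)[OF fl]] h0 by auto
      have "\<bar>h s - 4 * real_of_int k\<bar> \<le> 2" if "s \<in> {t0..t1}" for s
        using low[of s] level_down[OF fl, of t1 k s] t1 that by (cases "s = t1") auto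
      from agree[OF t1(1) this] show False using xy(4)[of "t1 - t0"] t1 by simp
    qed
    then show ?thesis using low[OF that] by linarith
  qed
  have eq: "xi k (\<theta> t) = x (t - t0) \<and> h t - 4 * real_of_int k = y (t - t0) \<and> in_arc k (\<theta> t)" if "t0 \<le> t" for t
    by (rule agree[OF that]) (use win in auto)
  have top: "LIM t at_top. t - t0 :> at_top"
    using filterlim_tendsto_add_at_top[OF tendsto_const[of "- t0"] filterlim_ident] by (simp add: add.commute)
  have "((\<lambda>t. x (t - t0)) \<longlongrightarrow> 0) at_top" by (rule filterlim_compose[OF xy(5) top])
  then have "((\<lambda>t. xi k (\<theta> t)) \<longlongrightarrow> 0) at_top"
    by (rule tendsto_at_top_eqI) (use eq in blast)
  moreover have "\<forall>\<^sub>F t in at_top. cos (W k) < cos (\<theta> t - th k)"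
    by (rule eventually_at_top_linorderI[of t0]) (use eq in blast)
  ultimately have "((\<lambda>t. cos (\<theta> t - th k)) \<longlongrightarrow> 1) at_top"
    using arc.chart_tendsto_0_iff[OF arc_param[OF k], of "\<lambda>t. \<theta> t - th k" at_top] by blast
  moreover have "((\<lambda>t. y (t - t0)) \<longlongrightarrow> sg k * crit) at_top" by (rule filterlim_compose[OF xy(6) top])
  then have "((\<lambda>t. h t - 4 * real_of_int k) \<longlongrightarrow> sg k * crit) at_top"
    by (rule tendsto_at_top_eqI) (use eq in blast)
  from tendsto_add[OF tendsto_const[of "4 * real_of_int k"] this] have "(h \<longlongrightarrow> 4 * real_of_int k + sg k * crit) at_top"
    by simp
  ultimately show ?thesis using k unfolding tends_def by blast
qed

end

section \<open>Periodic orbits and saddle connections\<close>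

context plug_field
begin

text \<open>Only positive indices occur: the lower hemisphere is covered by the same condition on
  the reversed field.\<close>

definition separated :: bool where
  "separated \<longleftrightarrow> (\<forall>i j \<theta>. 0 < i \<longrightarrow> i < j \<longrightarrow> hits j \<theta> \<longrightarrow> \<not> in_arc i \<theta>)"

abbreviation rest :: "real \<Rightarrow> real \<Rightarrow> bool" where
  "rest \<theta> h \<equiv> al \<theta> h = 0 \<and> be \<theta> h = 0"

lemma plug_slow_region:
  assumes "k \<in> K" "\<bar>h - 4 * real_of_int k\<bar> \<le> 2" "be \<theta> h \<le> 0"
  shows "in_arc k \<theta>" "\<bar>h - 4 * real_of_int k\<bar> < 1" "(xi k \<theta>)\<^sup>2 < 2"
proof -
  have "1 \<le> arc_bump (W k) (kp k) (\<theta> - th k) * dip (h - 4 * real_of_int k)"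
    using field_plug(2)[OF assms(1,2), of \<theta>] assms(3) by simp
  then have b: "arc_bump (W k) (kp k) (\<theta> - th k) \<noteq> 0" and d: "dip (h - 4 * real_of_int k) \<noteq> 0"
    by auto
  show "in_arc k \<theta>" using b assms(1) by (auto simp: arc_bump_def split: if_splits)
  show "(xi k \<theta>)\<^sup>2 < 2" using b plateau_eq_0[of 2 "xi k \<theta>"] by (force simp: arc_bump_def split: if_splits)
  show "\<bar>h - 4 * real_of_int k\<bar> < 1"
    using d dip_eq_0[of "h - 4 * real_of_int k"] abs_square_less_1[of "h - 4 * real_of_int k"] by force
qed

text \<open>Zero or downward vertical speed is confined to the part of the plugs where the
  contraction or expansion has full rate; hence off the axis the two speeds cannot vanish
  together.\<close>

lemma slow_cases:
  assumes "be \<theta> h \<le> 0" "h \<noteq> 0"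
  obtains k where "k \<in> K" "\<bar>h - 4 * real_of_int k\<bar> < 1" "in_arc k \<theta>" "(xi k \<theta>)\<^sup>2 < 2"
proof -
  obtain k :: int where k: "\<bar>h - 4 * real_of_int k\<bar> \<le> 2" by (rule window_exists)
  have "k \<in> K"
  proof (rule ccontr)
    assume nk: "k \<notin> K"
    show False
    proof (cases "k = 0")
      case True
      then show False using be_base_pos[of h \<theta>] k assms by simp
    next
      case False
      then show False using field_empty(2)[OF nk False k, of \<theta>] assms by simp
    qed
  qed
  then show ?thesis using that plug_slow_region[OF _ k assms(1)] by blast
qed

lemma rest_iff: "rest \<theta> h \<longleftrightarrow> (\<exists>k\<in>K. cos (\<theta> - th k) = 1 \<and> (h - 4 * real_of_int k)\<^sup>2 = 1 / 2)"
proof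
  assume r: "rest \<theta> h"
  have "om \<noteq> 0" using om by auto
  then have "h \<noteq> 0" using r by (auto simp: field_core)
  then obtain k where k: "k \<in> K" "\<bar>h - 4 * real_of_int k\<bar> < 1" "in_arc k \<theta>" "(xi k \<theta>)\<^sup>2 < 2"
    using slow_cases[of \<theta> h] r by auto
  interpret arc "W k" "kp k" by (rule arc_param[OF k(1)])
  have "sg k \<noteq> 0" using sg[OF k(1)] by auto
  moreover have "(h - 4 * real_of_int k)\<^sup>2 \<le> 2" using k(2) abs_square_less_1[of "h - 4 * real_of_int k"] by simp
  moreover have "0 < arc_chart' (W k) (kp k) (\<theta> - th k)" using chart'_pos k(3) by blast
  ultimately have "xi k \<theta> = 0"
    using r field_plug(1)[OF k(1), of h \<theta>] k by (simp add: arc_speed_def plateau_eq_1)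
  then have c: "cos (\<theta> - th k) = 1" using chart_eq_0 k(3) by blast
  moreover have "dip (h - 4 * real_of_int k) = 1"
    using r field_plug(2)[OF k(1), of h \<theta>] k \<open>xi k \<theta> = 0\<close> by (simp add: arc_bump_def plateau_eq_1)
  ultimately show "\<exists>k\<in>K. cos (\<theta> - th k) = 1 \<and> (h - 4 * real_of_int k)\<^sup>2 = 1 / 2"
    using k(1) dip_eq_1_iff by blast
next
  assume "\<exists>k\<in>K. cos (\<theta> - th k) = 1 \<and> (h - 4 * real_of_int k)\<^sup>2 = 1 / 2"
  then obtain k where k: "k \<in> K" "cos (\<theta> - th k) = 1" "(h - 4 * real_of_int k)\<^sup>2 = 1 / 2" by blast
  interpret arc "W k" "kp k" by (rule arc_param[OF k(1)])
  have a: "cos (W k) < cos (\<theta> - th k)" using k(2) cos_W by simp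
  then have "xi k \<theta> = 0" using chart_eq_0 k(2) by blast
  moreover have "\<bar>h - 4 * real_of_int k\<bar> \<le> 2" using abs_square_less_1[of "h - 4 * real_of_int k"] k(3) by simp
  moreover have "dip (h - 4 * real_of_int k) = 1" using k(3) dip_eq_1_iff by blast
  ultimately show "rest \<theta> h"
    using a k(1) by (simp add: field_plug arc_speed_def arc_bump_def plateau_eq_1)
qed

lemma xi_cong_cos:
  assumes "k \<in> K" "cos (\<theta> - th k) = cos (\<theta>' - th k)" "cos (W k) < cos (\<theta> - th k)"
  shows "(xi k \<theta>)\<^sup>2 = (xi k \<theta>')\<^sup>2"
proof -
  interpret arc "W k" "kp k" by (rule arc_param[OF assms(1)])
  have "(xi k \<theta>)\<^sup>2 * (cos (\<theta> - th k) - cos (W k))\<^sup>2 = (xi k \<theta>')\<^sup>2 * (cos (\<theta> - th k) - cos (W k))\<^sup>2"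
    using chart_squared[of "\<theta> - th k"] chart_squared[of "\<theta>' - th k"] assms by simp
  then show ?thesis using assms(3) by simp
qed

lemma periodic_reduce:
  fixes f :: "real \<Rightarrow> 'b"
  assumes "0 < T" "\<And>t. f (t + T) = f t"
  obtains s where "s \<in> {a..a + T}" "f s = f t"
proof -
  interpret periodic_fun_simple f T by standard (rule assms(2))
  have "f (t - of_int \<lfloor>(t - a) / T\<rfloor> * T) = f t" by (rule minus_of_int)
  moreover have "t - of_int \<lfloor>(t - a) / T\<rfloor> * T \<in> {a..a + T}"
    using floor_divide_lower[OF assms(1), of "t - a"] floor_divide_upper[OF assms(1), of "t - a"]
    by (simp add: algebra_simps)
  ultimately show ?thesis by (rule that[rotated])
qed

text \<open>At its highest point the orbit is inside a plug, and it cannot leave the window. There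
  \<open>sg k * (xi k (\<theta> t))\<^sup>2\<close> never increases and is periodic, hence constant;
  this forces the highest point onto the axis, where the horizontal speed vanishes too. The angle is
  assumed periodic through \<open>cos\<close> because a closed orbit on the sphere determines it
  only modulo \<open>2 * pi\<close>.\<close>

lemma periodic_flow_rest:
  assumes fl: "flow \<theta> h" and T: "0 < T" "\<And>t. h (t + T) = h t" "\<And>t c. cos (\<theta> (t + T) - c) = cos (\<theta> t - c)"
    and h0: "h 0 \<noteq> 0"
  shows "rest (\<theta> 0) (h 0)"
proof -
  have nz: "h t \<noteq> 0" for t using flow_zero(1)[OF fl, of t 0] h0 by auto
  have ne: "{0..T} \<noteq> {}" using T by simp
  obtain tm where tm: "\<And>s. s \<in> {0..T} \<Longrightarrow> h s \<le> h tm"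
    using continuous_attains_sup[OF compact_Icc ne flow_continuous(2)[OF fl]] by blast
  have max: "h t \<le> h tm" for t
  proof -
    obtain s where "s \<in> {0..0 + T}" "h s = h t" using periodic_reduce[OF T(1), of h 0 t] T(2) by metis
    then show ?thesis using tm[of s] by simp
  qed
  have be0: "be (\<theta> tm) (h tm) = 0"
    by (rule DERIV_local_max[OF flow_deriv(2)[OF fl], of 1]) (use max in auto)
  obtain k where k: "k \<in> K" "\<bar>h tm - 4 * real_of_int k\<bar> < 1" "in_arc k (\<theta> tm)" "(xi k (\<theta> tm))\<^sup>2 < 2"
    using slow_cases[of "\<theta> tm" "h tm"] be0 nz by auto
  interpret arc "W k" "kp k" by (rule arc_param[OF k(1)])
  \<comment> \<open>After \<open>tm\<close> the orbit is above the lower gate, by periodicity then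
    at all times; the maximum at \<open>tm\<close> keeps it below the upper one.\<close>
  have win: "\<bar>h t - 4 * real_of_int k\<bar> \<le> 2" for t
  proof -
    obtain s where s: "s \<in> {tm + 1..tm + 1 + T}" "h s = h t"
      using periodic_reduce[OF T(1), of h "tm + 1" t] T(2) by metis
    have "4 * real_of_int (k - 1) + 2 < h s"
      by (rule level_up[OF fl, of _ tm]) (use k(2) s(1) in auto)
    then show ?thesis using max[of t] k(2) s(2) by simp
  qed
  have arc: "in_arc k (\<theta> t)" for t
    by (rule arc_invariant[OF fl k(3) win, of "min t tm" "max t tm"]) auto
  have "xi k (\<theta> tm) = 0"
  proof (rule ccontr)
    assume x0: "xi k (\<theta> tm) \<noteq> 0"
    have "(h tm - 4 * real_of_int k)\<^sup>2 \<le> 2"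
      using k(2) abs_square_less_1[of "h tm - 4 * real_of_int k"] by simp
    then have "((\<lambda>t. sg k * (xi k (\<theta> t))\<^sup>2) has_real_derivative - (2 * (xi k (\<theta> tm))\<^sup>2)) (at tm)"
      using xi_square_deriv[OF fl arc win, of tm] k(4) by (simp add: plateau_eq_1)
    then obtain d where d: "d > 0" "\<And>e. 0 < e \<Longrightarrow> e < d \<Longrightarrow>
        sg k * (xi k (\<theta> (tm + e)))\<^sup>2 < sg k * (xi k (\<theta> tm))\<^sup>2"
      using DERIV_neg_dec_right[of "\<lambda>t. sg k * (xi k (\<theta> t))\<^sup>2" "- (2 * (xi k (\<theta> tm))\<^sup>2)" tm] x0 by auto
    define e where "e = min (d / 2) T"
    have e: "0 < e" "e < d" "e \<le> T" using d(1) T(1) by (auto simp: e_def min_def)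
    have "sg k * (xi k (\<theta> (tm + T)))\<^sup>2 \<le> sg k * (xi k (\<theta> (tm + e)))\<^sup>2"
      by (rule xi_square_mono[OF fl]) (use e arc win in auto)
    moreover have "(xi k (\<theta> (tm + T)))\<^sup>2 = (xi k (\<theta> tm))\<^sup>2"
      using xi_cong_cos[OF k(1) T(3)] arc by blast
    ultimately show False using d(2)[OF e(1,2)] by simp
  qed
  then have "al (\<theta> tm) (h tm) = 0"
    using field_plug(1)[OF k(1) win[of tm]] by (simp add: arc_speed_def)
  from flow_rest[OF fl this be0, of 0] show ?thesis using \<open>al (\<theta> tm) (h tm) = 0\<close> be0 by simp
qed

text \<open>\<open>sg k * (xi k (\<theta> t))\<^sup>2\<close> is monotone and tends to 0 at both
  ends, so the orbit lies on the axis; an autonomous motion on a line with equal limits at both ends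
  is constant.\<close>

lemma tends_both_rest:
  assumes fl: "flow \<theta> h" and top: "tends k \<theta> h at_top" and bot: "tends k \<theta> h at_bot"
  shows "rest (\<theta> 0) (h 0)"
proof -
  have k: "k \<in> K" using top unfolding tends_def by blast
  have early: "\<exists>t0\<le>t. 4 * real_of_int k - 2 \<le> h t0" for t
  proof -
    obtain t0 where "\<bar>h t0 - 4 * real_of_int k\<bar> < 2" "t0 \<le> t"
      using eventually_happens[OF eventually_conj[OF tends_window[OF bot] eventually_le_at_bot[of t]]] by auto
    then show ?thesis by (intro exI[of _ t0]) auto
  qed
  have win: "\<bar>h t - 4 * real_of_int k\<bar> \<le> 2" for t
    using early[of t] forward_window[OF fl _ top] by blast
  have arc: "in_arc k (\<theta> t)" for t
    using early[of t] forward_in_arc[OF fl _ top] by blast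
  have x0: "xi k (\<theta> t) = 0" for t
  proof -
    have lim: "((\<lambda>t. sg k * (xi k (\<theta> t))\<^sup>2) \<longlongrightarrow> sg k * 0\<^sup>2) F" if "tends k \<theta> h F" for F
      by (intro tendsto_intros tends_xi[OF that])
    have mono: "sg k * (xi k (\<theta> v))\<^sup>2 \<le> sg k * (xi k (\<theta> u))\<^sup>2" if "u \<le> v" for u v
      by (rule xi_square_mono[OF fl that]) (use arc win in auto)
    have "sg k * (xi k (\<theta> t))\<^sup>2 \<le> sg k * 0\<^sup>2"
      by (rule tendsto_lowerbound[OF lim[OF bot] eventually_mono[OF eventually_le_at_bot[of t] mono]])
        auto
    moreover have "sg k * 0\<^sup>2 \<le> sg k * (xi k (\<theta> t))\<^sup>2"
      by (rule tendsto_upperbound[OF lim[OF top] eventually_mono[OF eventually_ge_at_top[of t] mono]])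
        auto
    ultimately show ?thesis using sg[OF k] by auto
  qed
  have al0: "al (\<theta> t) (h t) = 0" for t
    using field_plug(1)[OF k win[of t]] x0[of t] by (simp add: arc_speed_def)
  have be_eq: "be (\<theta> t) (h t) = 1 - dip (h t - 4 * real_of_int k)" for t
    using field_plug(2)[OF k win[of t]] x0[of t] arc[of t] by (simp add: arc_bump_def plateau_eq_1)
  have lim_top: "(h \<longlongrightarrow> 4 * real_of_int k + sg k * crit) at_top"
    and lim_bot: "(h \<longlongrightarrow> 4 * real_of_int k + sg k * crit) at_bot"
    using top bot unfolding tends_def by blast+
  have same: "be (\<theta> s) (h s) = be (\<theta> 0) (h 0)" if "h s = h 0" for s
    using be_eq[of s] be_eq[of 0] that by metis
  let ?c = "4 * real_of_int k + sg k * crit"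
  have "dip (?c - 4 * real_of_int k) = 1" using sg[OF k] by auto
  \<comment> \<open>If the speed at level \<open>h 0\<close> is nonzero, this level is crossed in
    one direction only, so equal limits at both ends squeeze \<open>h 0\<close> onto
    \<open>?c\<close>. But the speed at \<open>?c\<close> is zero.\<close>
  moreover have "h 0 = ?c" if ne: "be (\<theta> 0) (h 0) \<noteq> 0"
  proof (cases "0 < be (\<theta> 0) (h 0)")
    case True
    have pos: "0 < be (\<theta> s) (h s)" if "h s = h 0" for s
      using same[OF that] True by simp
    have up: "h 0 < h t" if "0 < t" for t
      by (rule stays_above_level[OF flow_deriv(2)[OF fl] _ order_refl that]) (erule pos)
    have down: "h t < h 0" if "t < 0" for t
      by (rule stays_below_level_backwards[OF flow_deriv(2)[OF fl] _ order_refl that]) (erule pos)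
    have "h 0 \<le> ?c"
      by (rule tendsto_lowerbound[OF lim_top eventually_mono[OF eventually_gt_at_top[of 0] less_imp_le[OF up]]]) auto
    moreover have "?c \<le> h 0"
      by (rule tendsto_upperbound[OF lim_bot eventually_mono[OF eventually_gt_at_bot[of 0] less_imp_le[OF down]]]) auto
    ultimately show ?thesis by simp
  next
    case False
    note d = DERIV_minus[OF flow_deriv(2)[OF fl]]
    have pos: "0 < - be (\<theta> s) (h s)" if "- h s = - h 0" for s
      using same[of s] that False ne by simp
    have "- h 0 < - h t" if "0 < t" for t
      by (rule stays_above_level[OF d _ order_refl that]) (erule pos)
    then have up: "h t < h 0" if "0 < t" for t using that by fastforce
    have "- h t < - h 0" if "t < 0" for t
      by (rule stays_below_level_backwards[OF d _ order_refl that]) (erule pos)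
    then have down: "h 0 < h t" if "t < 0" for t using that by fastforce
    have "?c \<le> h 0"
      by (rule tendsto_upperbound[OF lim_top eventually_mono[OF eventually_gt_at_top[of 0] less_imp_le[OF up]]]) auto
    moreover have "h 0 \<le> ?c"
      by (rule tendsto_lowerbound[OF lim_bot eventually_mono[OF eventually_gt_at_bot[of 0] less_imp_le[OF down]]]) auto
    ultimately show ?thesis by simp
  qed
  ultimately show ?thesis using al0 be_eq[of 0] by fastforce
qed

text \<open>For \<open>\<bar>h\<bar> \<le> 2\<close> the field does not depend on the angle, so the
  angle turned is an integral over the height. Up to height 1 the integrand is
  \<open>2 * pi / h\<^sup>2\<close> and yields the term \<open>1 / h 0\<close>; the remaining part
  goes into the constant \<open>c\<close>.\<close>

lemma ascend_angle:
  obtains c where "\<And>\<theta> h. \<lbrakk>flow \<theta> h; \<theta> 0 = 0; 1 / 10 \<le> h 0; h 0 \<le> 1\<rbrakk> \<Longrightarrow>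
    \<exists>t\<ge>0. h t = 2 \<and> \<theta> t = 2 * pi * om * (c - 1 / h 0)"
proof -
  define B where "B h = 1 - plateau 2 h * (1 - h\<^sup>2)" for h :: real
  have B_pos: "0 < B h" if "0 < h" "h \<le> 2" for h
    using be_base_pos[of h 0] field_base(2)[of h 0] that by (simp add: B_def)
  have cont_p: "continuous_on A (plateau 2)" for A
    using smooth_on_plateau[of 2] unfolding smooth_on_def by (metis Ck_on.simps(1) continuous_on_subset subset_UNIV)
  define p where "p h = 2 * pi * plateau 2 h / B h" for h
  have contB: "continuous_on A B" for A
    unfolding B_def[abs_def] by (intro continuous_intros cont_p)
  \<comment> \<open>The interval starts below \<open>1 / 10\<close> so that \<open>Q\<close> has a
    two-sided derivative at every admissible starting height.\<close>
  have "continuous_on {1/20..2} p"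
    unfolding p_def[abs_def] using B_pos
    by (intro continuous_on_divide continuous_on_mult continuous_on_const cont_p contB) (force simp: less_le)
  then obtain Q where Q: "\<And>h. h \<in> {1/20..2} \<Longrightarrow> (Q has_vector_derivative p h) (at h within {1/20..2})"
    using antiderivative_continuous by blast
  have Q': "(Q has_real_derivative p h) (at h)" if "1/20 < h" "h < 2" for h
    using Q[of h] that at_within_Icc_at[of "1/20" h 2] by (simp add: has_real_derivative_iff_has_vector_derivative)
  have contQ: "continuous_on {1/20..2} Q"
    using Q unfolding continuous_on_eq_continuous_within by (blast intro: has_vector_derivative_continuous)
  \<comment> \<open>Up to height 1 the function \<open>Q\<close> differs from
    \<open>- 2 * pi / h\<close> by a constant.\<close>
  have Q1: "Q s = Q 1 + 2 * pi * (1 - 1 / s)" if s: "1/10 \<le> s" "s \<le> 1" for s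
  proof -
    have d: "((\<lambda>h. Q h + 2 * pi / h) has_real_derivative 0) (at u)" if u: "u \<in> {s..1}" for u
    proof -
      have "u\<^sup>2 \<le> 1" using u s by (simp add: power_le_one)
      then have "p u = 2 * pi / u\<^sup>2" by (simp add: p_def B_def plateau_eq_1)
      then show ?thesis using Q'[of u] u s
        by (auto intro!: derivative_eq_intros simp: power2_eq_square)
    qed
    have "Q s + 2 * pi / s + 0 * (1 - s) \<le> Q 1 + 2 * pi / 1" "Q 1 + 2 * pi / 1 \<le> Q s + 2 * pi / s + 0 * (1 - s)"
      by (rule DERIV_leI[OF s(2) d] DERIV_geI[OF s(2) d]; simp)+
    then show ?thesis by (simp add: algebra_simps)
  qed
  show ?thesis
  proof (rule that)
    fix \<theta> h assume fl: "flow \<theta> h" and 0: "\<theta> 0 = 0" "1 / 10 \<le> h 0" "h 0 \<le> 1"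
    let ?s = "h 0"
    have low: "?s \<le> h t" if "0 \<le> t" for t
    proof (cases "t = 0")
      case False
      have "?s < h t"
        by (rule stays_above_level[OF flow_deriv(2)[OF fl] _ order_refl]) (use that False 0 be_base_pos[of ?s] in auto)
      then show ?thesis by simp
    qed simp
    have ne: "{?s..2} \<noteq> {}" using 0 by simp
    obtain m where m: "m \<in> {?s..2}" "\<And>u. u \<in> {?s..2} \<Longrightarrow> B m \<le> B u"
      using continuous_attains_inf[OF compact_Icc ne contB] by blast
    have be_B: "be (\<theta> t) (h t) = B (h t)" if "0 \<le> t" "h t \<le> 2" for t
      using field_base(2)[of "h t" "\<theta> t"] low[OF that(1)] that(2) 0 by (simp add: B_def)
    have "\<exists>t\<ge>0. h t = 2"
    proof (rule reaches_level[OF flow_deriv(2)[OF fl]])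
      show "0 < B m" using B_pos[of m] m(1) 0 by simp
      show "B m \<le> be (\<theta> t) (h t)" if "0 \<le> t" "h t \<le> 2" for t
        using be_B[OF that] m(2)[of "h t"] low[OF that(1)] that(2) by simp
    qed (use 0 in simp)
    then obtain T where T: "0 \<le> T" "h T = 2" by blast
    have up: "h t < 2" if "t < T" for t
      using level_down[OF fl, of T 0 t] T that by simp
    \<comment> \<open>A first integral: \<open>om * Q (h t)\<close> undoes the rotation on the way
      up.\<close>
    define g where "g t = \<theta> t + om * Q (h t)" for t
    have contg: "continuous_on {0..T} g"
      unfolding g_def[abs_def]
      by (intro continuous_intros flow_continuous[OF fl] continuous_on_compose2[OF contQ])
        (use low 0 up T in \<open>force simp: less_le\<close>)
    have dg: "(g has_real_derivative 0) (at t)" if t: "0 < t" "t < T" for t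
    proof -
      have b: "1/20 < h t" "h t < 2" using low[of t] up[of t] t 0 by auto
      have "al (\<theta> t) (h t) + om * (p (h t) * be (\<theta> t) (h t)) = 0"
        using be_B[of t] field_base(1)[of "h t" "\<theta> t"] t b B_pos[of "h t"] by (simp add: p_def)
      moreover have "((\<lambda>t. Q (h t)) has_real_derivative p (h t) * be (\<theta> t) (h t)) (at t)"
        using DERIV_chain2[OF Q'[OF b] flow_deriv(2)[OF fl]] .
      ultimately show ?thesis
        unfolding g_def[abs_def] using flow_deriv(1)[OF fl, of t] by (auto intro!: derivative_eq_intros simp: algebra_simps)
    qed
    have "g T = g 0"
    proof (cases "T = 0")
      case False
      then show ?thesis using DERIV_isconst_end[of 0 T g] T(1) contg dg by simp
    qed simp
    then have "\<theta> T = om * (Q ?s - Q 2)" using 0(1) T(2) by (simp add: g_def algebra_simps)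
    also have "\<dots> = 2 * pi * om * ((Q 1 - Q 2) / (2 * pi) + 1 - 1 / ?s)"
      unfolding Q1[OF 0(2,3)] using 0(2) by (simp add: field_simps)
    finally show "\<exists>t\<ge>0. h t = 2 \<and> \<theta> t = 2 * pi * om * ((Q 1 - Q 2) / (2 * pi) + 1 - 1 / ?s)"
      using T by blast
  qed
qed

lemma pass_window:
  assumes fl: "flow \<theta> h" and h0: "4 * real_of_int k - 2 \<le> h t0"
    and T: "t0 \<le> T" "4 * real_of_int k + 2 < h T" and le: "h t0 \<le> 4 * real_of_int k + 2"
  obtains t1 where "t0 \<le> t1" "h t1 = 4 * real_of_int k + 2"
    "\<And>t. t \<in> {t0..t1} \<Longrightarrow> \<bar>h t - 4 * real_of_int k\<bar> \<le> 2"
proof -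
  obtain t1 where t1: "t0 \<le> t1" "t1 \<le> T" "h t1 = 4 * real_of_int k + 2"
    using IVT'[of h t0 "4 * real_of_int k + 2" T, OF le _ T(1) flow_continuous(2)[OF fl]] T(2) by auto
  have "\<bar>h t - 4 * real_of_int k\<bar> \<le> 2" if "t \<in> {t0..t1}" for t
  proof -
    have "4 * real_of_int k - 2 \<le> h t"
      using level_up[OF fl, of "k - 1" t0 t] h0 that by (cases "t = t0") auto
    moreover have "h t \<le> 4 * real_of_int k + 2"
      using level_down[OF fl, of t1 k t] t1 that by (cases "t = t1") auto
    ultimately show ?thesis by linarith
  qed
  then show ?thesis using that t1 by blast
qed

lemma tends_passes:
  assumes lim: "tends j \<theta> h at_top" and "k < j"
  shows "\<exists>T\<ge>t0. 4 * real_of_int k + 2 < h T"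
proof -
  obtain T where "\<bar>h T - 4 * real_of_int j\<bar> < 2" "t0 \<le> T"
    using eventually_happens[OF eventually_conj[OF tends_window[OF lim] eventually_ge_at_top[of t0]]] by auto
  moreover have "real_of_int k + 1 \<le> real_of_int j" using assms(2) by linarith
  ultimately show ?thesis by (intro exI[of _ T]) auto
qed

text \<open>Induction downwards from plug \<open>j\<close>. In the arc of a lower plug
  \<open>k\<close> the orbit would also leave the window within this arc, where \<open>j\<close> has
  no entry angle. So it is outside that arc and passes the window vertically, and the angle is
  already right below it.\<close>

lemma tends_imp_hits_above:
  assumes sep: separated and fl: "flow \<theta> h"
    and k: "0 < k" "k \<le> j" "h t0 = 4 * real_of_int k - 2" and lim: "tends j \<theta> h at_top"
  shows "hits j (\<theta> t0)"
  using k
proof (induction "nat (j - k)" arbitrary: k t0)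
  case 0
  then have "k = j" by simp
  then show ?case using tends_imp_hits[OF fl _ lim] 0 by blast
next
  case (Suc n)
  then have kj: "k < j" by simp
  obtain T where T: "t0 \<le> T" "4 * real_of_int k + 2 < h T" using tends_passes[OF lim kj] by blast
  obtain t1 where t1: "t0 \<le> t1" "h t1 = 4 * real_of_int k + 2"
      "\<And>t. t \<in> {t0..t1} \<Longrightarrow> \<bar>h t - 4 * real_of_int k\<bar> \<le> 2"
    using pass_window[OF fl _ T] Suc.prems by auto
  have n: "n = nat (j - (k + 1))" using Suc.hyps(2) by linarith
  have h1: "h t1 = 4 * real_of_int (k + 1) - 2" using t1(2) by simp
  have hit: "hits j (\<theta> t1)"
    by (rule Suc.hyps(1)[OF n _ _ h1]) (use Suc.prems(1) kj in linarith)+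
  have "\<not> in_arc k (\<theta> t0)"
  proof
    assume "in_arc k (\<theta> t0)"
    then have "in_arc k (\<theta> t1)"
      by (rule arc_invariant[OF fl _ t1(3)]) (use t1(1) in auto)
    then show False using sep hit kj Suc.prems(1) unfolding separated_def by blast
  qed
  then have "\<theta> t1 = \<theta> t0"
    by (intro outside_arc_const[OF fl _ _ t1(3)]) (use t1(1) Suc.prems(1) in auto)
  then show ?case using hit by simp
qed

text \<open>An entry angle of \<open>j\<close> misses all lower arcs, so each lower window is
  crossed at constant angle with vertical speed 1.\<close>

lemma hits_imp_tends_above:
  assumes sep: separated and fl: "flow \<theta> h"
    and k: "0 < k" "k \<le> j" "h t0 = 4 * real_of_int k - 2" and hit: "hits j (\<theta> t0)"
  shows "tends j \<theta> h at_top"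
  using k hit
proof (induction "nat (j - k)" arbitrary: k t0)
  case 0
  then have "k = j" by simp
  then show ?case using hits_imp_tends[OF fl] 0 by blast
next
  case (Suc n)
  then have kj: "k < j" by simp
  have out: "\<not> in_arc k (\<theta> t0)" using sep Suc.prems kj unfolding separated_def by blast
  have k0: "k \<noteq> 0" using Suc.prems by simp
  have win: "\<bar>h s - 4 * real_of_int k\<bar> \<le> 2" if "s \<in> {t0..t}" "h t \<le> 4 * real_of_int k + 2" for s t
  proof -
    have "4 * real_of_int k - 2 \<le> h s"
      using level_up[OF fl, of "k - 1" t0 s] Suc.prems that by (cases "s = t0") auto
    moreover have "h s \<le> 4 * real_of_int k + 2"
      using level_down[OF fl, of t k s] that by (cases "s = t") auto
    ultimately show ?thesis by linarith
  qed
  have const: "\<theta> t = \<theta> t0" if "t0 \<le> t" "h t \<le> 4 * real_of_int k + 2" for t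
    by (rule outside_arc_const[OF fl k0 out win[OF _ that(2)]]) (use that(1) in auto)
  have "\<exists>t\<ge>t0. h t = 4 * real_of_int k + 2"
  proof (rule reaches_level[OF flow_deriv(2)[OF fl], where m = 1])
    fix t assume t: "t0 \<le> t" "h t \<le> 4 * real_of_int k + 2"
    have w: "\<bar>h t - 4 * real_of_int k\<bar> \<le> 2" using win[of t t] t by simp
    show "1 \<le> be (\<theta> t) (h t)"
    proof (cases "k \<in> K")
      case True
      then show ?thesis using field_plug(2)[OF True w] const[OF t] out by (simp add: arc_bump_def)
    next
      case False
      then show ?thesis using field_empty(2)[OF False k0 w] by simp
    qed
  qed (use Suc.prems in auto)
  then obtain t1 where t1: "t0 \<le> t1" "h t1 = 4 * real_of_int k + 2" by blast
  have n: "n = nat (j - (k + 1))" using Suc.hyps(2) by linarith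
  have h1: "h t1 = 4 * real_of_int (k + 1) - 2" using t1(2) by simp
  have "hits j (\<theta> t1)" using const[of t1] t1 Suc.prems(4) by simp
  then show ?case
    by (rule Suc.hyps(1)[OF n _ _ h1, rotated 2]) (use Suc.prems(1) kj in linarith)+
qed

text \<open>An orbit from saddle \<open>i\<close> starts in arc \<open>i\<close> and leaves window
  \<open>i\<close> within it, so by separation it reaches no higher saddle. Lower saddles are behind
  a one-way gate, and returning to \<open>i\<close> is excluded by monotonicity.\<close>

lemma connection_upwards_rest:
  assumes sep: separated and fl: "flow \<theta> h" and i: "0 < i"
    and bot: "tends i \<theta> h at_bot" and top: "tends j \<theta> h at_top"
  shows "rest (\<theta> 0) (h 0)"
proof -
  obtain t0 where t0: "\<bar>h t0 - 4 * real_of_int i\<bar> < 2" "in_arc i (\<theta> t0)"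
    using eventually_happens[OF eventually_conj[OF tends_window[OF bot] tends_in_arc[OF bot]]] by auto
  consider "j < i" | "j = i" | "i < j" by linarith
  then show ?thesis
  proof cases
    case 1
    then have ji: "real_of_int j + 1 \<le> real_of_int i" by linarith
    have "4 * real_of_int j + 2 < h s" if "t0 < s" for s
      by (rule level_up[OF fl _ that]) (use t0(1) ji in auto)
    then have "\<forall>\<^sub>F s in at_top. 4 * real_of_int j + 2 < h s"
      by (intro eventually_at_top_linorderI[of "t0 + 1"]) simp
    with tends_window[OF top] have "\<forall>\<^sub>F s in (at_top :: real filter). False"
      by eventually_elim auto
    then show ?thesis by simp
  next
    case 2
    then show ?thesis using tends_both_rest[OF fl] top bot by simp
  next
    case 3
    obtain T where T: "t0 \<le> T" "4 * real_of_int i + 2 < h T" using tends_passes[OF top 3] by blast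
    have b: "4 * real_of_int i - 2 \<le> h t0" "h t0 \<le> 4 * real_of_int i + 2" using t0(1) by auto
    obtain t1 where t1: "t0 \<le> t1" "h t1 = 4 * real_of_int i + 2"
        "\<And>t. t \<in> {t0..t1} \<Longrightarrow> \<bar>h t - 4 * real_of_int i\<bar> \<le> 2"
      using pass_window[OF fl b(1) T b(2)] by metis
    have "in_arc i (\<theta> t1)"
      by (rule arc_invariant[OF fl t0(2) t1(3)]) (use t1(1) in auto)
    moreover have h1: "h t1 = 4 * real_of_int (i + 1) - 2" using t1(2) by simp
    have "hits j (\<theta> t1)"
      by (rule tends_imp_hits_above[OF sep fl _ _ h1 top]) (use i 3 in linarith)+
    ultimately show ?thesis using sep i 3 unfolding separated_def by blast
  qed
qed

lemma tends_pos:
  assumes "flow \<theta> h" "0 < h t0" "tends j \<theta> h F" "F \<noteq> bot"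
  shows "0 < j"
proof (rule ccontr)
  assume "\<not> 0 < j"
  moreover have "j \<noteq> 0" using assms(3) K unfolding tends_def by auto
  ultimately have j: "real_of_int j \<le> - 1" by linarith
  obtain t where "\<bar>h t - 4 * real_of_int j\<bar> < 2"
    using eventually_happens[OF tends_window[OF assms(3)]] assms(4) by auto
  then have "h t < 0" using j by auto
  then show False using flow_pos[OF assms(1,2), of t] by simp
qed

end

text \<open>The second field is the first one carried by \<open>(\<theta>, h, t)\<close> to
  \<open>(\<theta>, - h, - t)\<close>, as \<open>field_reverse\<close> confirms. What is proved
  above the equator for \<open>bw\<close> thus holds below it for \<open>fw\<close>.\<close>

locale plug_field_pair =
  fw: plug_field K om th W kp sg +
  bw: plug_field "uminus ` K" "- om" "\<lambda>k. th (- k)" "\<lambda>k. W (- k)" "\<lambda>k. kp (- k)" "\<lambda>k. - sg (- k)"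
  for K :: "int set" and om :: real and th W kp sg :: "int \<Rightarrow> real" +
  assumes fw_separated: "fw.separated" and bw_separated: "bw.separated"
begin

lemma field_reverse: "bw.al \<theta> h = - fw.al \<theta> (- h)" "bw.be \<theta> h = fw.be \<theta> (- h)"
proof -
  have inj: "inj_on uminus K" by simp
  have a: "h + 4 * real_of_int k = - (- h - 4 * real_of_int k)" for k by simp
  have p: "plateau 3 (h + 4 * real_of_int k) = plateau 3 (- h - 4 * real_of_int k)"
    "dip (h + 4 * real_of_int k) = dip (- h - 4 * real_of_int k)" for k
    by (subst a, simp only: plateau_minus dip_minus)+
  show "bw.al \<theta> h = - fw.al \<theta> (- h)"
    unfolding bw.al_def fw.al_def sum.reindex[OF inj] by (simp add: p sum_negf)
  show "bw.be \<theta> h = fw.be \<theta> (- h)"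
    unfolding bw.be_def fw.be_def sum.reindex[OF inj] by (simp add: p)
qed

lemma flow_reverse:
  assumes "fw.flow \<theta> h"
  shows "bw.flow (\<lambda>t. \<theta> (- t)) (\<lambda>t. - h (- t))"
  unfolding bw.flow_def planar_solution_def
proof (intro allI conjI)
  fix t
  have u: "(uminus has_real_derivative - 1) (at t)" by (auto intro!: derivative_eq_intros)
  show "((\<lambda>t. \<theta> (- t)) has_real_derivative bw.al (\<theta> (- t)) (- h (- t))) (at t)"
    using DERIV_chain2[OF fw.flow_deriv(1)[OF assms] u] by (simp add: field_reverse)
  show "((\<lambda>t. - h (- t)) has_real_derivative bw.be (\<theta> (- t)) (- h (- t))) (at t)"
    using DERIV_minus[OF DERIV_chain2[OF fw.flow_deriv(2)[OF assms] u]] by (simp add: field_reverse)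
qed

lemma tends_reverse:
  "fw.tends k \<theta> h at_bot \<longleftrightarrow> bw.tends (- k) (\<lambda>t. \<theta> (- t)) (\<lambda>t. - h (- t)) at_top"
  "fw.tends k \<theta> h at_top \<longleftrightarrow> bw.tends (- k) (\<lambda>t. \<theta> (- t)) (\<lambda>t. - h (- t)) at_bot"
proof -
  have h: "((\<lambda>t. - h t) \<longlongrightarrow> 4 * real_of_int (- k) + - sg (- (- k)) * crit) F \<longleftrightarrow>
      (h \<longlongrightarrow> 4 * real_of_int k + sg k * crit) F" for h :: "real \<Rightarrow> real" and F :: "real filter"
    using tendsto_minus_cancel_left[of h "4 * real_of_int (- k) + - sg (- (- k)) * crit" F]
    by (simp add: add.commute)
  have k: "- k \<in> uminus ` K \<longleftrightarrow> k \<in> K" by force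
  show "fw.tends k \<theta> h at_bot \<longleftrightarrow> bw.tends (- k) (\<lambda>t. \<theta> (- t)) (\<lambda>t. - h (- t)) at_top"
    unfolding fw.tends_def bw.tends_def h k filterlim_at_bot_mirror by simp
  show "fw.tends k \<theta> h at_top \<longleftrightarrow> bw.tends (- k) (\<lambda>t. \<theta> (- t)) (\<lambda>t. - h (- t)) at_bot"
    unfolding fw.tends_def bw.tends_def h k filterlim_at_bot_mirror by simp
qed

text \<open>A connection that starts at a saddle above the equator is handled by the upward
  argument. One that starts below stays below, and its reversal runs upwards from \<open>- j\<close>
  to \<open>- i\<close> for the reversed field.\<close>

lemma no_connection:
  assumes fl: "fw.flow \<theta> h" and bot: "fw.tends i \<theta> h at_bot" and top: "fw.tends j \<theta> h at_top"
  shows "fw.rest (\<theta> 0) (h 0)"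
proof (cases "0 < i")
  case True
  then show ?thesis by (rule fw.connection_upwards_rest[OF fw_separated fl _ bot top])
next
  case False
  moreover have "i \<noteq> 0" using bot fw.K unfolding fw.tends_def by auto
  ultimately have i: "i < 0" by simp
  have "\<not> 0 < h t" for t using fw.tends_pos[OF fl _ bot, of t] i by auto
  moreover have "h t \<noteq> 0" for t
  proof
    assume z: "h t = 0"
    obtain s where "\<bar>h s - 4 * real_of_int i\<bar> < 2"
      using eventually_happens[OF fw.tends_window[OF bot]] by auto
    moreover have "real_of_int i \<le> -1" using i by linarith
    ultimately show False using fw.flow_zero(1)[OF fl z, of s] by auto
  qed
  ultimately have neg: "h t < 0" for t by (metis linorder_neqE_linordered_idom)
  have "0 < - j"
    using bw.tends_pos[OF flow_reverse[OF fl], of 0 "- j" at_bot] top neg[of 0] tends_reverse(2) by simp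
  then have "bw.rest (\<theta> (- 0)) (- h (- 0))"
    by (rule bw.connection_upwards_rest[OF bw_separated flow_reverse[OF fl]])
      (use bot top tends_reverse in auto)
  then show ?thesis by (simp add: field_reverse)
qed

end

section \<open>Geometry of the sphere\<close>

text \<open>The compact set will be the sphere, which is not convex. The bound on the derivative is
  therefore used on small balls only, and compactness turns the local constants into one.\<close>

lemma smooth_on_lipschitz_compact:
  fixes V :: "'a::euclidean_space \<Rightarrow> 'b::real_normed_vector"
  assumes U: "open U" and C: "compact C" "C \<subseteq> U" and V: "smooth_on U V"
  obtains L where "L-lipschitz_on C V"
proof -
  have C1: "Ck_on (Suc 0) U V" using V unfolding smooth_on_def by blast
  then have D: "(V has_derivative frechet_derivative V (at y)) (at y)" if "y \<in> U" for y
    using that frechet_derivative_works by auto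
  have ll: "local_lipschitz {0::real} C (\<lambda>_. V)"
  proof (rule local_lipschitzI)
    fix t :: real and x assume "x \<in> C"
    then obtain u where u: "u > 0" "cball x u \<subseteq> U"
      using U C(2) open_contains_cball by blast
    have "\<exists>B. \<forall>y\<in>cball x u. norm (frechet_derivative V (at y) i) \<le> B" if "i \<in> Basis" for i
    proof -
      have "continuous_on (cball x u) (\<lambda>y. frechet_derivative V (at y) i)"
        using C1 that u(2) by (auto intro: continuous_on_subset)
      then have "bounded ((\<lambda>y. frechet_derivative V (at y) i) ` cball x u)"
        by (intro compact_imp_bounded compact_continuous_image) auto
      then show ?thesis by (auto simp: bounded_iff)
    qed
    then obtain B where B: "\<And>i y. i \<in> Basis \<Longrightarrow> y \<in> cball x u \<Longrightarrow> norm (frechet_derivative V (at y) i) \<le> B i"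
      by metis
    have on: "onorm (frechet_derivative V (at y)) \<le> (\<Sum>i\<in>Basis. B i)" if y: "y \<in> cball x u" for y
    proof (rule onorm_le)
      fix w
      have lin: "linear (frechet_derivative V (at y))"
        using D[of y] u(2) y has_derivative_linear by blast
      have "frechet_derivative V (at y) w = (\<Sum>i\<in>Basis. (w \<bullet> i) *\<^sub>R frechet_derivative V (at y) i)"
        using linear_sum[OF lin, of "\<lambda>i. (w \<bullet> i) *\<^sub>R i" Basis] linear_cmul[OF lin]
        by (simp add: euclidean_representation)
      then have "norm (frechet_derivative V (at y) w) \<le> (\<Sum>i\<in>Basis. norm ((w \<bullet> i) *\<^sub>R frechet_derivative V (at y) i))"
        using norm_sum[of "\<lambda>i. (w \<bullet> i) *\<^sub>R frechet_derivative V (at y) i" Basis] by (simp only:)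
      also have "\<dots> \<le> (\<Sum>i\<in>Basis. B i * norm w)"
      proof (rule sum_mono)
        fix i :: 'a assume i: "i \<in> Basis"
        have "norm ((w \<bullet> i) *\<^sub>R frechet_derivative V (at y) i) \<le> norm w * B i"
          using B[OF i y] Basis_le_norm[OF i, of w] by (simp add: mult_mono)
        then show "norm ((w \<bullet> i) *\<^sub>R frechet_derivative V (at y) i) \<le> B i * norm w"
          by (simp add: mult.commute)
      qed
      finally show "norm (frechet_derivative V (at y) w) \<le> (\<Sum>i\<in>Basis. B i) * norm w"
        by (simp add: sum_distrib_right)
    qed
    have "(max 0 (\<Sum>i\<in>Basis. B i))-lipschitz_on (cball x u \<inter> C) V"
    proof (rule lipschitz_onI)
      fix y z assume "y \<in> cball x u \<inter> C" "z \<in> cball x u \<inter> C"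
      then have "norm (V y - V z) \<le> (max 0 (\<Sum>i\<in>Basis. B i)) * norm (y - z)"
        using on u(2)
        by (intro differentiable_bound[OF convex_cball[of x u], where f' = "\<lambda>y. frechet_derivative V (at y)"])
          (auto intro!: has_derivative_at_withinI[OF D] intro: max.coboundedI2)
      then show "dist (V y) (V z) \<le> (max 0 (\<Sum>i\<in>Basis. B i)) * dist y z"
        by (simp add: dist_norm)
    qed simp
    then show "\<exists>u>0. \<exists>L. \<forall>t\<in>cball t u \<inter> {0}. L-lipschitz_on (cball x u \<inter> C) V"
      using u(1) by blast
  qed
  show ?thesis
    using local_lipschitz_compact_implies_lipschitz[OF ll C(1) compact_sing] that by auto
qed

section \<open>Coordinates on the sphere\<close>

definition v3 :: "real \<Rightarrow> real \<Rightarrow> real \<Rightarrow> real^3" where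
  "v3 a b c = a *\<^sub>R axis 1 1 + b *\<^sub>R axis 2 1 + c *\<^sub>R axis 3 1"

lemma v3_nth [simp]: "v3 a b c $ 1 = a" "v3 a b c $ 2 = b" "v3 a b c $ 3 = c"
  by (simp_all add: v3_def axis_def)

lemma vec3_eq_iff: "p = q \<longleftrightarrow> p $ 1 = q $ 1 \<and> p $ 2 = q $ 2 \<and> p $ 3 = q $ 3" for p q :: "real^3"
  by (simp add: vec_eq_iff forall_3)

lemma inner3: "p \<bullet> q = p $ 1 * q $ 1 + p $ 2 * q $ 2 + p $ 3 * q $ 3" for p q :: "real^3"
  by (simp add: inner_vec_def sum_3)

lemma mem_S2: "p \<in> S2 \<longleftrightarrow> (p $ 1)\<^sup>2 + (p $ 2)\<^sup>2 + (p $ 3)\<^sup>2 = 1"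
proof -
  have "p \<in> S2 \<longleftrightarrow> norm p = 1" by simp
  also have "\<dots> \<longleftrightarrow> (norm p)\<^sup>2 = 1" using norm_ge_zero[of p] power2_eq_1_iff[of "norm p"] by linarith
  also have "\<dots> \<longleftrightarrow> (p $ 1)\<^sup>2 + (p $ 2)\<^sup>2 + (p $ 3)\<^sup>2 = 1"
    unfolding power2_norm_eq_inner inner3 by (simp only: power2_eq_square)
  finally show ?thesis .
qed

lemma v3_has_vector_derivative:
  assumes "(a has_real_derivative a') (at t within S)" "(b has_real_derivative b') (at t within S)"
    "(c has_real_derivative c') (at t within S)"
  shows "((\<lambda>t. v3 (a t) (b t) (c t)) has_vector_derivative v3 a' b' c') (at t within S)"
  unfolding v3_def
  using has_vector_derivative_scaleR[OF assms(1) has_vector_derivative_const[of "axis 1 1 :: real^3"]]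
    has_vector_derivative_scaleR[OF assms(2) has_vector_derivative_const[of "axis 2 1 :: real^3"]]
    has_vector_derivative_scaleR[OF assms(3) has_vector_derivative_const[of "axis 3 1 :: real^3"]]
  by (intro has_vector_derivative_add) simp_all

lemma bounded_linear_nth: "bounded_linear (\<lambda>p::real^3. p $ i)"
  by (rule bounded_linear_vec_nth)

lemma smooth_on_v3:
  assumes "open S" "smooth_on S a" "smooth_on S b" "smooth_on S c"
  shows "smooth_on S (\<lambda>x. v3 (a x) (b x) (c x))"
  unfolding v3_def using assms
  by (intro smooth_on_add smooth_on_linear_compose[of S "\<lambda>r. r *\<^sub>R w" for w] bounded_linear_scaleR_left)

lemma smooth_on_nth: "open S \<Longrightarrow> smooth_on S (\<lambda>p::real^3. p $ i)"
  by (rule smooth_on_bounded_linear[OF _ bounded_linear_nth])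

text \<open>The inverse of the Mercator projection. The two vectors defined next are its partial
  derivatives.\<close>

definition cyl :: "real \<Rightarrow> real \<Rightarrow> real^3" where
  "cyl \<theta> h = v3 (cos \<theta> / cosh h) (sin \<theta> / cosh h) (tanh h)"

definition cyl_th :: "real \<Rightarrow> real \<Rightarrow> real^3" where
  "cyl_th \<theta> h = v3 (- sin \<theta> / cosh h) (cos \<theta> / cosh h) 0"

definition cyl_h :: "real \<Rightarrow> real \<Rightarrow> real^3" where
  "cyl_h \<theta> h = v3 (- cos \<theta> * tanh h / cosh h) (- sin \<theta> * tanh h / cosh h) (1 - (tanh h)\<^sup>2)"

definition rot :: "real^3 \<Rightarrow> real^3" where
  "rot p = v3 (- p $ 2) (p $ 1) 0"

text \<open>\<open>axis 3 1 - p $ 3 *\<^sub>R p\<close>, on the sphere the tangential part of the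
  vertical unit vector. In Mercator coordinates it is the field \<open>h' = 1\<close>, and it is
  smooth across the poles.\<close>

definition climb :: "real^3 \<Rightarrow> real^3" where
  "climb p = v3 (- p $ 1 * p $ 3) (- p $ 2 * p $ 3) (1 - (p $ 3)\<^sup>2)"

lemma tanh_squared: "1 - (tanh h)\<^sup>2 = 1 / (cosh h)\<^sup>2" for h :: real
proof -
  have "1 - (tanh h)\<^sup>2 = ((cosh h)\<^sup>2 - (sinh h)\<^sup>2) / (cosh h)\<^sup>2"
    using cosh_real_pos[of h] by (simp add: tanh_def power_divide diff_divide_distrib)
  then show ?thesis by (simp add: cosh_square_eq)
qed

lemma cyl_in_S2: "cyl \<theta> h \<in> S2"
proof -
  have "(cos \<theta>)\<^sup>2 / (cosh h)\<^sup>2 + (sin \<theta>)\<^sup>2 / (cosh h)\<^sup>2 = 1 / (cosh h)\<^sup>2"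
    by (simp add: add_divide_distrib[symmetric])
  then show ?thesis using tanh_squared[of h] unfolding mem_S2 by (simp add: cyl_def power_divide)
qed

lemma cyl_third: "\<bar>cyl \<theta> h $ 3\<bar> < 1"
  using tanh_real_bounds[of h] by (simp add: cyl_def abs_less_iff)

lemma cyl_eq_iff: "cyl \<theta> h = cyl \<theta>' h' \<longleftrightarrow> h = h' \<and> cos \<theta> = cos \<theta>' \<and> sin \<theta> = sin \<theta>'"
proof -
  have "tanh h = tanh h' \<longleftrightarrow> h = h'" by (metis artanh_tanh_real)
  then show ?thesis
    using cosh_real_pos[of h'] by (auto simp: vec3_eq_iff cyl_def)
qed

lemma rot_cyl: "rot (cyl \<theta> h) = cyl_th \<theta> h" and climb_cyl: "climb (cyl \<theta> h) = cyl_h \<theta> h"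
  by (simp_all add: rot_def climb_def cyl_def cyl_th_def cyl_h_def)

lemma cyl_has_vector_derivative:
  assumes "(\<theta> has_real_derivative \<theta>') (at t within S)" "(h has_real_derivative h') (at t within S)"
  shows "((\<lambda>t. cyl (\<theta> t) (h t)) has_vector_derivative (\<theta>' *\<^sub>R cyl_th (\<theta> t) (h t) + h' *\<^sub>R cyl_h (\<theta> t) (h t)))
    (at t within S)"
proof -
  have c: "cosh (h t) \<noteq> 0" using cosh_real_pos[of "h t"] by simp
  have "((\<lambda>t. cyl (\<theta> t) (h t)) has_vector_derivative
      v3 (\<theta>' * (- sin (\<theta> t) / cosh (h t)) + h' * (- cos (\<theta> t) * tanh (h t) / cosh (h t)))
         (\<theta>' * (cos (\<theta> t) / cosh (h t)) + h' * (- sin (\<theta> t) * tanh (h t) / cosh (h t)))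
         (h' * (1 - (tanh (h t))\<^sup>2))) (at t within S)"
    unfolding cyl_def
  proof (intro v3_has_vector_derivative)
    show "((\<lambda>t. cos (\<theta> t) / cosh (h t)) has_real_derivative
      (\<theta>' * (- sin (\<theta> t) / cosh (h t)) + h' * (- cos (\<theta> t) * tanh (h t) / cosh (h t)))) (at t within S)"
      using c by (auto intro!: derivative_eq_intros assms simp: tanh_def divide_simps power2_eq_square algebra_simps)
    show "((\<lambda>t. sin (\<theta> t) / cosh (h t)) has_real_derivative
      (\<theta>' * (cos (\<theta> t) / cosh (h t)) + h' * (- sin (\<theta> t) * tanh (h t) / cosh (h t)))) (at t within S)"
      using c by (auto intro!: derivative_eq_intros assms simp: tanh_def divide_simps power2_eq_square algebra_simps)
    show "((\<lambda>t. tanh (h t)) has_real_derivative h' * (1 - (tanh (h t))\<^sup>2)) (at t within S)"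
      using c by (auto intro!: derivative_eq_intros assms)
  qed
  then show ?thesis by (simp add: cyl_th_def cyl_h_def v3_def algebra_simps)
qed

lemma tanh_artanh:
  assumes "\<bar>x::real\<bar> < 1"
  shows "tanh (artanh x) = x"
proof -
  have pos: "0 < (1 + x) / (1 - x)" using assms by auto
  have "exp (- 2 * artanh x) = inverse ((1 + x) / (1 - x))"
    unfolding artanh_def using pos by (simp add: exp_minus)
  then have "exp (- 2 * artanh x) = (1 - x) / (1 + x)" by simp
  then have "tanh (artanh x) = (1 - (1 - x) / (1 + x)) / (1 + (1 - x) / (1 + x))"
    unfolding tanh_real_altdef by simp
  also have "\<dots> = x" using assms by (simp add: field_simps)
  finally show ?thesis .
qed

lemma S2_cases:
  assumes "p \<in> S2"
  obtains "p = v3 0 0 1" | "p = v3 0 0 (- 1)" | \<theta> h where "p = cyl \<theta> h"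
proof -
  have eq: "(p $ 1)\<^sup>2 + (p $ 2)\<^sup>2 = 1 - (p $ 3)\<^sup>2" using assms unfolding mem_S2 by simp
  then have "(p $ 3)\<^sup>2 \<le> 1" using zero_le_power2[of "p $ 1"] zero_le_power2[of "p $ 2"] by linarith
  then consider "p $ 3 = 1" | "p $ 3 = - 1" | "\<bar>p $ 3\<bar> < 1"
    using abs_square_le_1[of "p $ 3"] by linarith
  then show ?thesis
  proof cases
    case 1
    then have "p $ 1 = 0 \<and> p $ 2 = 0" using eq by (simp add: sum_power2_eq_zero_iff)
    then show ?thesis using 1 by (intro that(1)) (simp add: vec3_eq_iff)
  next
    case 2
    then have "p $ 1 = 0 \<and> p $ 2 = 0" using eq by (simp add: sum_power2_eq_zero_iff)
    then show ?thesis using 2 by (intro that(2)) (simp add: vec3_eq_iff)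
  next
    case 3
    define h where "h = artanh (p $ 3)"
    have h: "tanh h = p $ 3" using 3 unfolding h_def by (rule tanh_artanh)
    have "(p $ 1 * cosh h)\<^sup>2 + (p $ 2 * cosh h)\<^sup>2 = (1 - (tanh h)\<^sup>2) * (cosh h)\<^sup>2"
      using eq h by (simp add: power_mult_distrib flip: distrib_right)
    also have "\<dots> = 1" using cosh_real_pos[of h] by (simp add: tanh_squared)
    finally obtain \<theta> where "p $ 1 * cosh h = cos \<theta>" "p $ 2 * cosh h = sin \<theta>"
      using sincos_total_2pi by metis
    then have "p = cyl \<theta> h"
      using h cosh_real_pos[of h] by (simp add: vec3_eq_iff cyl_def eq_divide_eq)
    then show ?thesis by (rule that(3))
  qed
qed

text \<open>The angle has no continuous branch on a full circle. An arbitrary choice will do, since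
  it is only ever fed to periodic functions.\<close>

definition ang :: "real^3 \<Rightarrow> real" where
  "ang p = (SOME \<theta>. p $ 1 = sqrt ((p $ 1)\<^sup>2 + (p $ 2)\<^sup>2) * cos \<theta> \<and> p $ 2 = sqrt ((p $ 1)\<^sup>2 + (p $ 2)\<^sup>2) * sin \<theta>)"

lemma ang_eq:
  assumes r: "0 < r" and p: "p $ 1 = r * cos \<theta>" "p $ 2 = r * sin \<theta>"
  shows "cos (ang p) = cos \<theta>" "sin (ang p) = sin \<theta>"
proof -
  have "(p $ 1)\<^sup>2 + (p $ 2)\<^sup>2 = r\<^sup>2 * ((cos \<theta>)\<^sup>2 + (sin \<theta>)\<^sup>2)"
    by (simp only: p power_mult_distrib distrib_left)
  then have "sqrt ((p $ 1)\<^sup>2 + (p $ 2)\<^sup>2) = r" using r by simp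
  then have "p $ 1 = r * cos (ang p) \<and> p $ 2 = r * sin (ang p)"
    using someI[of "\<lambda>\<theta>. p $ 1 = sqrt ((p $ 1)\<^sup>2 + (p $ 2)\<^sup>2) * cos \<theta> \<and> p $ 2 = sqrt ((p $ 1)\<^sup>2 + (p $ 2)\<^sup>2) * sin \<theta>" \<theta>] p
    unfolding ang_def by simp
  then show "cos (ang p) = cos \<theta>" "sin (ang p) = sin \<theta>" using p r by auto
qed

lemma ang_cyl: "cos (ang (cyl \<theta> h)) = cos \<theta>" "sin (ang (cyl \<theta> h)) = sin \<theta>"
  using ang_eq[of "1 / cosh h" "cyl \<theta> h" \<theta>] cosh_real_pos[of h] by (simp_all add: cyl_def)

text \<open>Near a point with angle \<open>\<theta>\<^sub>0\<close> the angle is \<open>\<theta>\<^sub>0\<close> plus an arctangent in rotated coordinates.\<close>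

lemma smooth_on_angle:
  fixes F :: "real \<Rightarrow> real"
  assumes F: "smooth_on UNIV F" and per: "\<And>x y. cos x = cos y \<Longrightarrow> sin x = sin y \<Longrightarrow> F x = F y"
  shows "smooth_on {p. p $ 1 \<noteq> 0 \<or> p $ 2 \<noteq> 0} (\<lambda>p. F (ang p))"
proof (rule smooth_on_local)
  fix p0 :: "real^3" assume p0: "p0 \<in> {p. p $ 1 \<noteq> 0 \<or> p $ 2 \<noteq> 0}"
  define r where "r = sqrt ((p0 $ 1)\<^sup>2 + (p0 $ 2)\<^sup>2)"
  have r: "0 < r" using p0 by (auto simp: r_def sum_power2_gt_zero_iff)
  have r2: "r\<^sup>2 = (p0 $ 1)\<^sup>2 + (p0 $ 2)\<^sup>2" by (simp add: r_def)
  have "(p0 $ 1 / r)\<^sup>2 + (p0 $ 2 / r)\<^sup>2 = ((p0 $ 1)\<^sup>2 + (p0 $ 2)\<^sup>2) / r\<^sup>2"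
    by (simp add: power_divide add_divide_distrib)
  also have "\<dots> = 1" using r r2 by (simp flip: r2)
  finally obtain t where t: "p0 $ 1 / r = cos t" "p0 $ 2 / r = sin t"
    using sincos_total_2pi by metis
  define X where "X p = p $ 1 * cos t + p $ 2 * sin t" for p :: "real^3"
  define Y where "Y p = p $ 2 * cos t - p $ 1 * sin t" for p :: "real^3"
  have U: "open {p. 0 < X p}" unfolding X_def by (intro open_Collect_less continuous_intros)
  have sX: "smooth_on {p. 0 < X p} X" and sY: "smooth_on {p. 0 < X p} Y"
    unfolding X_def[abs_def] Y_def[abs_def]
    by (intro smooth_on_add smooth_on_diff smooth_on_mult smooth_on_const smooth_on_nth U[unfolded X_def])+
  have X0: "0 < X p0"
  proof -
    have "p0 $ 1 = r * cos t" "p0 $ 2 = r * sin t" using t r by (simp_all add: field_simps)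
    then have "X p0 = r * ((cos t)\<^sup>2 + (sin t)\<^sup>2)" unfolding X_def
      by (simp only: power2_eq_square distrib_left mult.assoc)
    then show ?thesis using r by simp
  qed
  have "smooth_on {p. 0 < X p} (\<lambda>p. t + arctan (Y p / X p))"
    by (intro smooth_on_add smooth_on_const U smooth_on_compose[OF U _ _ _ smooth_on_arctan]
        smooth_on_divide sX sY) auto
  then have "smooth_on {p. 0 < X p} (\<lambda>p. F (t + arctan (Y p / X p)))"
    by (intro smooth_on_compose[OF U _ _ _ F]) auto
  moreover have "F (t + arctan (Y p / X p)) = F (ang p)" if "p \<in> {p. 0 < X p}" for p
  proof -
    let ?a = "arctan (Y p / X p)"
    define s where "s = sqrt (1 + (Y p / X p)\<^sup>2)"
    have Xp: "0 < X p" and s: "0 < s" using that by (auto simp: s_def add_pos_nonneg)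
    have c: "cos ?a = 1 / s" "sin ?a = (Y p / X p) / s"
      by (simp_all add: s_def cos_arctan sin_arctan)
    have "X p * s * cos (t + ?a) = cos t * X p - sin t * Y p"
      using Xp s by (simp add: cos_add c field_simps)
    also have "\<dots> = p $ 1 * ((cos t)\<^sup>2 + (sin t)\<^sup>2)"
      unfolding X_def Y_def by algebra
    finally have 1: "p $ 1 = X p * s * cos (t + ?a)" by simp
    have "X p * s * sin (t + ?a) = sin t * X p + cos t * Y p"
      using Xp s by (simp add: sin_add c field_simps)
    also have "\<dots> = p $ 2 * ((cos t)\<^sup>2 + (sin t)\<^sup>2)"
      unfolding X_def Y_def by algebra
    finally have 2: "p $ 2 = X p * s * sin (t + ?a)" by simp
    show ?thesis using ang_eq[of "X p * s", OF _ 1 2] Xp s by (intro per) simp_all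
  qed
  ultimately have "smooth_on {p. 0 < X p} (\<lambda>p. F (ang p))"
    by (rule smooth_on_cong[OF U, rotated])
  then show "\<exists>U. open U \<and> p0 \<in> U \<and> smooth_on U (\<lambda>p. F (ang p))"
    using U X0 by blast
qed

text \<open>A derivative within the sphere is a linear map on the whole space that is determined
  only on tangent vectors; differentiating the field along a curve in the sphere gives its value
  there.\<close>

lemma sphere_curve_derivative:
  assumes c: "(c has_vector_derivative d) (at 0)" "\<And>t. c t \<in> S2" "c 0 = p"
    and v: "((\<lambda>t. v (c t)) has_vector_derivative w) (at 0)"
    and L: "(v has_derivative L) (at p within S2)"
  shows "L d = w"
proof -
  have "range c \<subseteq> S2" using c(2) by blast
  from has_derivative_subset[OF L this]
  have "(v has_derivative L) (at (c 0) within range c)" unfolding c(3) .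
  from vector_derivative_diff_chain_within[OF c(1) this]
  have "((\<lambda>t. v (c t)) has_vector_derivative L d) (at 0)" by (simp add: o_def)
  then show ?thesis using v by (rule vector_derivative_unique_at)
qed

text \<open>The first hypothesis treats all derivatives \<open>L\<close> at once because
  \<open>L\<close> is not unique. Splitting the complex eigenvector along \<open>e1\<close> and
  \<open>e2\<close> decouples the eigenvalue equation.\<close>

lemma linear_part_eigenvalue_diagonal:
  assumes der: "\<And>L. (v has_derivative L) (at p within S2) \<Longrightarrow> L e1 = l1 *\<^sub>R e1 \<and> L e2 = l2 *\<^sub>R e2"
    and span: "\<And>a. a \<bullet> p = 0 \<Longrightarrow> \<exists>x y. a = x *\<^sub>R e1 + y *\<^sub>R e2"
    and indep: "\<And>x y. x *\<^sub>R e1 + y *\<^sub>R e2 = 0 \<Longrightarrow> x = 0 \<and> y = 0"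
    and z: "linear_part_eigenvalue v p z"
  shows "z = of_real l1 \<or> z = of_real l2"
proof -
  obtain L a b where L: "(v has_derivative L) (at p within S2)" and ab: "a \<bullet> p = 0" "b \<bullet> p = 0" "a \<noteq> 0 \<or> b \<noteq> 0"
    and eq: "L a = Re z *\<^sub>R a - Im z *\<^sub>R b" "L b = Im z *\<^sub>R a + Re z *\<^sub>R b"
    using z unfolding linear_part_eigenvalue_def by blast
  obtain x y where a: "a = x *\<^sub>R e1 + y *\<^sub>R e2" using span[OF ab(1)] by blast
  obtain x' y' where b: "b = x' *\<^sub>R e1 + y' *\<^sub>R e2" using span[OF ab(2)] by blast
  have lin: "linear L" using L has_derivative_linear by blast
  have La: "L a = (l1 * x) *\<^sub>R e1 + (l2 * y) *\<^sub>R e2" "L b = (l1 * x') *\<^sub>R e1 + (l2 * y') *\<^sub>R e2"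
    using der[OF L] unfolding a b by (simp_all add: linear_add[OF lin] linear_cmul[OF lin] mult.commute)
  have E1: "(l1 * x) *\<^sub>R e1 + (l2 * y) *\<^sub>R e2 = Re z *\<^sub>R a - Im z *\<^sub>R b"
    and E2: "(l1 * x') *\<^sub>R e1 + (l2 * y') *\<^sub>R e2 = Im z *\<^sub>R a + Re z *\<^sub>R b"
    using La eq by simp_all
  have z1: "(l1 * x - Re z * x + Im z * x') *\<^sub>R e1 + (l2 * y - Re z * y + Im z * y') *\<^sub>R e2 = 0"
    using E1 unfolding a b by (simp add: algebra_simps)
  have e1: "(l1 - Re z) * x + Im z * x' = 0" "(l2 - Re z) * y + Im z * y' = 0"
    using indep[OF z1] by (simp_all add: algebra_simps)
  have z2: "(l1 * x' - Re z * x' - Im z * x) *\<^sub>R e1 + (l2 * y' - Re z * y' - Im z * y) *\<^sub>R e2 = 0"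
    using E2 unfolding a b by (simp add: algebra_simps)
  have e2: "(l1 - Re z) * x' - Im z * x = 0" "(l2 - Re z) * y' - Im z * y = 0"
    using indep[OF z2] by (simp_all add: algebra_simps)
  \<comment> \<open>The last two premises are the real and imaginary parts of
    \<open>(l - z) * (u + \<i> * w) = 0\<close>.\<close>
  have key: "z = of_real l" if "u \<noteq> 0 \<or> w \<noteq> 0" "(l - Re z) * u + Im z * w = 0" "(l - Re z) * w - Im z * u = 0"
    for l u w :: real
  proof -
    have "((l - Re z)\<^sup>2 + (Im z)\<^sup>2) * (u\<^sup>2 + w\<^sup>2) =
        ((l - Re z) * u + Im z * w)\<^sup>2 + ((l - Re z) * w - Im z * u)\<^sup>2"
      by (simp add: power2_eq_square algebra_simps)
    also have "\<dots> = 0" by (simp add: that(2,3))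
    finally have "((l - Re z)\<^sup>2 + (Im z)\<^sup>2) * (u\<^sup>2 + w\<^sup>2) = 0" .
    moreover have "u\<^sup>2 + w\<^sup>2 \<noteq> 0" using that(1) by (simp add: sum_power2_eq_zero_iff)
    ultimately have "(l - Re z)\<^sup>2 + (Im z)\<^sup>2 = 0" by (simp only: mult_eq_0_iff simp_thms)
    then have "l = Re z \<and> Im z = 0" by (simp add: sum_power2_eq_zero_iff)
    then show ?thesis by (simp add: complex_eq_iff)
  qed
  have "x \<noteq> 0 \<or> x' \<noteq> 0 \<or> y \<noteq> 0 \<or> y' \<noteq> 0" using ab(3) a b by auto
  then show ?thesis using key[of x x' l1] key[of y y' l2] e1 e2 by blast
qed

section \<open>The vector field on the sphere\<close>

lemma norm_cyl [simp]: "norm (cyl \<theta> h) = 1"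
  using cyl_in_S2 by simp

context plug_field
begin

text \<open>The coefficients depend on the angle and on \<open>p $ 3\<close>, which make sense off
  the sphere too, so this is at once an extension to a neighbourhood. Near the poles the
  coefficients are 0 and 1, and \<open>climb\<close> continues the field across them.\<close>

definition vf :: "real^3 \<Rightarrow> real^3" where
  "vf p = (if \<bar>p $ 3\<bar> < 1
     then al (ang p) (artanh (p $ 3)) *\<^sub>R rot p + be (ang p) (artanh (p $ 3)) *\<^sub>R climb p
     else climb p)"

lemma arc_chart_cong:
  assumes "cos x = cos y" "sin x = sin y"
  shows "arc_chart w q (x - c) = arc_chart w q (y - c)" "arc_chart' w q (x - c) = arc_chart' w q (y - c)"
    "cos (x - c) = cos (y - c)"
  unfolding arc_chart_def arc_chart'_def cos_diff sin_diff assms by simp_all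

lemma arc_functions_cong:
  assumes "cos x = cos y" "sin x = sin y"
  shows "arc_speed w q (x - c) = arc_speed w q (y - c)" "arc_bump w q (x - c) = arc_bump w q (y - c)"
  unfolding arc_speed_def arc_bump_def arc_chart_cong[OF assms] by simp_all

lemma field_cong:
  assumes "cos x = cos y" "sin x = sin y"
  shows "al x h = al y h" "be x h = be y h"
  unfolding al_def be_def arc_functions_cong[OF assms] by simp_all

lemma vf_cyl: "vf (cyl \<theta> h) = al \<theta> h *\<^sub>R cyl_th \<theta> h + be \<theta> h *\<^sub>R cyl_h \<theta> h"
  using cyl_third[of \<theta> h] field_cong[OF ang_cyl[of \<theta> h]]
  by (simp add: vf_def rot_cyl climb_cyl) (simp add: cyl_def artanh_tanh_real)

lemma field_far:
  obtains H where "0 < H" "\<And>\<theta> h. H \<le> \<bar>h\<bar> \<Longrightarrow> al \<theta> h = 0 \<and> be \<theta> h = 1"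
proof -
  obtain N where N: "\<And>k. k \<in> K \<Longrightarrow> \<bar>real_of_int k\<bar> \<le> N"
    using finite_imp_bounded[of "real_of_int ` K"] K(1) unfolding bounded_iff by auto
  show ?thesis
  proof (rule that[of "4 * \<bar>N\<bar> + 3"])
    fix \<theta> h :: real assume h: "4 * \<bar>N\<bar> + 3 \<le> \<bar>h\<bar>"
    obtain k :: int where k: "\<bar>h - 4 * real_of_int k\<bar> \<le> 2" by (rule window_exists)
    have "k \<notin> K" using N[of k] k h by linarith
    moreover have "k \<noteq> 0" using k h by auto
    ultimately show "al \<theta> h = 0 \<and> be \<theta> h = 1" using field_empty[OF _ _ k] by blast
  qed simp
qed

lemma smooth_on_climb: "open S \<Longrightarrow> smooth_on S climb"
  unfolding climb_def[abs_def]
  by (intro smooth_on_v3 smooth_on_mult smooth_on_uminus smooth_on_diff smooth_on_power smooth_on_const smooth_on_nth)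

lemma vf_near_poles:
  obtains z where "0 < z" "z < 1" "\<And>p. z < \<bar>p $ 3\<bar> \<Longrightarrow> vf p = climb p"
proof -
  obtain H where H: "0 < H" "\<And>\<theta> h. H \<le> \<bar>h\<bar> \<Longrightarrow> al \<theta> h = 0 \<and> be \<theta> h = 1"
    using field_far by blast
  show ?thesis
  proof (rule that[of "tanh H"])
    show "0 < tanh H" using H(1) by simp
    show "tanh H < 1" by (rule tanh_real_lt_1)
    fix p :: "real^3" assume p: "tanh H < \<bar>p $ 3\<bar>"
    show "vf p = climb p"
    proof (cases "\<bar>p $ 3\<bar> < 1")
      case True
      define h where "h = artanh (p $ 3)"
      have "tanh h = p $ 3" using tanh_artanh[OF True] by (simp add: h_def)
      moreover have "tanh \<bar>h\<bar> = \<bar>tanh h\<bar>"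
        by (cases "0 \<le> h") (simp_all add: abs_of_neg)
      ultimately have "tanh H < tanh \<bar>h\<bar>" using p by simp
      then have "H \<le> \<bar>h\<bar>" by (metis less_imp_le tanh_real_less_iff)
      then show ?thesis using H(2) True by (simp add: vf_def h_def)
    qed (simp add: vf_def)
  qed
qed

text \<open>Away from the polar axis periodic functions of the angle are smooth; near the poles the
  field is the polynomial field \<open>climb\<close>.\<close>

lemma vf_smooth: "\<exists>U. open U \<and> S2 \<subseteq> U \<and> smooth_on U vf"
proof -
  obtain z where z: "0 < z" "z < 1" "\<And>p. z < \<bar>p $ 3\<bar> \<Longrightarrow> vf p = climb p"
    using vf_near_poles by blast
  define U1 where "U1 = {p::real^3. p $ 1 \<noteq> 0 \<or> p $ 2 \<noteq> 0} \<inter> {p. \<bar>p $ 3\<bar> < 1}"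
  define U2 where "U2 = {p::real^3. z < \<bar>p $ 3\<bar>}"
  have o1: "open U1" unfolding U1_def
    by (intro open_Int open_Collect_disj open_Collect_neq open_Collect_less continuous_intros)
  have o2: "open U2" unfolding U2_def by (intro open_Collect_less continuous_intros)
  have ang: "smooth_on U1 (\<lambda>p. F (ang p))" if "smooth_on UNIV F" "\<And>x y. cos x = cos y \<Longrightarrow> sin x = sin y \<Longrightarrow> F x = F y"
    for F :: "real \<Rightarrow> real"
    by (rule smooth_on_subset[OF smooth_on_angle[OF that]]) (auto simp: U1_def)
  have hgt: "smooth_on U1 (\<lambda>p. g (artanh (p $ 3)))" if "smooth_on UNIV g" for g :: "real \<Rightarrow> real"
    by (intro smooth_on_compose[OF o1 _ _ _ that] smooth_on_compose[OF o1 _ _ _ smooth_on_artanh] smooth_on_nth o1)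
      (auto simp: U1_def abs_less_iff)
  have shift: "smooth_on UNIV (\<lambda>x. g (x - c))" if "smooth_on UNIV g" for g :: "real \<Rightarrow> real" and c
    by (intro smooth_on_compose[OF _ _ _ _ that] smooth_on_diff smooth_on_const smooth_on_id) auto
  have "smooth_on U1 (\<lambda>p. al (ang p) (artanh (p $ 3)))"
    unfolding al_def
    by (intro smooth_on_diff smooth_on_sum smooth_on_mult smooth_on_const o1
        hgt[OF smooth_on_plateau] hgt[OF shift[OF smooth_on_plateau]]
        ang[OF shift[OF arc.smooth_on_arc_speed[OF arc_param]]] arc_functions_cong)
  moreover have "smooth_on U1 (\<lambda>p. be (ang p) (artanh (p $ 3)))"
  proof -
    have "smooth_on UNIV (\<lambda>h::real. 1 - plateau 2 h * (1 - h\<^sup>2))"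
      by (intro smooth_on_diff smooth_on_mult smooth_on_const smooth_on_plateau smooth_on_power smooth_on_id) auto
    note base = hgt[OF this]
    show ?thesis
      unfolding be_def
      by (intro smooth_on_diff[OF o1 base] smooth_on_sum smooth_on_mult o1 hgt[OF shift[OF smooth_on_dip]]
          ang[OF shift[OF arc.smooth_on_arc_bump[OF arc_param]]] arc_functions_cong)
  qed
  ultimately have "smooth_on U1 (\<lambda>p. v3
      (al (ang p) (artanh (p $ 3)) * (- p $ 2) + be (ang p) (artanh (p $ 3)) * (- p $ 1 * p $ 3))
      (al (ang p) (artanh (p $ 3)) * p $ 1 + be (ang p) (artanh (p $ 3)) * (- p $ 2 * p $ 3))
      (be (ang p) (artanh (p $ 3)) * (1 - (p $ 3)\<^sup>2)))"
    by (intro smooth_on_v3 smooth_on_add smooth_on_mult smooth_on_uminus smooth_on_diff smooth_on_const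
        smooth_on_power smooth_on_nth o1)
  then have s1: "smooth_on U1 vf"
    by (rule smooth_on_cong[OF o1, rotated]) (auto simp: U1_def vf_def rot_def climb_def vec3_eq_iff)
  have s2: "smooth_on U2 vf"
    by (rule smooth_on_cong[OF o2 _ smooth_on_climb[OF o2]]) (simp add: z(3) U2_def)
  have "S2 \<subseteq> U1 \<union> U2"
  proof
    fix p assume "p \<in> S2"
    then show "p \<in> U1 \<union> U2"
    proof (cases rule: S2_cases)
      case (3 \<theta> h)
      have "cos \<theta> \<noteq> 0 \<or> sin \<theta> \<noteq> 0" using sin_zero_abs_cos_one[of \<theta>] by auto
      then show ?thesis using 3 cyl_third[of \<theta> h] cosh_real_pos[of h] by (simp add: U1_def cyl_def)
    qed (use z in \<open>simp_all add: U2_def\<close>)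
  qed
  moreover have "smooth_on (U1 \<union> U2) vf"
    by (rule smooth_on_local) (use s1 s2 o1 o2 in blast)
  ultimately show ?thesis using o1 o2 by (intro exI[of _ "U1 \<union> U2"]) auto
qed

lemma vf_pole: "vf (v3 0 0 1) = 0" "vf (v3 0 0 (- 1)) = 0"
  by (simp_all add: vf_def climb_def vec3_eq_iff)

lemma flow_trajectory: "flow \<theta> h \<Longrightarrow> trajectory vf (\<lambda>t. cyl (\<theta> t) (h t))"
  unfolding trajectory_def
  using cyl_has_vector_derivative[OF flow_deriv] cyl_in_S2 by (simp add: vf_cyl del: mem_sphere)

lemma trajectory_unique:
  assumes "trajectory vf \<phi>" "trajectory vf \<psi>" "\<phi> t0 = \<psi> t0"
  shows "\<phi> = \<psi>"
proof
  fix t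
  obtain U where U: "open U" "S2 \<subseteq> U" "smooth_on U vf" using vf_smooth by blast
  obtain L where L: "L-lipschitz_on S2 vf"
    using smooth_on_lipschitz_compact[OF U(1) compact_sphere U(2,3)] by blast
  show "\<phi> t = \<psi> t"
  proof (rule gronwall_unique[where a = "min t t0" and b = "max t t0" and ?t0.0 = t0 and L = L])
    fix s
    show "(\<phi> has_vector_derivative vf (\<phi> s)) (at s)" "(\<psi> has_vector_derivative vf (\<psi> s)) (at s)"
      using assms(1,2) unfolding trajectory_def by blast+
    show "norm (vf (\<phi> s) - vf (\<psi> s)) \<le> L * norm (\<phi> s - \<psi> s)"
      using lipschitz_on_normD[OF L] assms(1,2) unfolding trajectory_def by blast
  qed (use assms(3) in auto)
qed

text \<open>Planar solutions exist for all times, so by uniqueness on the sphere every trajectory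
  that does not sit at a pole is the image of one. From here on trajectories are treated through
  \<open>flow\<close>.\<close>

lemma trajectory_cases:
  assumes "trajectory vf \<phi>"
  obtains (rest) "\<And>t. vf (\<phi> t) = 0" "\<And>t. \<phi> t = \<phi> 0"
  | (flow) \<theta> h where "flow \<theta> h" "\<phi> = (\<lambda>t. cyl (\<theta> t) (h t))"
proof -
  have pole: "thesis" if p: "\<phi> 0 = p" "vf p = 0" for p
  proof -
    have "p \<in> S2" using assms p(1) unfolding trajectory_def by blast
    then have "trajectory vf (\<lambda>_. p)"
      unfolding trajectory_def using p(2) by simp
    from trajectory_unique[OF assms this] p have "\<phi> = (\<lambda>_. p)" by blast
    then show ?thesis using rest p(2) by simp
  qed
  have "\<phi> 0 \<in> S2" using assms unfolding trajectory_def by blast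
  then show ?thesis
  proof (cases rule: S2_cases)
    case (3 \<theta>0 h0)
    obtain \<theta> h where fl: "\<theta> 0 = \<theta>0" "h 0 = h0" "flow \<theta> h" using flow_exists by metis
    have "\<phi> = (\<lambda>t. cyl (\<theta> t) (h t))"
      by (rule trajectory_unique[OF assms flow_trajectory[OF fl(3)], of 0]) (simp add: 3 fl)
    then show ?thesis using flow fl(3) by blast
  qed (use pole vf_pole in blast)+
qed

lemma cyl_frame_independent: "x *\<^sub>R cyl_th \<theta> h + y *\<^sub>R cyl_h \<theta> h = 0 \<Longrightarrow> x = 0 \<and> y = 0"
proof -
  assume eq: "x *\<^sub>R cyl_th \<theta> h + y *\<^sub>R cyl_h \<theta> h = 0"
  have "y * (1 - (tanh h)\<^sup>2) = 0"
    using arg_cong[OF eq, of "\<lambda>p. p $ 3"] by (simp add: cyl_th_def cyl_h_def)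
  then have y: "y = 0" using cosh_real_pos[of h] by (simp add: tanh_squared)
  then have "x * sin \<theta> = 0" "x * cos \<theta> = 0"
    using arg_cong[OF eq, of "\<lambda>p. p $ 1"] arg_cong[OF eq, of "\<lambda>p. p $ 2"] cosh_real_pos[of h]
    by (simp_all add: cyl_th_def cyl_h_def)
  then show ?thesis using y sin_zero_abs_cos_one[of \<theta>] by auto
qed

lemma cyl_frame_span:
  assumes "a \<bullet> cyl \<theta> h = 0"
  shows "\<exists>x y. a = x *\<^sub>R cyl_th \<theta> h + y *\<^sub>R cyl_h \<theta> h"
proof -
  have C: "0 < cosh h" by (rule cosh_real_pos)
  define T where "T = tanh h"
  define x where "x = cosh h * (a $ 2 * cos \<theta> - a $ 1 * sin \<theta>)"
  define y where "y = a $ 3 * (cosh h)\<^sup>2"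
  have T2: "(1 - T\<^sup>2) * (cosh h)\<^sup>2 = 1" using C by (simp add: T_def tanh_squared)
  have "(a $ 1 * cos \<theta> + a $ 2 * sin \<theta>) / cosh h + a $ 3 * T = 0"
    using assms by (simp add: inner3 cyl_def T_def add_divide_distrib)
  then have rad: "a $ 1 * cos \<theta> + a $ 2 * sin \<theta> = - a $ 3 * T * cosh h"
    using C by (simp add: field_simps)
  have sc: "(sin \<theta>)\<^sup>2 + (cos \<theta>)\<^sup>2 = 1" by simp
  have 1: "a $ 1 = - (a $ 2 * cos \<theta> - a $ 1 * sin \<theta>) * sin \<theta> + (a $ 1 * cos \<theta> + a $ 2 * sin \<theta>) * cos \<theta>"
    using sc by algebra
  have 2: "a $ 2 = (a $ 2 * cos \<theta> - a $ 1 * sin \<theta>) * cos \<theta> + (a $ 1 * cos \<theta> + a $ 2 * sin \<theta>) * sin \<theta>"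
    using sc by algebra
  have "a = x *\<^sub>R cyl_th \<theta> h + y *\<^sub>R cyl_h \<theta> h"
    unfolding vec3_eq_iff
  proof (intro conjI)
    show "a $ 1 = (x *\<^sub>R cyl_th \<theta> h + y *\<^sub>R cyl_h \<theta> h) $ 1"
      using 1 C unfolding rad x_def y_def by (simp add: cyl_th_def cyl_h_def T_def power2_eq_square algebra_simps)
    show "a $ 2 = (x *\<^sub>R cyl_th \<theta> h + y *\<^sub>R cyl_h \<theta> h) $ 2"
      using 2 C unfolding rad x_def y_def by (simp add: cyl_th_def cyl_h_def T_def power2_eq_square algebra_simps)
    show "a $ 3 = (x *\<^sub>R cyl_th \<theta> h + y *\<^sub>R cyl_h \<theta> h) $ 3"
      using T2 unfolding y_def T_def by (simp add: cyl_th_def cyl_h_def mult.assoc mult.commute[of "(cosh h)\<^sup>2"])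
  qed
  then show ?thesis by blast
qed

lemma vf_cyl_eq_0: "vf (cyl \<theta> h) = 0 \<longleftrightarrow> rest \<theta> h"
  unfolding vf_cyl using cyl_frame_independent[of "al \<theta> h" \<theta> h "be \<theta> h"] by auto

text \<open>The field is differentiated along the parallel and the meridian of the point. Along the
  parallel \<open>al\<close> has slope \<open>- sg k\<close> and \<open>be\<close> has slope 0;
  along the meridian \<open>al\<close> vanishes and \<open>be\<close> is \<open>1 - dip\<close>,
  with slope 8 times the relative height.\<close>

lemma plug_linear_part:
  assumes k: "k \<in> K" and y: "(h - 4 * real_of_int k)\<^sup>2 = 1 / 2"
    and L: "(vf has_derivative L) (at (cyl (th k) h) within S2)"
  shows "L (cyl_th (th k) h) = (- sg k) *\<^sub>R cyl_th (th k) h"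
    and "L (cyl_h (th k) h) = (8 * (h - 4 * real_of_int k)) *\<^sub>R cyl_h (th k) h"
proof -
  interpret arc "W k" "kp k" by (rule arc_param[OF k])
  let ?y = "h - 4 * real_of_int k"
  have yb: "\<bar>?y\<bar> < 1" using y abs_square_less_1[of ?y] by simp
  have p3: "plateau 3 ?y = 1" and dy: "dip ?y = 1" using y by (simp_all add: plateau_eq_1 dip_eq_1_iff)
  have c: "cos (W k) < 1" using cos_W by simp
  have al: "al (th k + t) h = - sg k * arc_speed (W k) (kp k) t" for t
    using field_plug(1)[OF k, of h "th k + t"] yb p3 by simp
  have be: "be (th k + t) h = 1 - arc_bump (W k) (kp k) t" for t
    using field_plug(2)[OF k, of h "th k + t"] yb dy by simp
  have chart0: "arc_chart (W k) (kp k) 0 = 0" by (simp add: arc_chart_def)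
  have sp0: "arc_speed (W k) (kp k) 0 = 0" "arc_bump (W k) (kp k) 0 = 1"
    using c by (simp_all add: arc_speed_def arc_bump_def chart0 plateau_eq_1)
  have d_cth: "((\<lambda>t. cyl_th (th k + t) h) has_vector_derivative
      v3 (- cos (th k) / cosh h) (- sin (th k) / cosh h) 0) (at 0)"
    unfolding cyl_th_def by (rule v3_has_vector_derivative) (auto intro!: derivative_eq_intros)
  have d_ch: "((\<lambda>t. cyl_h (th k + t) h) has_vector_derivative
      v3 (sin (th k) * tanh h / cosh h) (- cos (th k) * tanh h / cosh h) 0) (at 0)"
    unfolding cyl_h_def by (rule v3_has_vector_derivative) (auto intro!: derivative_eq_intros)
  show "L (cyl_th (th k) h) = (- sg k) *\<^sub>R cyl_th (th k) h"
  proof (rule sphere_curve_derivative[OF _ _ _ _ L, where c = "\<lambda>t. cyl (th k + t) h"])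
    show "((\<lambda>t. cyl (th k + t) h) has_vector_derivative cyl_th (th k) h) (at 0)"
      using cyl_has_vector_derivative[of "\<lambda>t. th k + t" 1 0 UNIV "\<lambda>t. h" 0]
      by (simp add: DERIV_add_const)
    have "((\<lambda>t. (- sg k * arc_speed (W k) (kp k) t) *\<^sub>R cyl_th (th k + t) h) has_vector_derivative
        (- sg k) *\<^sub>R cyl_th (th k) h) (at 0)"
      using has_vector_derivative_scaleR[OF DERIV_cmult[OF arc_speed_has_derivative[of 0], of "- sg k"] d_cth]
      by (simp add: sp0)
    moreover have "((\<lambda>t. (1 - arc_bump (W k) (kp k) t) *\<^sub>R cyl_h (th k + t) h) has_vector_derivative 0) (at 0)"
      using has_vector_derivative_scaleR[OF DERIV_diff[OF DERIV_const[of 1] arc_bump_has_derivative[of 0]] d_ch]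
      by (simp add: sp0)
    ultimately show "((\<lambda>t. vf (cyl (th k + t) h)) has_vector_derivative (- sg k) *\<^sub>R cyl_th (th k) h) (at 0)"
      unfolding vf_cyl al be by (rule has_vector_derivative_add[where g' = 0, simplified])
  qed simp_all
  show "L (cyl_h (th k) h) = (8 * ?y) *\<^sub>R cyl_h (th k) h"
  proof (rule sphere_curve_derivative[OF _ _ _ _ L, where c = "\<lambda>t. cyl (th k) (h + t)"])
    show "((\<lambda>t. cyl (th k) (h + t)) has_vector_derivative cyl_h (th k) h) (at 0)"
      using cyl_has_vector_derivative[of "\<lambda>t. th k" 0 0 UNIV "\<lambda>t. h + t" 1]
      by (simp add: DERIV_add_const)
    have "cosh h \<noteq> 0" using cosh_real_pos[of h] by simp
    then have T: "((\<lambda>t. tanh (h + t)) has_real_derivative 1 - (tanh h)\<^sup>2) (at 0)"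
      and C: "((\<lambda>t. cosh (h + t)) has_real_derivative sinh h) (at 0)" and C0: "cosh (h + 0) \<noteq> 0"
      by (auto intro!: derivative_eq_intros)
    obtain D where d_h: "((\<lambda>t. cyl_h (th k) (h + t)) has_vector_derivative D) (at 0)"
      unfolding cyl_h_def
      using v3_has_vector_derivative[OF DERIV_divide[OF DERIV_cmult[OF T, of "- cos (th k)"] C C0]
          DERIV_divide[OF DERIV_cmult[OF T, of "- sin (th k)"] C C0]
          DERIV_diff[OF DERIV_const[of 1] DERIV_power[OF T, of 2]]] by blast
    have "(dip has_real_derivative - 8 * ?y) (at (?y + 0))"
      using dip_has_derivative_critical[OF y] by simp
    then have dd: "((\<lambda>t. dip (?y + t)) has_real_derivative - 8 * ?y) (at 0)"
      using DERIV_shift[of dip "- 8 * ?y" 0 ?y] by (simp add: add.commute)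
    have d1: "((\<lambda>t. (1 - dip (?y + t)) *\<^sub>R cyl_h (th k) (h + t)) has_vector_derivative
        (8 * ?y) *\<^sub>R cyl_h (th k) h) (at 0)"
      using has_vector_derivative_scaleR[OF DERIV_diff[OF DERIV_const[of 1] dd] d_h] by (simp add: dy)
    have e1: "(1 - dip (?y + t)) *\<^sub>R cyl_h (th k) (h + t) = vf (cyl (th k) (h + t))" if "t \<in> {-1<..<1}" for t
    proof -
      have w: "\<bar>h + t - 4 * real_of_int k\<bar> \<le> 2" using that yb by auto
      have "h + t - 4 * real_of_int k = ?y + t" by simp
      note f = field_plug[OF k w, of "th k", unfolded this]
      show ?thesis unfolding vf_cyl f using sp0 by simp
    qed
    show "((\<lambda>t. vf (cyl (th k) (h + t))) has_vector_derivative (8 * ?y) *\<^sub>R cyl_h (th k) h) (at 0)"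
      by (rule has_vector_derivative_transform_within_open[OF d1 open_greaterThanLessThan[of "-1" 1] _ e1]) simp_all
  qed simp_all
qed

lemma plug_eigenvalue:
  assumes k: "k \<in> K" and y: "(h - 4 * real_of_int k)\<^sup>2 = 1 / 2"
    and z: "linear_part_eigenvalue vf (cyl (th k) h) z"
  shows "z = of_real (- sg k) \<or> z = of_real (8 * (h - 4 * real_of_int k))"
proof (rule linear_part_eigenvalue_diagonal[OF _ _ _ z])
  show "L (cyl_th (th k) h) = (- sg k) *\<^sub>R cyl_th (th k) h \<and>
      L (cyl_h (th k) h) = (8 * (h - 4 * real_of_int k)) *\<^sub>R cyl_h (th k) h"
    if "(vf has_derivative L) (at (cyl (th k) h) within S2)" for L
    using plug_linear_part[OF k y that] by (rule conjI)
qed (fact cyl_frame_span cyl_frame_independent)+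

lemma pole_eigenvalue:
  assumes s: "s = 1 \<or> s = - 1" and z: "linear_part_eigenvalue vf (v3 0 0 s) z"
  shows "z = of_real (- s)"
proof -
  have s2: "s * s = 1" using s by auto
  obtain r where r: "0 < r" "r < 1" "\<And>p. r < \<bar>p $ 3\<bar> \<Longrightarrow> vf p = climb p"
    using vf_near_poles by blast
  have lp: "L (v3 a b 0) = (- s) *\<^sub>R v3 a b 0"
    if L: "(vf has_derivative L) (at (v3 0 0 s) within S2)" and ab: "a\<^sup>2 + b\<^sup>2 = 1" for L a b
  \<comment> \<open>Great circles through the pole serve as test curves; near it the field is
    \<open>climb\<close>.\<close>
  proof (rule sphere_curve_derivative[OF _ _ _ _ L, where c = "\<lambda>t. v3 (a * sin t) (b * sin t) (s * cos t)"])
    show "((\<lambda>t. v3 (a * sin t) (b * sin t) (s * cos t)) has_vector_derivative v3 a b 0) (at 0)"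
      by (rule v3_has_vector_derivative) (auto intro!: derivative_eq_intros)
    show "v3 (a * sin t) (b * sin t) (s * cos t) \<in> S2" for t
    proof -
      have "(a * sin t)\<^sup>2 + (b * sin t)\<^sup>2 + (s * cos t)\<^sup>2 = (a\<^sup>2 + b\<^sup>2) * (sin t)\<^sup>2 + (s * s) * (cos t)\<^sup>2"
        by (simp add: power_mult_distrib power2_eq_square algebra_simps)
      then show ?thesis unfolding mem_S2 ab s2 by simp
    qed
    have "((\<lambda>t. climb (v3 (a * sin t) (b * sin t) (s * cos t))) has_vector_derivative v3 (- s * a) (- s * b) 0) (at 0)"
      unfolding climb_def
      by (rule v3_has_vector_derivative) (auto intro!: derivative_eq_intros simp: s2 power2_eq_square)
    moreover have "v3 (- s * a) (- s * b) 0 = (- s) *\<^sub>R v3 a b 0" by (simp add: vec3_eq_iff)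
    ultimately have "((\<lambda>t. climb (v3 (a * sin t) (b * sin t) (s * cos t))) has_vector_derivative (- s) *\<^sub>R v3 a b 0) (at 0)"
      by simp
    moreover have "open {t. r < \<bar>s * cos t\<bar>}" by (intro open_Collect_less continuous_intros)
    moreover have "climb (v3 (a * sin t) (b * sin t) (s * cos t)) = vf (v3 (a * sin t) (b * sin t) (s * cos t))"
      if "t \<in> {t. r < \<bar>s * cos t\<bar>}" for t
      using r(3)[of "v3 (a * sin t) (b * sin t) (s * cos t)"] that by simp
    ultimately show "((\<lambda>t. vf (v3 (a * sin t) (b * sin t) (s * cos t))) has_vector_derivative (- s) *\<^sub>R v3 a b 0) (at 0)"
      by (rule_tac has_vector_derivative_transform_within_open[where S = "{t. r < \<bar>s * cos t\<bar>}"]) (use r s in auto)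
  qed simp
  have "z = of_real (- s) \<or> z = of_real (- s)"
  proof (rule linear_part_eigenvalue_diagonal[OF _ _ _ z, where ?e1.0 = "v3 1 0 0" and ?e2.0 = "v3 0 1 0"])
    show "L (v3 1 0 0) = (- s) *\<^sub>R v3 1 0 0 \<and> L (v3 0 1 0) = (- s) *\<^sub>R v3 0 1 0"
      if "(vf has_derivative L) (at (v3 0 0 s) within S2)" for L
      using lp[OF that, of 1 0] lp[OF that, of 0 1] by simp
    show "\<exists>x y. a = x *\<^sub>R v3 1 0 0 + y *\<^sub>R v3 0 1 0" if "a \<bullet> v3 0 0 s = 0" for a
      using that s by (intro exI[of _ "a $ 1"] exI[of _ "a $ 2"]) (auto simp: inner3 vec3_eq_iff)
    show "x = 0 \<and> y = 0" if "x *\<^sub>R v3 1 0 0 + y *\<^sub>R v3 0 1 0 = 0" for x y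
      using that by (simp add: vec3_eq_iff)
  qed
  then show ?thesis by simp
qed

text \<open>At relative height \<open>y\<close> the eigenvalues are \<open>- sg k\<close> and
  \<open>8 * y\<close>. They have opposite signs at the upper singular point if
  \<open>sg k = 1\<close> and at the lower one if \<open>sg k = - 1\<close>.\<close>

definition saddle :: "int \<Rightarrow> real^3" where
  "saddle k = cyl (th k) (4 * real_of_int k + sg k * crit)"

lemma sg_crit_squared: "k \<in> K \<Longrightarrow> (sg k * crit)\<^sup>2 = 1 / 2"
  using sg[of k] crit_squared by auto

lemma singular_point_cases:
  assumes "p \<in> singular_points vf"
  obtains s where "s = 1 \<or> s = - 1" "p = v3 0 0 s"
  | k h where "k \<in> K" "(h - 4 * real_of_int k)\<^sup>2 = 1 / 2" "p = cyl (th k) h"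
proof -
  have p: "p \<in> S2" "vf p = 0" using assms unfolding singular_points_def by auto
  from p(1) show ?thesis
  proof (cases rule: S2_cases)
    case (3 \<theta> h)
    then have "rest \<theta> h" using p(2) vf_cyl_eq_0 by simp
    then obtain k where k: "k \<in> K" "cos (\<theta> - th k) = 1" "(h - 4 * real_of_int k)\<^sup>2 = 1 / 2"
      unfolding rest_iff by blast
    obtain n :: int where "\<theta> - th k = of_int n * 2 * pi" using k(2) cos_one_2pi_int by blast
    then have "\<theta> = th k + 2 * pi * of_int n" by (simp add: algebra_simps)
    then have "p = cyl (th k) h" using 3 by (simp add: cyl_def cos_add sin_add)
    then show ?thesis using that(2) k by blast
  qed (use that(1) in blast)+
qed

lemma saddle_singular: "k \<in> K \<Longrightarrow> saddle k \<in> singular_points vf"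
proof -
  assume k: "k \<in> K"
  have "rest (th k) (4 * real_of_int k + sg k * crit)"
    unfolding rest_iff using k sg_crit_squared[OF k] by (intro bexI[of _ k]) simp_all
  then have "vf (saddle k) = 0" unfolding saddle_def vf_cyl_eq_0 .
  then show ?thesis using cyl_in_S2 unfolding singular_points_def saddle_def by blast
qed

lemma finite_singular_points: "finite (singular_points vf)"
proof (rule finite_subset)
  show "singular_points vf \<subseteq> {v3 0 0 1, v3 0 0 (- 1)} \<union>
      (\<Union>k\<in>K. {cyl (th k) (4 * real_of_int k + crit), cyl (th k) (4 * real_of_int k - crit)})"
  proof
    fix p assume "p \<in> singular_points vf"
    then show "p \<in> {v3 0 0 1, v3 0 0 (- 1)} \<union>
      (\<Union>k\<in>K. {cyl (th k) (4 * real_of_int k + crit), cyl (th k) (4 * real_of_int k - crit)})"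
    proof (cases rule: singular_point_cases)
      case (2 k h)
      then have "h - 4 * real_of_int k = crit \<or> h - 4 * real_of_int k = - crit"
        unfolding crit_squared[symmetric] by (simp add: power2_eq_iff)
      then have "h = 4 * real_of_int k + crit \<or> h = 4 * real_of_int k - crit" by auto
      then show ?thesis using 2 by auto
    qed auto
  qed
qed (use K in auto)

lemma sphere_vector_field_vf: "sphere_vector_field vf"
  unfolding sphere_vector_field_def
proof (intro conjI ballI)
  show "\<exists>U V. open U \<and> S2 \<subseteq> U \<and> smooth_on U V \<and> (\<forall>x\<in>S2. V x = vf x)"
    using vf_smooth by blast
  show "vf x \<bullet> x = 0" if "x \<in> S2" for x
  proof -
    have "(x $ 1)\<^sup>2 + (x $ 2)\<^sup>2 + (x $ 3)\<^sup>2 = 1" using that unfolding mem_S2 .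
    then have "climb x \<bullet> x = 0"
      unfolding inner3 climb_def v3_nth by algebra
    moreover have "rot x \<bullet> x = 0" by (simp add: inner3 rot_def)
    ultimately show ?thesis unfolding vf_def by (simp add: inner_add_left)
  qed
  show "\<not> p islimpt singular_points vf" for p
    using finite_singular_points islimpt_finite by blast
qed

lemma hyperbolic_vf: "p \<in> singular_points vf \<Longrightarrow> hyperbolic_singular_point vf p"
  unfolding hyperbolic_singular_point_def
proof (intro conjI allI impI)
  fix z assume p: "p \<in> singular_points vf" and z: "linear_part_eigenvalue vf p z"
  from p show "Re z \<noteq> 0"
  proof (cases rule: singular_point_cases)
    case (1 s)
    then show ?thesis using pole_eigenvalue z by fastforce
  next
    case (2 k h)
    have "h - 4 * real_of_int k \<noteq> 0" using 2(2) by auto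
    then show ?thesis using plug_eigenvalue[OF 2(1,2)] z 2(3) sg[OF 2(1)] by fastforce
  qed
qed

lemma saddle_eigenvalues:
  assumes k: "k \<in> K"
  shows "linear_part_eigenvalue vf (saddle k) (of_real (- sg k))"
    "linear_part_eigenvalue vf (saddle k) (of_real (8 * (sg k * crit)))"
proof -
  let ?h = "4 * real_of_int k + sg k * crit"
  obtain U where U: "open U" "S2 \<subseteq> U" "smooth_on U vf" using vf_smooth by blast
  have "saddle k \<in> U" using cyl_in_S2 U(2) unfolding saddle_def by blast
  moreover have "Ck_on (Suc 0) U vf" using U(3) unfolding smooth_on_def by blast
  ultimately have "vf differentiable (at (saddle k))" by auto
  then obtain L where "(vf has_derivative L) (at (saddle k))"
    unfolding differentiable_def by blast
  then have L: "(vf has_derivative L) (at (cyl (th k) ?h) within S2)"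
    unfolding saddle_def by (rule has_derivative_at_withinI)
  have y: "(?h - 4 * real_of_int k)\<^sup>2 = 1 / 2" using sg_crit_squared[OF k] by simp
  note lp = plug_linear_part[OF k y L]
  have "linear L" using L has_derivative_linear by blast
  then have L0: "L 0 = 0" by (rule linear_0)
  have ne: "cyl_th (th k) ?h \<noteq> 0" "cyl_h (th k) ?h \<noteq> 0"
    using cyl_frame_independent[of 1 "th k" ?h 0] cyl_frame_independent[of 0 "th k" ?h 1] by auto
  have tang: "cyl_th (th k) ?h \<bullet> cyl (th k) ?h = 0" "cyl_h (th k) ?h \<bullet> cyl (th k) ?h = 0"
  proof -
    have "(- c * T / C) * (c / C) + (- s * T / C) * (s / C) + u * T = (u - ((sin x)\<^sup>2 + (cos x)\<^sup>2) / C\<^sup>2) * T"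
      if "c = cos x" "s = sin x" for c s x T C u :: real
      unfolding that[symmetric] by (simp add: power2_eq_square add_divide_distrib algebra_simps)
    from this[OF refl refl, where T = "tanh ?h" and C = "cosh ?h" and u = "1 - (tanh ?h)\<^sup>2"]
    show "cyl_h (th k) ?h \<bullet> cyl (th k) ?h = 0"
      unfolding inner3 cyl_h_def cyl_def v3_nth tanh_squared by simp
    show "cyl_th (th k) ?h \<bullet> cyl (th k) ?h = 0" by (simp add: inner3 cyl_th_def cyl_def)
  qed
  show "linear_part_eigenvalue vf (saddle k) (of_real (- sg k))"
    unfolding linear_part_eigenvalue_def saddle_def
    by (rule exI[of _ L], rule exI[of _ "cyl_th (th k) ?h"], rule exI[of _ 0]) (simp add: L lp L0 ne tang)
  show "linear_part_eigenvalue vf (saddle k) (of_real (8 * (sg k * crit)))"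
    unfolding linear_part_eigenvalue_def saddle_def
    by (rule exI[of _ L], rule exI[of _ "cyl_h (th k) ?h"], rule exI[of _ 0]) (simp add: L lp L0 ne tang)
qed

lemma hyperbolic_saddle_iff: "hyperbolic_saddle vf p \<longleftrightarrow> (\<exists>k\<in>K. p = saddle k)"
proof
  assume "hyperbolic_saddle vf p"
  then obtain c d :: real where p: "p \<in> singular_points vf" and cd: "c < 0" "0 < d"
    "linear_part_eigenvalue vf p (of_real c)" "linear_part_eigenvalue vf p (of_real d)"
    unfolding hyperbolic_saddle_def by blast
  from p show "\<exists>k\<in>K. p = saddle k"
  proof (cases rule: singular_point_cases)
    case (1 s)
    then have "complex_of_real c = of_real (- s)" "complex_of_real d = of_real (- s)"
      using pole_eigenvalue cd(3,4) by blast+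
    then show ?thesis using cd(1,2) by (metis less_asym of_real_eq_iff)
  next
    case (2 k h)
    let ?y = "h - 4 * real_of_int k"
    have "complex_of_real c = of_real (- sg k) \<or> complex_of_real c = of_real (8 * ?y)"
      "complex_of_real d = of_real (- sg k) \<or> complex_of_real d = of_real (8 * ?y)"
      using plug_eigenvalue[OF 2(1,2)] cd(3,4) 2(3) by blast+
    then have e: "c = - sg k \<or> c = 8 * ?y" "d = - sg k \<or> d = 8 * ?y" unfolding of_real_eq_iff by blast+
    have "?y\<^sup>2 = crit\<^sup>2" using 2(2) crit_squared by simp
    then have "?y = crit \<or> ?y = - crit" by (simp add: power2_eq_iff)
    then have "?y = sg k * crit"
      using e cd(1,2) sg[OF 2(1)] crit_bounds by auto
    then have "h = 4 * real_of_int k + sg k * crit" by simp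
    then show ?thesis using 2 unfolding saddle_def by blast
  qed
next
  assume "\<exists>k\<in>K. p = saddle k"
  then obtain k where k: "k \<in> K" "p = saddle k" by blast
  note ev = saddle_eigenvalues[OF k(1), folded k(2)]
  have "\<exists>c d. c < 0 \<and> 0 < d \<and> linear_part_eigenvalue vf p (complex_of_real c) \<and>
      linear_part_eigenvalue vf p (complex_of_real d)"
  proof (cases "sg k = 1")
    case True
    then have "- sg k < 0" "0 < 8 * (sg k * crit)" using crit_bounds by simp_all
    then show ?thesis using ev by blast
  next
    case False
    then have "sg k = - 1" using sg[OF k(1)] by blast
    then have "8 * (sg k * crit) < 0" "0 < - sg k" using crit_bounds by simp_all
    then show ?thesis using ev by blast
  qed
  then show "hyperbolic_saddle vf p"
    using saddle_singular[OF k(1)] k(2) unfolding hyperbolic_saddle_def by blast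
qed

end

section \<open>The equator as limit cycle\<close>

lemma tendsto_v3:
  "(a \<longlongrightarrow> a0) F \<Longrightarrow> (b \<longlongrightarrow> b0) F \<Longrightarrow> (c \<longlongrightarrow> c0) F \<Longrightarrow>
    ((\<lambda>x. v3 (a x) (b x) (c x)) \<longlongrightarrow> v3 a0 b0 c0) F"
  unfolding v3_def by (intro tendsto_intros)

lemma norm_v3_le: "norm (v3 a b c) \<le> \<bar>a\<bar> + \<bar>b\<bar> + \<bar>c\<bar>"
proof -
  have "norm (v3 a b c) \<le> norm (a *\<^sub>R axis 1 (1::real) :: real^3) + norm (b *\<^sub>R axis 2 (1::real) :: real^3) +
      norm (c *\<^sub>R axis 3 (1::real) :: real^3)"
    unfolding v3_def by (intro norm_triangle_le add_right_mono norm_triangle_ineq)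
  then show ?thesis by simp
qed

lemma smooth_on_exp: "open S \<Longrightarrow> smooth_on S f \<Longrightarrow> smooth_on S (\<lambda>x. exp (f x))" for f :: "real \<Rightarrow> real"
  by (rule smooth_on_compose[OF _ _ _ _ smooth_on_exp_real]) auto

lemma smooth_on_cyl: "smooth_on UNIV (cyl \<theta>)"
proof -
  have c: "smooth_on UNIV (\<lambda>h::real. (exp h + exp (- h)) * (1 / 2))"
    and s: "smooth_on UNIV (\<lambda>h::real. (exp h - exp (- h)) * (1 / 2))"
    by (intro smooth_on_mult smooth_on_add smooth_on_diff smooth_on_exp smooth_on_uminus smooth_on_const
        smooth_on_id open_UNIV)+
  have e: "cosh h = (exp h + exp (- h)) * (1 / 2)" "sinh h = (exp h - exp (- h)) * (1 / 2)" for h :: real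
    by (simp_all add: cosh_field_def sinh_field_def)
  have c': "smooth_on UNIV (cosh :: real \<Rightarrow> real)" and s': "smooth_on UNIV (sinh :: real \<Rightarrow> real)"
    using smooth_on_cong[OF open_UNIV _ c, of cosh] smooth_on_cong[OF open_UNIV _ s, of sinh] e by simp_all
  have "cosh h \<noteq> 0" for h :: real using cosh_real_pos[of h] by simp
  then show ?thesis
    unfolding cyl_def[abs_def] tanh_def
    by (intro smooth_on_v3 smooth_on_divide smooth_on_const c' s' open_UNIV)
qed

definition equator :: "(real^3) set" where
  "equator = range (\<lambda>\<theta>. cyl \<theta> 0)"

lemma infdist_equator_tendsto:
  assumes "(h \<longlongrightarrow> 0) F"
  shows "((\<lambda>t. infdist (cyl (\<theta> t) (h t)) equator) \<longlongrightarrow> 0) F"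
proof -
  have le: "infdist (cyl \<theta> h) equator \<le> 2 * \<bar>1 / cosh h - 1\<bar> + \<bar>tanh h\<bar>" for \<theta> h
  proof -
    have "infdist (cyl \<theta> h) equator \<le> dist (cyl \<theta> h) (cyl \<theta> 0)"
      by (rule infdist_le) (simp add: equator_def)
    also have "\<dots> = norm (v3 (cos \<theta> * (1 / cosh h - 1)) (sin \<theta> * (1 / cosh h - 1)) (tanh h))"
      unfolding dist_norm by (rule arg_cong[of _ _ norm]) (simp add: vec3_eq_iff cyl_def algebra_simps)
    also have "\<dots> \<le> \<bar>cos \<theta>\<bar> * \<bar>1 / cosh h - 1\<bar> + \<bar>sin \<theta>\<bar> * \<bar>1 / cosh h - 1\<bar> + \<bar>tanh h\<bar>"
      using norm_v3_le[of "cos \<theta> * (1 / cosh h - 1)" "sin \<theta> * (1 / cosh h - 1)" "tanh h"]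
      by (simp add: abs_mult)
    also have "\<dots> \<le> 1 * \<bar>1 / cosh h - 1\<bar> + 1 * \<bar>1 / cosh h - 1\<bar> + \<bar>tanh h\<bar>"
      by (intro add_mono mult_right_mono) auto
    finally show ?thesis by simp
  qed
  have "((\<lambda>t. 2 * \<bar>1 / cosh (h t) - 1\<bar> + \<bar>tanh (h t)\<bar>) \<longlongrightarrow> 2 * \<bar>1 / cosh 0 - 1\<bar> + \<bar>tanh 0\<bar>) F"
    by (intro tendsto_intros assms) simp_all
  then have "((\<lambda>t. 2 * \<bar>1 / cosh (h t) - 1\<bar> + \<bar>tanh (h t)\<bar>) \<longlongrightarrow> 0) F" by simp
  then show ?thesis
    by (rule tendsto_sandwich[OF _ _ tendsto_const, rotated 2]) (simp_all add: le infdist_nonneg)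
qed

definition return_map :: "real \<Rightarrow> real" where
  "return_map s = s / (1 - s)"

lemma return_map_expansion: "(\<lambda>x. return_map x - (x + x\<^sup>2)) \<in> O[at 0](\<lambda>x. x^3)"
proof (rule bigoI[of _ 2])
  have "\<forall>\<^sub>F x in at (0::real). x \<in> {- 1 / 2<..<1 / 2}"
    by (rule eventually_at_in_open') auto
  then show "\<forall>\<^sub>F x in at 0. norm (return_map x - (x + x\<^sup>2)) \<le> 2 * norm (x ^ 3)"
  proof (rule eventually_mono)
    fix x :: real assume x: "x \<in> {- 1 / 2<..<1 / 2}"
    then have "return_map x - (x + x\<^sup>2) = x ^ 3 * (1 / (1 - x))"
      by (simp add: return_map_def field_simps power2_eq_square power3_eq_cube)
    moreover have "\<bar>1 / (1 - x)\<bar> \<le> 2" using x by (simp add: field_simps)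
    then have "\<bar>x ^ 3\<bar> * \<bar>1 / (1 - x)\<bar> \<le> \<bar>x ^ 3\<bar> * 2" by (rule mult_left_mono) simp
    ultimately show "norm (return_map x - (x + x\<^sup>2)) \<le> 2 * norm (x ^ 3)"
      by (simp only: real_norm_def abs_mult mult.commute)
  qed
qed

context plug_field
begin

text \<open>All other periodic motions are at rest. So the equator is isolated among closed orbits,
  and the hyperbolicity of the other limit cycles holds vacuously.\<close>

lemma closed_orbit_equator: "closed_orbit vf \<gamma> \<longleftrightarrow> \<gamma> = equator"
proof
  assume "closed_orbit vf \<gamma>"
  then obtain \<phi> \<tau> where \<phi>: "trajectory vf \<phi>" "0 < \<tau>" "\<And>t. \<phi> (t + \<tau>) = \<phi> t" "vf (\<phi> 0) \<noteq> 0" "\<gamma> = range \<phi>"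
    unfolding closed_orbit_def by blast
  from \<phi>(1) show "\<gamma> = equator"
  proof (cases rule: trajectory_cases)
    case rest
    then show ?thesis using \<phi>(4) by blast
  next
    case (flow \<theta> h)
    have per: "h (t + \<tau>) = h t" "cos (\<theta> (t + \<tau>)) = cos (\<theta> t)" "sin (\<theta> (t + \<tau>)) = sin (\<theta> t)" for t
      using \<phi>(3)[of t] flow(2) by (simp_all add: cyl_eq_iff)
    have "cos (\<theta> (t + \<tau>) - c) = cos (\<theta> t - c)" for t c
      by (simp add: cos_diff per)
    then have "h 0 = 0"
      using periodic_flow_rest[OF flow(1) \<phi>(2) per(1)] \<phi>(4) flow(2) vf_cyl_eq_0 by blast
    note z = flow_zero[OF flow(1) this]
    have om0: "om \<noteq> 0" using om by auto
    have "cyl x 0 \<in> range \<phi>" for x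
    proof -
      have "\<phi> ((\<theta> 0 - x) / (2 * pi * om)) = cyl x 0"
        using flow(2) z(1)[of "(\<theta> 0 - x) / (2 * pi * om)"] z(2)[of "(\<theta> 0 - x) / (2 * pi * om)"] om0
        by simp
      then show ?thesis by (metis rangeI)
    qed
    moreover have "\<phi> t \<in> equator" for t using flow(2) z(1)[of t] by (simp add: equator_def)
    ultimately show ?thesis unfolding \<phi>(5) equator_def by blast
  qed
next
  assume g: "\<gamma> = equator"
  obtain \<theta> h where fl: "\<theta> 0 = 0" "h 0 = 0" "flow \<theta> h" using flow_exists by metis
  note z = flow_zero[OF fl(3,2)]
  have om0: "om \<noteq> 0" using om by auto
  have cyl: "cyl (\<theta> t) (h t) = cyl (- 2 * pi * om * t) 0" for t using z[of t] fl(1) by simp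
  have "cyl (\<theta> (t + 1)) (h (t + 1)) = cyl (\<theta> t) (h t)" for t
  proof -
    have "cos (- 2 * pi * om * (t + 1)) = cos (- 2 * pi * om * t)" "sin (- 2 * pi * om * (t + 1)) = sin (- 2 * pi * om * t)"
      using om by (auto simp: distrib_left cos_add sin_add cos_diff sin_diff)
    then show ?thesis unfolding cyl cyl_eq_iff by simp
  qed
  moreover have "vf (cyl (\<theta> 0) (h 0)) \<noteq> 0"
    unfolding vf_cyl_eq_0 using om0 by (simp add: fl field_core)
  moreover have "equator = range (\<lambda>t. cyl (\<theta> t) (h t))"
  proof -
    have "cyl x 0 = cyl (\<theta> (- x / (2 * pi * om))) (h (- x / (2 * pi * om)))" for x
      unfolding cyl using om0 by simp
    then have "cyl x 0 \<in> range (\<lambda>t. cyl (\<theta> t) (h t))" for x by blast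
    moreover have "cyl (\<theta> t) (h t) \<in> range (\<lambda>x. cyl x 0)" for t unfolding cyl by blast
    ultimately show ?thesis unfolding equator_def by blast
  qed
  ultimately show "closed_orbit vf \<gamma>"
    unfolding closed_orbit_def g using flow_trajectory[OF fl(3)]
    by (intro exI[of _ "\<lambda>t. cyl (\<theta> t) (h t)"] exI[of _ 1]) simp
qed

lemma limit_cycle_iff: "limit_cycle vf \<gamma> \<longleftrightarrow> \<gamma> = equator"
  unfolding limit_cycle_def closed_orbit_equator by blast

lemma cross_section_vf: "cross_section vf equator (cyl 0) (- 1 / 2) (1 / 2)"
  unfolding cross_section_def
proof (intro conjI ballI)
  show "\<exists>U. open U \<and> {- 1 / 2..1 / 2} \<subseteq> U \<and> smooth_on U (cyl 0)"
    using smooth_on_cyl[of 0] by (intro exI[of _ UNIV]) simp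
  show "inj_on (cyl 0) {- 1 / 2..1 / 2}" by (rule inj_onI) (simp add: cyl_eq_iff)
  fix s :: real assume s: "s \<in> {- 1 / 2..1 / 2}"
  show "cyl 0 s \<in> S2" by (rule cyl_in_S2)
  show "cyl 0 s \<in> equator \<longleftrightarrow> s = 0"
    unfolding equator_def using cyl_eq_iff[of 0 s _ 0] by auto
  have "(cyl 0 has_vector_derivative cyl_h 0 s) (at s)"
    using cyl_has_vector_derivative[of "\<lambda>t. 0" 0 s UNIV "\<lambda>t. t" 1] by simp
  then have vd: "vector_derivative (cyl 0) (at s) = cyl_h 0 s" by (rule vector_derivative_at)
  have "om \<noteq> 0" using om by auto
  then have "al 0 s \<noteq> 0" using s field_core(1)[of s 0] by (simp add: abs_le_iff)
  then have "cross3 (cyl_h 0 s) (vf (cyl 0 s)) $ 1 \<noteq> 0"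
    using cosh_real_pos[of s] unfolding vf_cyl
    by (simp add: cross3_def cyl_h_def cyl_th_def tanh_squared)
  then show "cross3 (vector_derivative (cyl 0) (at s)) (vf (cyl 0 s)) \<noteq> 0"
    unfolding vd by force
qed simp_all

lemma poincare_map_vf: "poincare_map vf equator (cyl 0) (- 1 / 2) (1 / 2) {- 1 / 4<..<1 / 4} return_map"
  unfolding poincare_map_def
proof (intro conjI ballI cross_section_vf)
  show "smooth_on {- 1 / 4<..<1 / 4} return_map"
    unfolding return_map_def[abs_def]
    by (intro smooth_on_divide smooth_on_diff smooth_on_const smooth_on_id) auto
  fix s :: real assume s: "s \<in> {- 1 / 4<..<1 / 4}"
  show r: "return_map s \<in> {- 1 / 2..1 / 2}"
    using s by (auto simp: return_map_def field_simps)
  obtain \<theta> h where fl: "\<theta> 0 = 0" "h 0 = s" "flow \<theta> h" using flow_exists by metis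
  \<comment> \<open>\<open>\<bar>s\<bar> < 1 / 4\<close> gives \<open>1 - s * t \<ge> 3 / 4\<close>
    during one turn, so the orbit stays in the core, where the solution is explicit.\<close>
  have bd: "\<bar>s\<bar> \<le> 1 - s * t \<and> 0 < 1 - s * t" if "t \<in> {0..1}" for t
  proof -
    have "\<bar>s * t\<bar> \<le> 1 / 4 * 1" unfolding abs_mult using s that by (intro mult_mono) auto
    then show ?thesis using s by auto
  qed
  have core: "\<theta> t = - 2 * pi * om * t" "h t = s / (1 - s * t)" if "t \<in> {0..1}" for t
    using flow_core[OF fl(3,2) _ that bd] fl(1) by simp_all
  show "first_return vf (cyl 0 ` {- 1 / 2..1 / 2}) (cyl 0 s) (cyl 0 (return_map s))"
    unfolding first_return_def
  proof (intro exI[of _ "\<lambda>t. cyl (\<theta> t) (h t)"] exI[of _ 1] conjI allI impI)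
    show "trajectory vf (\<lambda>t. cyl (\<theta> t) (h t))" by (rule flow_trajectory[OF fl(3)])
    show "cyl (\<theta> 0) (h 0) = cyl 0 s" by (simp add: fl)
    show "cyl (\<theta> 1) (h 1) = cyl 0 (return_map s)"
      using core[of 1] om by (auto simp: return_map_def cyl_eq_iff)
    show "cyl 0 (return_map s) \<in> cyl 0 ` {- 1 / 2..1 / 2}" using r by blast
    fix t :: real assume t: "0 < t \<and> t < 1"
    show "cyl (\<theta> t) (h t) \<notin> cyl 0 ` {- 1 / 2..1 / 2}"
    proof
      assume "cyl (\<theta> t) (h t) \<in> cyl 0 ` {- 1 / 2..1 / 2}"
      then have "cos (\<theta> t) = 1" by (auto simp: cyl_eq_iff)
      then have "cos (2 * pi * t) = 1" using core(1)[of t] t om by auto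
      then obtain n :: int where "2 * pi * t = of_int n * 2 * pi" using cos_one_2pi_int by blast
      then have "t = of_int n" by simp
      then show False using t by auto
    qed
  qed simp
qed auto

lemma parabolic_vf: "parabolic_cycle_mult2 vf equator"
  unfolding parabolic_cycle_mult2_def limit_cycle_iff
  using poincare_map_vf return_map_expansion
  by (intro conjI refl exI[of _ "cyl 0"] exI[of _ "- 1 / 2"] exI[of _ "1 / 2"]
      exI[of _ "{- 1 / 4<..<1 / 4}"] exI[of _ return_map] exI[of _ 1]) simp_all

lemma takens_vf: "takens_generator {- 1 / 4<..<1 / 4} return_map UNIV (\<lambda>x. x\<^sup>2)"
  unfolding takens_generator_def
proof (intro conjI ballI)
  show "smooth_on UNIV (\<lambda>x::real. x\<^sup>2)" by (rule smooth_on_power[OF open_UNIV smooth_on_id[OF open_UNIV]])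
  show "(\<lambda>x::real. x\<^sup>2 - x\<^sup>2) \<in> O[at 0](\<lambda>x. x ^ 3)" by simp
  fix s :: real assume s: "s \<in> {- 1 / 4<..<1 / 4}"
  have bd: "1 - s * t \<noteq> 0" if "t \<in> {0..1}" for t
  proof -
    have "\<bar>s * t\<bar> \<le> 1 / 4 * 1" unfolding abs_mult using s that by (intro mult_mono) auto
    then show ?thesis by auto
  qed
  show "\<exists>\<psi>. \<psi> 0 = s \<and> \<psi> 1 = return_map s \<and>
      (\<forall>t\<in>{0..1}. \<psi> t \<in> UNIV \<and> (\<psi> has_real_derivative (\<psi> t)\<^sup>2) (at t within {0..1}))"
    using bd
    by (intro exI[of _ "\<lambda>t. s / (1 - s * t)"])
      (auto simp: return_map_def power2_eq_square intro!: derivative_eq_intros)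
qed auto

section \<open>Separatrices on the sphere and limits on the cylinder\<close>

lemma cyl_tendsto_saddle_iff:
  assumes k: "k \<in> K"
  shows "((\<lambda>t. cyl (\<theta> t) (h t)) \<longlongrightarrow> saddle k) F \<longleftrightarrow> tends k \<theta> h F"
proof
  let ?h = "4 * real_of_int k + sg k * crit"
  assume lim: "((\<lambda>t. cyl (\<theta> t) (h t)) \<longlongrightarrow> saddle k) F"
  note c = lim[THEN tendsto_vec_nth]
  have "((\<lambda>t. artanh (tanh (h t))) \<longlongrightarrow> artanh (tanh ?h)) F"
    using c[of 3] tanh_real_bounds[of ?h] unfolding saddle_def cyl_def v3_nth
    by (intro tendsto_artanh) auto
  then have h: "(h \<longlongrightarrow> ?h) F" by (simp add: artanh_tanh_real)
  have C: "cosh x \<noteq> 0" for x :: real using cosh_real_pos[of x] by simp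
  have "((\<lambda>t. cos (\<theta> t) / cosh (h t) * cosh (h t)) \<longlongrightarrow> cos (th k) / cosh ?h * cosh ?h) F"
    "((\<lambda>t. sin (\<theta> t) / cosh (h t) * cosh (h t)) \<longlongrightarrow> sin (th k) / cosh ?h * cosh ?h) F"
    using tendsto_mult[OF c[of 1, unfolded saddle_def cyl_def v3_nth] tendsto_cosh[OF h]]
      tendsto_mult[OF c[of 2, unfolded saddle_def cyl_def v3_nth] tendsto_cosh[OF h]] by simp_all
  then have "((\<lambda>t. cos (\<theta> t)) \<longlongrightarrow> cos (th k)) F" "((\<lambda>t. sin (\<theta> t)) \<longlongrightarrow> sin (th k)) F"
    by (simp_all add: C)
  then have "((\<lambda>t. cos (\<theta> t) * cos (th k) + sin (\<theta> t) * sin (th k)) \<longlongrightarrow>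
      cos (th k) * cos (th k) + sin (th k) * sin (th k)) F"
    by (intro tendsto_add tendsto_mult_right)
  then show "tends k \<theta> h F" unfolding tends_def using k h by (simp add: cos_diff)
next
  let ?h = "4 * real_of_int k + sg k * crit"
  assume t: "tends k \<theta> h F"
  then have h: "(h \<longlongrightarrow> ?h) F" and c: "((\<lambda>t. cos (\<theta> t - th k)) \<longlongrightarrow> 1) F"
    unfolding tends_def by blast+
  have "((\<lambda>t. 1 - (cos (\<theta> t - th k))\<^sup>2) \<longlongrightarrow> 1 - 1\<^sup>2) F" by (intro tendsto_intros c)
  then have "((\<lambda>t. (sin (\<theta> t - th k))\<^sup>2) \<longlongrightarrow> 0) F" by (simp add: sin_squared_eq)
  then have s: "((\<lambda>t. sin (\<theta> t - th k)) \<longlongrightarrow> 0) F" by (simp add: power_tendsto_0_iff)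
  have "((\<lambda>t. cos (\<theta> t - th k) * cos (th k) - sin (\<theta> t - th k) * sin (th k)) \<longlongrightarrow>
      1 * cos (th k) - 0 * sin (th k)) F"
    "((\<lambda>t. sin (\<theta> t - th k) * cos (th k) + cos (\<theta> t - th k) * sin (th k)) \<longlongrightarrow>
      0 * cos (th k) + 1 * sin (th k)) F"
    by (intro tendsto_intros c s)+
  then have cs: "((\<lambda>t. cos (\<theta> t)) \<longlongrightarrow> cos (th k)) F" "((\<lambda>t. sin (\<theta> t)) \<longlongrightarrow> sin (th k)) F"
    by (simp_all flip: cos_add sin_add)
  show "((\<lambda>t. cyl (\<theta> t) (h t)) \<longlongrightarrow> saddle k) F"
    unfolding saddle_def cyl_def using cosh_real_pos[of ?h]
    by (intro tendsto_v3 tendsto_divide tendsto_cosh tendsto_tanh cs h) auto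
qed

lemma saddle_inj:
  assumes "i \<in> K" "j \<in> K" "saddle i = saddle j"
  shows "i = j"
proof -
  have "4 * real_of_int i + sg i * crit = 4 * real_of_int j + sg j * crit"
    using assms(3) unfolding saddle_def cyl_eq_iff by blast
  then have "4 * (real_of_int i - real_of_int j) = sg j * crit - sg i * crit"
    by (simp add: algebra_simps)
  then have "\<bar>4 * (real_of_int i - real_of_int j)\<bar> < 2"
    using abs_triangle_ineq4[of "sg j * crit" "sg i * crit"] sg_crit[OF assms(1)] sg_crit[OF assms(2)] by simp
  then have "\<bar>real_of_int (i - j)\<bar> < 1" by simp
  then have "\<bar>i - j\<bar> < 1" by linarith
  then show ?thesis by simp
qed

text \<open>Excluding rest takes care of the clause that a separatrix does not start at its
  saddle.\<close>

lemma stable_separatrix_flow_iff: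
  assumes fl: "flow \<theta> h" and nr: "\<not> rest (\<theta> 0) (h 0)"
  shows "stable_separatrix vf p (\<lambda>t. cyl (\<theta> t) (h t)) \<longleftrightarrow> (\<exists>k. tends k \<theta> h at_top \<and> p = saddle k)"
    "unstable_separatrix vf p (\<lambda>t. cyl (\<theta> t) (h t)) \<longleftrightarrow> (\<exists>k. tends k \<theta> h at_bot \<and> p = saddle k)"
proof -
  have ne: "cyl (\<theta> 0) (h 0) \<noteq> saddle k" if "k \<in> K" for k
  proof
    assume "cyl (\<theta> 0) (h 0) = saddle k"
    then have "vf (cyl (\<theta> 0) (h 0)) = 0"
      using saddle_singular[OF that] unfolding singular_points_def by simp
    then show False using nr unfolding vf_cyl_eq_0 by blast
  qed
  have K: "tends k \<theta> h F \<Longrightarrow> k \<in> K" for k F unfolding tends_def by blast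
  have gen: "(\<exists>k\<in>K. p = saddle k) \<and> cyl (\<theta> 0) (h 0) \<noteq> p \<and> ((\<lambda>t. cyl (\<theta> t) (h t)) \<longlongrightarrow> p) F \<longleftrightarrow>
      (\<exists>k. tends k \<theta> h F \<and> p = saddle k)" for F
  proof
    assume "(\<exists>k\<in>K. p = saddle k) \<and> cyl (\<theta> 0) (h 0) \<noteq> p \<and> ((\<lambda>t. cyl (\<theta> t) (h t)) \<longlongrightarrow> p) F"
    then obtain k where k: "k \<in> K" "p = saddle k" "((\<lambda>t. cyl (\<theta> t) (h t)) \<longlongrightarrow> saddle k) F" by blast
    then show "\<exists>k. tends k \<theta> h F \<and> p = saddle k" using cyl_tendsto_saddle_iff[OF k(1)] by metis
  next
    assume "\<exists>k. tends k \<theta> h F \<and> p = saddle k"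
    then obtain k where k: "tends k \<theta> h F" "p = saddle k" by blast
    then show "(\<exists>k\<in>K. p = saddle k) \<and> cyl (\<theta> 0) (h 0) \<noteq> p \<and> ((\<lambda>t. cyl (\<theta> t) (h t)) \<longlongrightarrow> p) F"
      unfolding k(2) using K[OF k(1)] cyl_tendsto_saddle_iff[OF K[OF k(1)], of \<theta> h F] ne[OF K[OF k(1)]] k(1)
      by (intro conjI bexI[of _ k]) simp_all
  qed
  note tr = flow_trajectory[OF fl]
  show "stable_separatrix vf p (\<lambda>t. cyl (\<theta> t) (h t)) \<longleftrightarrow> (\<exists>k. tends k \<theta> h at_top \<and> p = saddle k)"
    unfolding stable_separatrix_def hyperbolic_saddle_iff gen[symmetric] by (simp only: tr simp_thms)
  show "unstable_separatrix vf p (\<lambda>t. cyl (\<theta> t) (h t)) \<longleftrightarrow> (\<exists>k. tends k \<theta> h at_bot \<and> p = saddle k)"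
    unfolding unstable_separatrix_def hyperbolic_saddle_iff gen[symmetric] by (simp only: tr simp_thms)
qed

lemma separatrix_not_rest:
  assumes "trajectory vf \<phi>" "\<phi> 0 \<noteq> p" "(\<phi> \<longlongrightarrow> p) F" "F \<noteq> bot"
  obtains \<theta> h where "flow \<theta> h" "\<phi> = (\<lambda>t. cyl (\<theta> t) (h t))" "\<not> rest (\<theta> 0) (h 0)"
proof -
  have nc: "\<not> (\<forall>t. \<phi> t = \<phi> 0)"
  proof
    assume "\<forall>t. \<phi> t = \<phi> 0"
    then have "\<phi> = (\<lambda>_. \<phi> 0)" by blast
    then have "((\<lambda>_. \<phi> 0) \<longlongrightarrow> p) F" using assms(3) by metis
    then show False using assms(2,4) by (simp add: tendsto_const_iff)
  qed
  from assms(1) show ?thesis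
  proof (cases rule: trajectory_cases)
    case rest
    then show ?thesis using nc by blast
  next
    case (flow \<theta> h)
    have "\<not> rest (\<theta> 0) (h 0)"
    proof
      assume "rest (\<theta> 0) (h 0)"
      then have "\<theta> t = \<theta> 0 \<and> h t = h 0" for t using flow_rest[OF flow(1)] by blast
      then have "\<phi> t = \<phi> 0" for t unfolding flow(2) by metis
      then show False using nc by blast
    qed
    then show ?thesis using that flow by blast
  qed
qed

text \<open>In negative time \<open>s / (1 - s * t)\<close> stays in the core and decays to 0, so an
  orbit met just above the equator comes from the equator.\<close>

lemma flow_from_core:
  assumes fl: "flow \<theta> h" "h 0 = s" "0 < s" "s \<le> 1"
  shows "(h \<longlongrightarrow> 0) at_bot" "\<not> rest (\<theta> 0) (h 0)"
proof -
  have eq: "h t = s / (1 - s * t)" if t: "t \<le> 0" for t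
  proof (rule flow_core(2)[OF fl(1,2), of t 0])
    show "\<bar>s\<bar> \<le> 1 - s * u \<and> 0 < 1 - s * u" if "u \<in> {t..0}" for u
    proof -
      have "s * u \<le> 0" using fl(3) that by (simp add: mult_nonneg_nonpos)
      then show ?thesis using fl(3,4) by auto
    qed
  qed (use t in auto)
  have "((\<lambda>t. h (- t)) \<longlongrightarrow> 0) at_top"
  proof (rule tendsto_at_top_eqI[of "\<lambda>t. s * inverse (1 + s * t)" _ 0])
    have "LIM t at_top. 1 + s * t :> at_top"
      by (intro filterlim_tendsto_add_at_top[OF tendsto_const] filterlim_tendsto_pos_mult_at_top[OF tendsto_const fl(3)] filterlim_ident)
    then have "((\<lambda>t. s * inverse (1 + s * t)) \<longlongrightarrow> s * 0) at_top"
      by (intro tendsto_intros tendsto_inverse_0_at_top)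
    then show "((\<lambda>t. s * inverse (1 + s * t)) \<longlongrightarrow> 0) at_top" by simp
    show "h (- t) = s * inverse (1 + s * t)" if "0 \<le> t" for t
      using eq[of "- t"] that by (simp add: divide_inverse)
  qed
  then show "(h \<longlongrightarrow> 0) at_bot" unfolding filterlim_at_bot_mirror .
  show "\<not> rest (\<theta> 0) (h 0)" using fl(2-4) by (simp add: field_core)
qed

lemma tends_not_core:
  assumes "tends k \<theta> h F" "(h \<longlongrightarrow> 0) F" "F \<noteq> bot"
  shows False
proof -
  have "(h \<longlongrightarrow> 4 * real_of_int k + sg k * crit) F" and k: "k \<in> K" using assms(1) unfolding tends_def by blast+
  then have "4 * real_of_int k + sg k * crit = 0" using tendsto_unique[OF assms(3) _ assms(2)] by blast
  moreover have "1 \<le> \<bar>real_of_int k\<bar>" using k K by (cases "k = 0") auto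
  ultimately show False using sg_crit[OF k] by linarith
qed

lemma winding_above:
  assumes sep: separated
  obtains c where "\<And>\<theta> h j. \<lbrakk>flow \<theta> h; \<theta> 0 = 0; 1 / 10 \<le> h 0; h 0 \<le> 1\<rbrakk> \<Longrightarrow>
    tends j \<theta> h at_top \<longleftrightarrow> 0 < j \<and> hits j (2 * pi * om * (c - 1 / h 0))"
proof -
  obtain c where c: "\<And>\<theta> h. \<lbrakk>flow \<theta> h; \<theta> 0 = 0; 1 / 10 \<le> h 0; h 0 \<le> 1\<rbrakk> \<Longrightarrow>
    \<exists>t\<ge>0. h t = 2 \<and> \<theta> t = 2 * pi * om * (c - 1 / h 0)"
    using ascend_angle by blast
  show ?thesis
  proof (rule that)
    fix \<theta> h j assume fl: "flow \<theta> h" and a: "\<theta> 0 = 0" "1 / 10 \<le> h 0" "h 0 \<le> 1"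
    obtain t where t: "0 \<le> t" "h t = 2" "\<theta> t = 2 * pi * om * (c - 1 / h 0)" using c[OF fl a] by blast
    \<comment> \<open>Height 2 is the bottom of window 1, at which the lowest possible plug
      begins.\<close>
    have lev: "h t = 4 * real_of_int 1 - 2" using t(2) by simp
    show "tends j \<theta> h at_top \<longleftrightarrow> 0 < j \<and> hits j (2 * pi * om * (c - 1 / h 0))"
    proof
      assume lim: "tends j \<theta> h at_top"
      have "0 < j" by (rule tends_pos[OF fl _ lim, of 0]) (use a in auto)
      then show "0 < j \<and> hits j (2 * pi * om * (c - 1 / h 0))"
        using tends_imp_hits_above[OF sep fl _ _ lev lim] t(3) by simp
    next
      assume "0 < j \<and> hits j (2 * pi * om * (c - 1 / h 0))"
      then show "tends j \<theta> h at_top"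
        using hits_imp_tends_above[OF sep fl _ _ lev, of j] t(3) by simp
    qed
  qed
qed

end

context plug_field_pair
begin

lemma PC_with_cycle_vf: "PC_with_cycle fw.vf equator"
  unfolding PC_with_cycle_def
proof (intro conjI ballI allI impI)
  show "\<not> (\<exists>\<phi>. saddle_connection fw.vf \<phi>)"
  proof
    assume "\<exists>\<phi>. saddle_connection fw.vf \<phi>"
    then obtain \<phi> p q where s: "unstable_separatrix fw.vf p \<phi>" "stable_separatrix fw.vf q \<phi>"
      unfolding saddle_connection_def by blast
    then obtain \<theta> h where fl: "fw.flow \<theta> h" "\<phi> = (\<lambda>t. cyl (\<theta> t) (h t))" "\<not> fw.rest (\<theta> 0) (h 0)"
      using fw.separatrix_not_rest[of \<phi> q at_top] unfolding stable_separatrix_def by auto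
    obtain i j where "fw.tends i \<theta> h at_bot" "fw.tends j \<theta> h at_top"
      using s fw.stable_separatrix_flow_iff[OF fl(1,3)] unfolding fl(2) by blast
    then show False using no_connection[OF fl(1)] fl(3) by blast
  qed
qed (auto simp: fw.sphere_vector_field_vf fw.parabolic_vf fw.limit_cycle_iff fw.hyperbolic_vf)

text \<open>An orbit through the section above the equator winds onto it in negative time anyway, so
  it is a winding separatrix exactly if its forward limit is a saddle. Below the equator the roles
  of the two time directions are exchanged.\<close>

lemma winding_at_section:
  assumes om: "om = 1"
  obtains c d where "\<And>s p. \<lbrakk>1 / 10 \<le> s; s \<le> 1\<rbrakk> \<Longrightarrow>
      (\<exists>\<phi>. winding_separatrix fw.vf equator p \<phi> \<and> \<phi> 0 = cyl 0 s) \<longleftrightarrow>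
      (\<exists>j>0. p = fw.saddle j \<and> fw.hits j (2 * pi * (c - 1 / s)))"
    and "\<And>s p. \<lbrakk>s \<le> - 1 / 10; - 1 \<le> s\<rbrakk> \<Longrightarrow>
      (\<exists>\<phi>. winding_separatrix fw.vf equator p \<phi> \<and> \<phi> 0 = cyl 0 s) \<longleftrightarrow>
      (\<exists>j>0. p = fw.saddle (- j) \<and> bw.hits j (2 * pi * (d - 1 / s)))"
proof -
  obtain c where c: "\<And>\<theta> h j. \<lbrakk>fw.flow \<theta> h; \<theta> 0 = 0; 1 / 10 \<le> h 0; h 0 \<le> 1\<rbrakk> \<Longrightarrow>
    fw.tends j \<theta> h at_top \<longleftrightarrow> 0 < j \<and> fw.hits j (2 * pi * om * (c - 1 / h 0))"
    using fw.winding_above[OF fw_separated] by blast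
  obtain d where d: "\<And>\<theta> h j. \<lbrakk>bw.flow \<theta> h; \<theta> 0 = 0; 1 / 10 \<le> h 0; h 0 \<le> 1\<rbrakk> \<Longrightarrow>
    bw.tends j \<theta> h at_top \<longleftrightarrow> 0 < j \<and> bw.hits j (2 * pi * - om * (d - 1 / h 0))"
    using bw.winding_above[OF bw_separated] by blast
  have traj: "\<phi> = (\<lambda>t. cyl (\<theta> t) (h t))"
    if "winding_separatrix fw.vf equator p \<phi>" "\<phi> 0 = cyl 0 s" "fw.flow \<theta> h" "\<theta> 0 = 0" "h 0 = s" for \<phi> p s \<theta> h
  proof (rule fw.trajectory_unique[OF _ fw.flow_trajectory[OF that(3)], of _ 0])
    show "trajectory fw.vf \<phi>"
      using that(1) unfolding winding_separatrix_def unstable_separatrix_def stable_separatrix_def by blast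
  qed (use that in auto)
  have red: "(\<exists>\<phi>. winding_separatrix fw.vf equator p \<phi> \<and> \<phi> 0 = cyl 0 s) \<longleftrightarrow>
      winding_separatrix fw.vf equator p (\<lambda>t. cyl (\<theta> t) (h t))"
    if fl: "fw.flow \<theta> h" "\<theta> 0 = 0" "h 0 = s" for p s \<theta> h
  proof
    assume "\<exists>\<phi>. winding_separatrix fw.vf equator p \<phi> \<and> \<phi> 0 = cyl 0 s"
    then obtain \<phi> where \<phi>: "winding_separatrix fw.vf equator p \<phi>" "\<phi> 0 = cyl 0 s" by blast
    show "winding_separatrix fw.vf equator p (\<lambda>t. cyl (\<theta> t) (h t))"
      using \<phi>(1) unfolding traj[OF \<phi> fl] .
  next
    assume "winding_separatrix fw.vf equator p (\<lambda>t. cyl (\<theta> t) (h t))"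
    then show "\<exists>\<phi>. winding_separatrix fw.vf equator p \<phi> \<and> \<phi> 0 = cyl 0 s"
      using fl by (intro exI[of _ "\<lambda>t. cyl (\<theta> t) (h t)"]) simp
  qed
  show ?thesis
  \<comment> \<open>The reversed orbit starts at height \<open>- s\<close> and turns the other way:
    \<open>2 * pi * (- 1) * (d - 1 / (- s)) = 2 * pi * (- d - 1 / s)\<close>.\<close>
  proof (rule that[of c "- d"])
    fix s :: real and p assume s: "1 / 10 \<le> s" "s \<le> 1"
    obtain \<theta> h where fl: "\<theta> 0 = 0" "h 0 = s" "fw.flow \<theta> h" using fw.flow_exists by metis
    have core: "(h \<longlongrightarrow> 0) at_bot" "\<not> fw.rest (\<theta> 0) (h 0)"
      using fw.flow_from_core[OF fl(3,2)] s by auto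
    have iff: "fw.tends j \<theta> h at_top \<longleftrightarrow> 0 < j \<and> fw.hits j (2 * pi * (c - 1 / s))" for j
      using c[OF fl(3,1)] s fl(2) om by simp
    note sep = fw.stable_separatrix_flow_iff[OF fl(3) core(2)]
    have "winding_separatrix fw.vf equator p (\<lambda>t. cyl (\<theta> t) (h t)) \<longleftrightarrow>
        (\<exists>j>0. p = fw.saddle j \<and> fw.hits j (2 * pi * (c - 1 / s)))"
      unfolding winding_separatrix_def sep
      using infdist_equator_tendsto[OF core(1), of \<theta>] fw.tends_not_core[OF _ core(1)] iff by auto
    then show "(\<exists>\<phi>. winding_separatrix fw.vf equator p \<phi> \<and> \<phi> 0 = cyl 0 s) \<longleftrightarrow>
      (\<exists>j>0. p = fw.saddle j \<and> fw.hits j (2 * pi * (c - 1 / s)))"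
      unfolding red[OF fl(3,1,2)] .
  next
    fix s :: real and p assume s: "s \<le> - 1 / 10" "- 1 \<le> s"
    obtain \<theta> h where fl: "\<theta> 0 = 0" "h 0 = s" "fw.flow \<theta> h" using fw.flow_exists by metis
    note rev = flow_reverse[OF fl(3)]
    have "((\<lambda>t. - h (- t)) \<longlongrightarrow> 0) at_bot" and nr': "\<not> bw.rest (\<theta> (- 0)) (- h (- 0))"
      using bw.flow_from_core[OF rev, of "- s"] s fl(2) by auto
    from tendsto_minus[OF this(1)] have core: "(h \<longlongrightarrow> 0) at_top"
      unfolding filterlim_at_bot_mirror by simp
    have nr: "\<not> fw.rest (\<theta> 0) (h 0)" using nr' by (simp add: field_reverse)
    have iff: "fw.tends j \<theta> h at_bot \<longleftrightarrow> 0 < - j \<and> bw.hits (- j) (2 * pi * (- d - 1 / s))" for j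
    proof -
      have "2 * pi * - om * (d - 1 / (- h (- 0))) = 2 * pi * (- d - 1 / s)"
        using om fl(2) by (simp add: algebra_simps)
      note eq = this
      have prem: "\<theta> (- 0) = 0" "1 / 10 \<le> - h (- 0)" "- h (- 0) \<le> 1" using s fl(1,2) by simp_all
      show ?thesis using d[OF rev prem, of "- j"] tends_reverse(1)[of j \<theta> h] unfolding eq by (simp only:)
    qed
    note sep = fw.stable_separatrix_flow_iff[OF fl(3) nr]
    have "(\<exists>k. fw.tends k \<theta> h at_bot \<and> p = fw.saddle k) \<longleftrightarrow>
        (\<exists>j>0. p = fw.saddle (- j) \<and> bw.hits j (2 * pi * (- d - 1 / s)))"
    proof
      assume "\<exists>k. fw.tends k \<theta> h at_bot \<and> p = fw.saddle k"
      then obtain k where "fw.tends k \<theta> h at_bot" "p = fw.saddle k" by blast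
      then show "\<exists>j>0. p = fw.saddle (- j) \<and> bw.hits j (2 * pi * (- d - 1 / s))"
        using iff[of k] by (intro exI[of _ "- k"]) simp
    next
      assume "\<exists>j>0. p = fw.saddle (- j) \<and> bw.hits j (2 * pi * (- d - 1 / s))"
      then obtain j where "0 < j" "p = fw.saddle (- j)" "bw.hits j (2 * pi * (- d - 1 / s))" by blast
      then show "\<exists>k. fw.tends k \<theta> h at_bot \<and> p = fw.saddle k"
        using iff[of "- j"] by (intro exI[of _ "- j"]) simp
    qed
    then have "winding_separatrix fw.vf equator p (\<lambda>t. cyl (\<theta> t) (h t)) \<longleftrightarrow>
        (\<exists>j>0. p = fw.saddle (- j) \<and> bw.hits j (2 * pi * (- d - 1 / s)))"
      unfolding winding_separatrix_def sep
      using infdist_equator_tendsto[OF core, of \<theta>] fw.tends_not_core[OF _ core] by auto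
    then show "(\<exists>\<phi>. winding_separatrix fw.vf equator p \<phi> \<and> \<phi> 0 = cyl 0 s) \<longleftrightarrow>
      (\<exists>j>0. p = fw.saddle (- j) \<and> bw.hits j (2 * pi * (- d - 1 / s)))"
      unfolding red[OF fl(3,1,2)] .
  qed
qed

end

section \<open>Characteristic sets\<close>

lemma frac_diff_of_int: "frac (x - of_int n) = frac x"
  by (simp add: frac_def)

text \<open>Along \<open>x' = x\<^sup>2\<close> the quantity \<open>1 / b - 1 / s\<close> is the
  time from \<open>b\<close> to \<open>s\<close>, and \<open>b / (1 - b)\<close> is the position at
  time 1. The formula is the same on both sides of the equator.\<close>

lemma section_segment:
  fixes b :: real
  assumes b: "b \<noteq> 0" "b < 1"
  shows "s \<in> {b..<b / (1 - b)} \<Longrightarrow> 0 < b * s \<and> 1 / b - 1 / s \<in> {0..<1}"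
    and "\<tau> \<in> {0..<1} \<Longrightarrow> \<exists>s\<in>{b..<b / (1 - b)}. 1 / b - 1 / s = \<tau>"
proof -
  have e: "1 / b - 1 / (b / (1 - b)) = 1" using b by (simp add: field_simps)
  have pos: "0 < 1 - b" using b by simp
  show "0 < b * s \<and> 1 / b - 1 / s \<in> {0..<1}" if s: "s \<in> {b..<b / (1 - b)}"
  proof (cases "0 < b")
    case True
    have "s * (1 - b) < b" using s pos by (simp add: pos_less_divide_eq)
    then show ?thesis using s True by (simp add: field_simps)
  next
    case False
    then have bn: "b < 0" using b by simp
    then have "b / (1 - b) < 0" using pos by (simp add: divide_neg_pos)
    then have sn: "s < 0" using s by auto
    have "s * (1 - b) < b" using s pos by (simp add: pos_less_divide_eq)
    then show ?thesis using s bn sn by (simp add: field_simps mult_neg_neg)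
  qed
  show "\<exists>s\<in>{b..<b / (1 - b)}. 1 / b - 1 / s = \<tau>" if \<tau>: "\<tau> \<in> {0..<1}"
  \<comment> \<open>The point reached from \<open>b\<close> after time
    \<open>\<tau>\<close>.\<close>
  proof (intro bexI[of _ "b / (1 - b * \<tau>)"])
    have "b * \<tau> < 1"
    proof (cases "0 < b")
      case True
      then have "b * \<tau> \<le> b * 1" using \<tau> by (intro mult_left_mono) auto
      then show ?thesis using b by simp
    next
      case False
      then have "b * \<tau> \<le> 0" using \<tau> by (simp add: mult_nonpos_nonneg)
      then show ?thesis by simp
    qed
    then have q: "0 < 1 - b * \<tau>" by simp
    show "1 / b - 1 / (b / (1 - b * \<tau>)) = \<tau>" using b q by (simp add: field_simps)
    have "b * (1 - b * \<tau>) \<le> b"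
      using b \<tau> by (simp add: algebra_simps)
    moreover have "b * (1 - b) < b * (1 - b * \<tau>)"
    proof -
      have "b * b * \<tau> < b * b * 1" using b \<tau> by (intro mult_strict_left_mono) (auto simp: zero_less_mult_iff)
      then show ?thesis by (simp add: algebra_simps)
    qed
    ultimately show "b / (1 - b * \<tau>) \<in> {b..<b / (1 - b)}"
      using q pos by (simp add: pos_le_divide_eq pos_divide_less_eq pos_less_divide_eq mult.commute divide_less_eq less_divide_eq)
  qed
qed

text \<open>\<open>0 < b * s\<close> keeps the interval of integration on one side of the zero of
  the field.\<close>

lemma takens_time_square:
  assumes "b \<le> s" "0 < b * s"
  shows "takens_time (\<lambda>x. x\<^sup>2) b s = 1 / b - 1 / s"
proof -
  have nz: "x \<noteq> 0" if "min b s \<le> x" "x \<le> max b s" for x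
    using assms that by (auto simp: zero_less_mult_iff min_def max_def)
  have "(LBINT x=ereal b..ereal s. 1 / x\<^sup>2) = - (1 / s) - - (1 / b)"
  proof (rule interval_integral_FTC_finite)
    show "continuous_on {min b s..max b s} (\<lambda>x. 1 / x\<^sup>2)"
      using nz by (intro continuous_intros) auto
    fix x assume x: "min b s \<le> x" "x \<le> max b s"
    have "((\<lambda>x. - (1 / x)) has_real_derivative 1 / x\<^sup>2) (at x within {min b s..max b s})"
      using nz[OF x] by (auto intro!: derivative_eq_intros simp: power2_eq_square)
    then show "((\<lambda>x. - (1 / x)) has_vector_derivative 1 / x\<^sup>2) (at x within {min b s..max b s})"
      by (simp add: has_real_derivative_iff_has_vector_derivative)
  qed
  then show ?thesis by (simp add: takens_time_def)
qed

text \<open>\<open>H j x\<close> is meant as: some winding separatrix of the saddle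
  \<open>pt j\<close> has arrival phase \<open>x\<close>. Phase and time coordinate differ by the
  constant \<open>d\<close>, and this is the rotation. By injectivity of \<open>pt\<close>, coming
  from the same saddle means having the same index.\<close>

lemma equal_mod_rotation_charset:
  fixes H :: "'i \<Rightarrow> real \<Rightarrow> bool" and pt :: "'i \<Rightarrow> real^3"
  assumes b: "b \<noteq> 0" "b < 1"
    and wind: "\<And>s p. s \<in> {b..<b / (1 - b)} \<Longrightarrow>
      (\<exists>\<phi>. winding_separatrix v \<gamma> p \<phi> \<and> \<phi> 0 = \<sigma> s) \<longleftrightarrow> (\<exists>j. p = pt j \<and> H j (1 / b - 1 / s + d))"
    and per: "\<And>j x. H j (frac x) \<longleftrightarrow> H j x"
    and inj: "\<And>i j x y. H i x \<Longrightarrow> H j y \<Longrightarrow> pt i = pt j \<Longrightarrow> i = j"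
  shows "equal_mod_rotation (charset v \<gamma> \<sigma> return_map (\<lambda>x. x\<^sup>2) b) (charset_rel v \<gamma> \<sigma> return_map (\<lambda>x. x\<^sup>2) b)
    {a \<in> {0..<1}. \<exists>j. H j a} {(a, a'). a \<in> {0..<1} \<and> a' \<in> {0..<1} \<and> (\<exists>j. H j a \<and> H j a')}"
proof -
  let ?e = "b / (1 - b)" and ?T = "\<lambda>s. 1 / b - 1 / s"
  let ?u = "\<lambda>x::real. x\<^sup>2"
  have time: "frac (takens_time ?u b s) = ?T s" if "s \<in> {b..<?e}" for s
    using takens_time_square[of b s] section_segment(1)[OF b that] that by (simp add: frac_eq)
  have pts: "separatrix_points v \<gamma> \<sigma> b (return_map b) p = {s \<in> {b..<?e}. \<exists>j. p = pt j \<and> H j (?T s + d)}" for p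
    unfolding separatrix_points_def return_map_def using wind by blast
  have set: "charset v \<gamma> \<sigma> return_map ?u b = {\<tau> \<in> {0..<1}. \<exists>j. H j (\<tau> + d)}"
  proof (intro equalityI subsetI)
    fix \<tau> assume "\<tau> \<in> charset v \<gamma> \<sigma> return_map ?u b"
    then obtain s j where "s \<in> {b..<?e}" "H j (?T s + d)" "\<tau> = ?T s"
      unfolding charset_def pts using time by auto
    then show "\<tau> \<in> {\<tau> \<in> {0..<1}. \<exists>j. H j (\<tau> + d)}" using section_segment(1)[OF b] by blast
  next
    fix \<tau> assume "\<tau> \<in> {\<tau> \<in> {0..<1}. \<exists>j. H j (\<tau> + d)}"
    then obtain j where \<tau>: "\<tau> \<in> {0..<1}" "H j (\<tau> + d)" by blast
    obtain s where s: "s \<in> {b..<?e}" "?T s = \<tau>" using section_segment(2)[OF b \<tau>(1)] by blast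
    then have "s \<in> (\<Union>p. separatrix_points v \<gamma> \<sigma> b (return_map b) p)" unfolding pts using \<tau>(2) by blast
    then show "\<tau> \<in> charset v \<gamma> \<sigma> return_map ?u b"
      unfolding charset_def using time[OF s(1)] s(2) by (intro image_eqI[of _ _ s]) simp_all
  qed
  have rel: "charset_rel v \<gamma> \<sigma> return_map ?u b =
      {(\<tau>, \<tau>'). \<tau> \<in> {0..<1} \<and> \<tau>' \<in> {0..<1} \<and> (\<exists>j. H j (\<tau> + d) \<and> H j (\<tau>' + d))}"
  proof (intro equalityI subsetI)
    fix q assume "q \<in> charset_rel v \<gamma> \<sigma> return_map ?u b"
    then obtain s s' p where q: "q = (frac (takens_time ?u b s), frac (takens_time ?u b s'))"
      "s \<in> separatrix_points v \<gamma> \<sigma> b (return_map b) p" "s' \<in> separatrix_points v \<gamma> \<sigma> b (return_map b) p"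
      unfolding charset_rel_def by blast
    then obtain i j where "s \<in> {b..<?e}" "s' \<in> {b..<?e}" "p = pt i" "H i (?T s + d)" "p = pt j" "H j (?T s' + d)"
      unfolding pts by blast
    moreover from this have "i = j" using inj by metis
    ultimately show "q \<in> {(\<tau>, \<tau>'). \<tau> \<in> {0..<1} \<and> \<tau>' \<in> {0..<1} \<and> (\<exists>j. H j (\<tau> + d) \<and> H j (\<tau>' + d))}"
      using q(1) time section_segment(1)[OF b] by auto
  next
    fix q assume "q \<in> {(\<tau>, \<tau>'). \<tau> \<in> {0..<1} \<and> \<tau>' \<in> {0..<1} \<and> (\<exists>j. H j (\<tau> + d) \<and> H j (\<tau>' + d))}"
    then obtain \<tau> \<tau>' j where q: "q = (\<tau>, \<tau>')" "\<tau> \<in> {0..<1}" "\<tau>' \<in> {0..<1}" "H j (\<tau> + d)" "H j (\<tau>' + d)"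
      by blast
    obtain s where s: "s \<in> {b..<?e}" "?T s = \<tau>" using section_segment(2)[OF b q(2)] by blast
    obtain s' where s': "s' \<in> {b..<?e}" "?T s' = \<tau>'" using section_segment(2)[OF b q(3)] by blast
    have "s \<in> separatrix_points v \<gamma> \<sigma> b (return_map b) (pt j)" "s' \<in> separatrix_points v \<gamma> \<sigma> b (return_map b) (pt j)"
      unfolding pts using s s' q(4,5) by blast+
    then show "q \<in> charset_rel v \<gamma> \<sigma> return_map ?u b"
      unfolding charset_rel_def q(1) using time[OF s(1)] time[OF s'(1)] s(2) s'(2) by force
  qed
  have rot: "frac (frac (a - d) + d) = a" "H j (frac (a - d) + d) \<longleftrightarrow> H j a" "frac (a - d) \<in> {0..<1}"
    if "a \<in> {0..<1}" for a j
  proof -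
    have "frac (a - d) + d = a - of_int \<lfloor>a - d\<rfloor>" by (simp add: frac_def)
    then have "frac (frac (a - d) + d) = frac a" by (simp only: frac_diff_of_int)
    then show "frac (frac (a - d) + d) = a" using that by (simp add: frac_eq)
    then show "H j (frac (a - d) + d) \<longleftrightarrow> H j a" using per[of j "frac (a - d) + d"] by simp
    show "frac (a - d) \<in> {0..<1}" by (simp add: frac_lt_1)
  qed
  show ?thesis
    unfolding equal_mod_rotation_def
  proof (intro exI[of _ d] conjI equalityI subsetI)
    fix a assume "a \<in> {a \<in> {0..<1}. \<exists>j. H j a}"
    then obtain j where a: "a \<in> {0..<1}" "H j a" by blast
    then have "frac (a - d) \<in> charset v \<gamma> \<sigma> return_map ?u b" unfolding set using rot by blast
    then show "a \<in> rotate_circle d ` charset v \<gamma> \<sigma> return_map ?u b"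
      using rot(1)[OF a(1)] by (intro image_eqI[of _ _ "frac (a - d)"]) (simp_all add: rotate_circle_def)
  next
    fix a assume "a \<in> rotate_circle d ` charset v \<gamma> \<sigma> return_map ?u b"
    then obtain \<tau> j where "a = frac (\<tau> + d)" "H j (\<tau> + d)" unfolding set rotate_circle_def by blast
    then show "a \<in> {a \<in> {0..<1}. \<exists>j. H j a}" using per by (auto simp: frac_lt_1)
  next
    fix q assume "q \<in> {(a, a'). a \<in> {0..<1} \<and> a' \<in> {0..<1} \<and> (\<exists>j. H j a \<and> H j a')}"
    then obtain a a' j where q: "q = (a, a')" "a \<in> {0..<1}" "a' \<in> {0..<1}" "H j a" "H j a'" by blast
    then have "(frac (a - d), frac (a' - d)) \<in> charset_rel v \<gamma> \<sigma> return_map ?u b"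
      unfolding rel using rot by blast
    then show "q \<in> map_prod (rotate_circle d) (rotate_circle d) ` charset_rel v \<gamma> \<sigma> return_map ?u b"
      using rot(1)[OF q(2)] rot(1)[OF q(3)] q(1)
      by (intro image_eqI[of _ _ "(frac (a - d), frac (a' - d))"]) (simp_all add: rotate_circle_def)
  next
    fix q assume "q \<in> map_prod (rotate_circle d) (rotate_circle d) ` charset_rel v \<gamma> \<sigma> return_map ?u b"
    then obtain \<tau> \<tau>' j where "q = (frac (\<tau> + d), frac (\<tau>' + d))" "H j (\<tau> + d)" "H j (\<tau>' + d)"
      unfolding rel rotate_circle_def by force
    then show "q \<in> {(a, a'). a \<in> {0..<1} \<and> a' \<in> {0..<1} \<and> (\<exists>j. H j a \<and> H j a')}"
      using per by (auto simp: frac_lt_1)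
  qed
qed

lemma (in plug_field) hits_frac: "hits j (2 * pi * frac x) \<longleftrightarrow> hits j (2 * pi * x)"
proof -
  have e: "2 * pi * frac x = 2 * pi * x - 2 * pi * of_int \<lfloor>x\<rfloor>" by (simp add: frac_def algebra_simps)
  have "cos (2 * pi * frac x) = cos (2 * pi * x)" "sin (2 * pi * frac x) = sin (2 * pi * x)"
    unfolding e cos_diff sin_diff by simp_all
  note cong = arc_chart_cong(1,3)[OF this]
  show ?thesis unfolding hits_def cong ..
qed

lemma (in plug_field_pair) characteristic_sets_vf:
  assumes om: "om = 1"
  shows "class_PC fw.vf \<and> characteristic_sets fw.vf
    {a \<in> {0..<1}. \<exists>j>0. fw.hits j (2 * pi * a)}
    {(a, a'). a \<in> {0..<1} \<and> a' \<in> {0..<1} \<and> (\<exists>j>0. fw.hits j (2 * pi * a) \<and> fw.hits j (2 * pi * a'))}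
    {a \<in> {0..<1}. \<exists>j>0. bw.hits j (2 * pi * a)}
    {(a, a'). a \<in> {0..<1} \<and> a' \<in> {0..<1} \<and> (\<exists>j>0. bw.hits j (2 * pi * a) \<and> bw.hits j (2 * pi * a'))}"
proof -
  obtain c d where c: "\<And>s p. \<lbrakk>1 / 10 \<le> s; s \<le> 1\<rbrakk> \<Longrightarrow>
      (\<exists>\<phi>. winding_separatrix fw.vf equator p \<phi> \<and> \<phi> 0 = cyl 0 s) \<longleftrightarrow>
      (\<exists>j>0. p = fw.saddle j \<and> fw.hits j (2 * pi * (c - 1 / s)))"
    and d: "\<And>s p. \<lbrakk>s \<le> - 1 / 10; - 1 \<le> s\<rbrakk> \<Longrightarrow>
      (\<exists>\<phi>. winding_separatrix fw.vf equator p \<phi> \<and> \<phi> 0 = cyl 0 s) \<longleftrightarrow>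
      (\<exists>j>0. p = fw.saddle (- j) \<and> bw.hits j (2 * pi * (d - 1 / s)))"
    using winding_at_section[OF om] by blast
  have up: "equal_mod_rotation (charset fw.vf equator (cyl 0) return_map (\<lambda>x. x\<^sup>2) (1 / 8))
      (charset_rel fw.vf equator (cyl 0) return_map (\<lambda>x. x\<^sup>2) (1 / 8))
      {a \<in> {0..<1}. \<exists>j. 0 < j \<and> fw.hits j (2 * pi * a)}
      {(a, a'). a \<in> {0..<1} \<and> a' \<in> {0..<1} \<and> (\<exists>j. (0 < j \<and> fw.hits j (2 * pi * a)) \<and> 0 < j \<and> fw.hits j (2 * pi * a'))}"
  \<comment> \<open>Here \<open>1 / b = 8\<close>, so \<open>d = c - 8\<close> makes the phase
    \<open>c - 1 / s\<close>. The segment \<open>[1 / 8, 1 / 7)\<close> lies within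
    \<open>1 / 10 \<le> s \<le> 1\<close>.\<close>
  proof (rule equal_mod_rotation_charset[where pt = fw.saddle and d = "c - 8"])
    show "(\<exists>\<phi>. winding_separatrix fw.vf equator p \<phi> \<and> \<phi> 0 = cyl 0 s) \<longleftrightarrow>
      (\<exists>j. p = fw.saddle j \<and> 0 < j \<and> fw.hits j (2 * pi * (1 / (1 / 8) - 1 / s + (c - 8))))"
      if "s \<in> {1 / 8..<1 / 8 / (1 - 1 / 8)}" for s p
      using c[of s p] that by (auto simp: algebra_simps)
    show "i = j" if "0 < i \<and> fw.hits i (2 * pi * x)" "0 < j \<and> fw.hits j (2 * pi * y)" "fw.saddle i = fw.saddle j" for i j x y
      using fw.saddle_inj[of i j] that unfolding fw.hits_def by blast
  qed (auto simp: fw.hits_frac)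
  have down: "equal_mod_rotation (charset fw.vf equator (cyl 0) return_map (\<lambda>x. x\<^sup>2) (- 1 / 8))
      (charset_rel fw.vf equator (cyl 0) return_map (\<lambda>x. x\<^sup>2) (- 1 / 8))
      {a \<in> {0..<1}. \<exists>j. 0 < j \<and> bw.hits j (2 * pi * a)}
      {(a, a'). a \<in> {0..<1} \<and> a' \<in> {0..<1} \<and> (\<exists>j. (0 < j \<and> bw.hits j (2 * pi * a)) \<and> 0 < j \<and> bw.hits j (2 * pi * a'))}"
  \<comment> \<open>Here \<open>1 / b = - 8\<close>, and the segment is
    \<open>[- 1 / 8, - 1 / 9)\<close>, still at distance more than \<open>1 / 10\<close> from
    0.\<close>
  proof (rule equal_mod_rotation_charset[where pt = "\<lambda>j. fw.saddle (- j)" and d = "d + 8"])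
    show "(\<exists>\<phi>. winding_separatrix fw.vf equator p \<phi> \<and> \<phi> 0 = cyl 0 s) \<longleftrightarrow>
      (\<exists>j. p = fw.saddle (- j) \<and> 0 < j \<and> bw.hits j (2 * pi * (1 / (- 1 / 8) - 1 / s + (d + 8))))"
      if "s \<in> {- 1 / 8..<- 1 / 8 / (1 - (- 1 / 8))}" for s p
      using d[of s p] that by (auto simp: algebra_simps)
    show "i = j" if "0 < i \<and> bw.hits i (2 * pi * x)" "0 < j \<and> bw.hits j (2 * pi * y)" "fw.saddle (- i) = fw.saddle (- j)" for i j x y
      using fw.saddle_inj[of "- i" "- j"] that unfolding bw.hits_def by force
  qed (auto simp: bw.hits_frac)
  have "characteristic_sets fw.vf
    {a \<in> {0..<1}. \<exists>j>0. fw.hits j (2 * pi * a)}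
    {(a, a'). a \<in> {0..<1} \<and> a' \<in> {0..<1} \<and> (\<exists>j>0. fw.hits j (2 * pi * a) \<and> fw.hits j (2 * pi * a'))}
    {a \<in> {0..<1}. \<exists>j>0. bw.hits j (2 * pi * a)}
    {(a, a'). a \<in> {0..<1} \<and> a' \<in> {0..<1} \<and> (\<exists>j>0. bw.hits j (2 * pi * a) \<and> bw.hits j (2 * pi * a'))}"
    unfolding characteristic_sets_def
  proof (rule exI[of _ equator], rule exI[of _ "cyl 0"], rule exI[of _ "- 1 / 2"], rule exI[of _ "1 / 2"],
      rule exI[of _ "{- 1 / 4<..<1 / 4}"], rule exI[of _ return_map], rule exI[of _ UNIV],
      rule exI[of _ "\<lambda>x. x\<^sup>2"], rule exI[of _ "- 1 / 8"], rule exI[of _ "1 / 8"], intro conjI)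
    show "PC_with_cycle fw.vf equator" by (rule PC_with_cycle_vf)
    show "poincare_map fw.vf equator (cyl 0) (- 1 / 2) (1 / 2) {- 1 / 4<..<1 / 4} return_map"
      by (rule fw.poincare_map_vf)
    show "(\<lambda>x. return_map x - (x + x\<^sup>2)) \<in> O[at 0](\<lambda>x. x ^ 3)" by (rule return_map_expansion)
    show "takens_generator {- 1 / 4<..<1 / 4} return_map UNIV (\<lambda>x. x\<^sup>2)" by (rule fw.takens_vf)
    show "{- 1 / 8..1 / 8 :: real} \<subseteq> {- 1 / 4<..<1 / 4}" by auto
  qed (use up down in \<open>simp_all add: conj_ac\<close>)
  then show ?thesis using PC_with_cycle_vf unfolding class_PC_def by blast
qed

text \<open>Among the non-intermingled classes of a marked set, cut open at \<open>0\<close>, shorter ones are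
  enumerated first; then a class never has a point between the two points of an earlier one.\<close>

lemma marked_set_enumeration:
  assumes "marked_set A E"
  obtains n :: nat and lo hi :: "nat \<Rightarrow> real" where
    "\<And>i. i \<in> {1..n} \<Longrightarrow> 0 \<le> lo i \<and> lo i \<le> hi i \<and> hi i < 1"
    "\<And>i j x. \<lbrakk>1 \<le> i; i < j; j \<le> n; x \<in> {lo j, hi j}\<rbrakk> \<Longrightarrow> x < lo i \<or> hi i < x"
    "A = (\<Union>i\<in>{1..n}. {lo i, hi i})" "E = (\<Union>i\<in>{1..n}. {lo i, hi i} \<times> {lo i, hi i})"
proof -
  have fin: "finite A" and sub: "A \<subseteq> {0..<1}" and eqv: "equiv A E"
    and card: "\<And>C. C \<in> A // E \<Longrightarrow> card C = 1 \<or> card C = 2"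
    and proper: "\<And>a b c d. \<lbrakk>a \<noteq> b; c \<noteq> d; {a, b} \<in> A // E; {c, d} \<in> A // E\<rbrakk> \<Longrightarrow>
        c \<in> oriented_arc a b \<longleftrightarrow> d \<in> oriented_arc a b"
    using assms unfolding marked_set_def proper_equiv_def by blast+
  have E_sub: "E \<subseteq> A \<times> A" using eqv by (rule equiv_type)
  have finQ: "finite (A // E)" using fin E_sub by (rule finite_quotient)
  have pair: "C = {Min C, Max C} \<and> Min C \<le> Max C \<and> 0 \<le> Min C \<and> Max C < 1" if C: "C \<in> A // E" for C
  proof -
    have "C \<subseteq> A" using C eqv by (metis Union_quotient Union_upper)
    then have C01: "C \<subseteq> {0..<1}" using sub by blast
    have "finite C" using card[OF C] card.infinite by fastforce
    moreover have "C \<noteq> {}" using card[OF C] by auto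
    ultimately have m: "Min C \<in> C" "Max C \<in> C" "Min C \<le> Max C" by simp_all
    have "C = {Min C, Max C}"
    proof (cases "card C = 1")
      case True
      then obtain x where "C = {x}" by (rule card_1_singletonE)
      then show ?thesis by simp
    next
      case False
      then obtain x y where "C = {x, y}" "x \<noteq> y" using card[OF C] card_2_iff by metis
      then show ?thesis by (auto simp: min_def max_def)
    qed
    then show ?thesis using m C01 by auto
  qed
  define len where "len C = Max C - Min C" for C :: "real set"
  obtain xs0 where xs0: "set xs0 = A // E" "distinct xs0" using finite_distinct_list[OF finQ] by blast
  define xs where "xs = sort_key len xs0"
  have xs: "set xs = A // E" "distinct xs" "sorted (map len xs)" using xs0 by (simp_all add: xs_def)
  define n where "n = length xs"
  define cl where "cl i = xs ! (i - 1)" for i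
  have clQ: "cl i \<in> A // E" if "i \<in> {1..n}" for i
  proof -
    have "i - 1 < length xs" using that by (auto simp: n_def)
    from nth_mem[OF this] show ?thesis unfolding cl_def xs(1) .
  qed
  have Q_cl: "A // E = cl ` {1..n}"
  proof (intro equalityI subsetI)
    fix C assume "C \<in> A // E"
    then have "C \<in> set xs" using xs(1) by simp
    then obtain k where "k < n" "C = xs ! k" unfolding n_def by (metis in_set_conv_nth)
    then have "Suc k \<in> {1..n}" "C = cl (Suc k)" by (simp_all add: cl_def)
    then show "C \<in> cl ` {1..n}" by blast
  qed (use clQ in blast)
  have cl_eq: "cl i = {Min (cl i), Max (cl i)}" if "i \<in> {1..n}" for i using pair[OF clQ[OF that]] by blast
  show ?thesis
  proof (rule that[of n "\<lambda>i. Min (cl i)" "\<lambda>i. Max (cl i)"])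
    show "0 \<le> Min (cl i) \<and> Min (cl i) \<le> Max (cl i) \<and> Max (cl i) < 1" if "i \<in> {1..n}" for i
      using pair[OF clQ[OF that]] by blast
    show "A = (\<Union>i\<in>{1..n}. {Min (cl i), Max (cl i)})"
    proof -
      have "A = \<Union> (A // E)" using Union_quotient[OF eqv] by simp
      also have "\<dots> = (\<Union>i\<in>{1..n}. {Min (cl i), Max (cl i)})" unfolding Q_cl using cl_eq by auto
      finally show ?thesis .
    qed
    show "E = (\<Union>i\<in>{1..n}. {Min (cl i), Max (cl i)} \<times> {Min (cl i), Max (cl i)})"
    proof -
      have "E = (\<Union>C\<in>A // E. C \<times> C)"
      proof (intro equalityI subrelI)
        fix x y assume xy: "(x, y) \<in> E"
        then have "E `` {x} \<in> A // E" "x \<in> E `` {x}" "y \<in> E `` {x}"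
          using E_sub equiv_class_self[OF eqv] by (auto intro: quotientI)
        then show "(x, y) \<in> (\<Union>C\<in>A // E. C \<times> C)" by blast
      next
        fix x y assume "(x, y) \<in> (\<Union>C\<in>A // E. C \<times> C)"
        then show "(x, y) \<in> E" using in_quotient_imp_in_rel[OF eqv] by auto
      qed
      then show ?thesis unfolding Q_cl using cl_eq by auto
    qed
    fix i j :: nat and x assume ij: "1 \<le> i" "i < j" "j \<le> n" and x: "x \<in> {Min (cl j), Max (cl j)}"
    have i: "i \<in> {1..n}" and j: "j \<in> {1..n}" using ij by auto
    have ne: "cl i \<noteq> cl j"
      using xs(2) ij nth_eq_iff_index_eq[of xs "i - 1" "j - 1"] by (auto simp: cl_def n_def)
    then have disj: "cl i \<inter> cl j = {}" using quotient_disj[OF eqv clQ[OF i] clQ[OF j]] by blast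
    have le: "len (cl i) \<le> len (cl j)"
      using sorted_nth_mono[OF xs(3), of "i - 1" "j - 1"] ij by (simp add: cl_def n_def)
    define a b c d where "a = Min (cl i)" and "b = Max (cl i)" and "c = Min (cl j)" and "d = Max (cl j)"
    have ci: "cl i = {a, b}" and cj: "cl j = {c, d}" using cl_eq i j by (simp_all add: a_def b_def c_def d_def)
    have ab: "0 \<le> a" "a \<le> b" "b < 1" and cd: "0 \<le> c" "c \<le> d" "d < 1"
      using pair[OF clQ[OF i]] pair[OF clQ[OF j]] by (auto simp: a_def b_def c_def d_def)
    have le': "b - a \<le> d - c" using le by (simp add: len_def a_def b_def c_def d_def)
    have dj: "a \<noteq> c" "a \<noteq> d" "b \<noteq> c" "b \<noteq> d" using disj unfolding ci cj by auto
    \<comment> \<open>As \<open>a \<le> b\<close> within \<open>[0, 1)\<close>, the arc from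
      \<open>a\<close> to \<open>b\<close> does not pass the cut at 0 and is an interval.\<close>
    have arc: "z \<in> oriented_arc a b \<longleftrightarrow> a \<le> z \<and> z \<le> b" if "z \<in> {0..<1}" for z
    proof (cases "a \<le> z")
      case True
      then show ?thesis using that ab by (simp add: oriented_arc_def frac_eq)
    next
      case False
      have "frac (z - a) = frac (z - a + 1)" by (simp add: frac_1_eq)
      also have "\<dots> = z - a + 1" using False that ab by (simp add: frac_eq)
      finally show ?thesis using False that ab by (simp add: oriented_arc_def frac_eq)
    qed
    have "\<not> (a \<le> x \<and> x \<le> b)"
    proof
      assume ax: "a \<le> x \<and> x \<le> b"
      have xcd: "x = c \<or> x = d" using x by (simp add: c_def d_def)
      then have "a < b" using ax dj by auto
      then have "c < d" using le' by simp
      have "{a, b} \<in> A // E" "{c, d} \<in> A // E" using clQ[OF i] clQ[OF j] ci cj by simp_all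
      note proper[OF _ _ this]
      then have "c \<in> oriented_arc a b \<longleftrightarrow> d \<in> oriented_arc a b"
        using \<open>a < b\<close> \<open>c < d\<close> by simp
      moreover have "c \<in> {0..<1}" "d \<in> {0..<1}" using cd by auto
      ultimately have "a \<le> c \<and> c \<le> b \<longleftrightarrow> a \<le> d \<and> d \<le> b" using arc by blast
      \<comment> \<open>Properness puts both points of class \<open>j\<close> between
        \<open>a\<close> and \<open>b\<close>; as the classes are disjoint, class \<open>j\<close>
        would be strictly shorter than class \<open>i\<close>, against the sorting.\<close>
      then have "a \<le> c \<and> d \<le> b" using ax xcd by blast
      then show False using le' dj by linarith
    qed
    then show "x < Min (cl i) \<or> Max (cl i) < x" by (auto simp: a_def b_def)
  qed
qed

section \<open>Arcs around the classes of a marked set\<close>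

lemma cos_class_iff:
  assumes "0 \<le> lo" "lo \<le> hi" "hi < 1" "x \<in> {0..<1}"
  shows "cos (2 * pi * x - pi * (lo + hi)) = cos (pi * (hi - lo)) \<longleftrightarrow> x = lo \<or> x = hi"
proof
  assume "cos (2 * pi * x - pi * (lo + hi)) = cos (pi * (hi - lo))"
  then obtain n where n: "n \<in> \<int>" and
    "2 * pi * x - pi * (lo + hi) = pi * (hi - lo) + 2 * n * pi \<or>
     2 * pi * x - pi * (lo + hi) = - (pi * (hi - lo)) + 2 * n * pi"
    using cos_eq by blast
  then have "pi * (2 * (x - hi - n)) = 0 \<or> pi * (2 * (x - lo - n)) = 0"
    by (simp add: algebra_simps)
  then have xn: "x - hi = n \<or> x - lo = n" by auto
  obtain m :: int where m: "n = of_int m" using n by (rule Ints_cases)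
  have "\<bar>n\<bar> < 1" using xn assms by auto
  then have "m = 0" unfolding m by linarith
  then show "x = lo \<or> x = hi" using xn m by auto
next
  assume "x = lo \<or> x = hi"
  then show "cos (2 * pi * x - pi * (lo + hi)) = cos (pi * (hi - lo))"
  proof
    assume x: "x = lo"
    have "2 * pi * x - pi * (lo + hi) = - (pi * (hi - lo))" unfolding x by (simp add: algebra_simps)
    then show ?thesis by simp
  next
    assume x: "x = hi"
    have "2 * pi * x - pi * (lo + hi) = pi * (hi - lo)" unfolding x by (simp add: algebra_simps)
    then show ?thesis by simp
  qed
qed

text \<open>The class has its midpoint at the angle \<open>pi * (lo + hi)\<close> and half-width
  \<open>pi * (hi - lo)\<close>. The distance of the point from the midpoint on the circle is
  \<open>pi * \<bar>?d\<bar>\<close> or its complement to \<open>2 * pi\<close>, and both exceed the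
  half-width.\<close>

lemma cos_outside_class:
  assumes "0 \<le> lo" "lo \<le> hi" "hi < 1" "x \<in> {0..<1}" "x < lo \<or> hi < x"
  shows "cos (2 * pi * x - pi * (lo + hi)) < cos (pi * (hi - lo))"
proof -
  let ?d = "2 * x - (lo + hi)"
  have d: "hi - lo < \<bar>?d\<bar>" "\<bar>?d\<bar> < 2 - (hi - lo)" using assms by auto
  have e: "\<bar>2 * pi * x - pi * (lo + hi)\<bar> = pi * \<bar>?d\<bar>"
  proof -
    have "2 * pi * x - pi * (lo + hi) = pi * ?d" by (simp add: algebra_simps)
    then show ?thesis by (simp add: abs_mult)
  qed
  have "cos (2 * pi * x - pi * (lo + hi)) = cos (pi * \<bar>?d\<bar>)" using e by (metis cos_abs_real)
  also have "\<dots> < cos (pi * (hi - lo))"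
  proof (cases "\<bar>?d\<bar> \<le> 1")
    case True
    then show ?thesis using d assms by (intro cos_monotone_0_pi) auto
  next
    case False
    have "cos (pi * \<bar>?d\<bar>) = cos (2 * pi - pi * \<bar>?d\<bar>)" by (simp add: cos_diff)
    also have "\<dots> = cos (pi * (2 - \<bar>?d\<bar>))" by (simp add: algebra_simps)
    also have "\<dots> < cos (pi * (hi - lo))"
    proof (rule cos_monotone_0_pi)
      show "pi * (hi - lo) < pi * (2 - \<bar>?d\<bar>)" using d by (intro mult_strict_left_mono) auto
      have "pi * (2 - \<bar>?d\<bar>) \<le> pi * 1" using False by (intro mult_left_mono) auto
      then show "pi * (2 - \<bar>?d\<bar>) \<le> pi" by simp
    qed (use assms in simp)
    finally show ?thesis .
  qed
  finally show ?thesis .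
qed

text \<open>Width and scale of one plug: the arc around the class has to avoid the points
  \<open>B\<close> of higher classes, and the scale has to put the entry abscissas exactly on the
  endpoints. For a one-point class the entry is the axis.\<close>

definition plug_data :: "real \<Rightarrow> real \<Rightarrow> real set \<Rightarrow> real \<Rightarrow> real \<Rightarrow> bool" where
  "plug_data lo hi B w q \<longleftrightarrow> arc w q \<and>
     (\<forall>x\<in>B. cos (2 * pi * x - pi * (lo + hi)) \<le> cos w) \<and>
     (\<forall>d. cos w < cos d \<and> (arc_chart w q d)\<^sup>2 = (if lo < hi then plug_entry\<^sup>2 else 0) \<longleftrightarrow>
       cos d = cos (pi * (hi - lo)))"

lemma plug_data_exists:
  assumes lh: "0 \<le> lo" "lo \<le> hi" "hi < 1"
    and B: "finite B" "\<And>x. x \<in> B \<Longrightarrow> x \<in> {0..<1} \<and> (x < lo \<or> hi < x)"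
  shows "\<exists>w q. plug_data lo hi B w q"
proof -
  let ?v = "pi * (hi - lo)"
  have "pi * (hi - lo) < pi * 1" using lh by (intro mult_strict_left_mono) auto
  then have v: "0 \<le> ?v" "?v < pi" using lh by simp_all
  have cv: "- 1 < cos ?v" using cos_monotone_0_pi[of ?v pi] v by simp
  \<comment> \<open>The largest cosine among the forbidden points; \<open>- 1\<close> covers the
    case of empty \<open>B\<close>.\<close>
  define M where "M = Max (insert (- 1) ((\<lambda>x. cos (2 * pi * x - pi * (lo + hi))) ` B))"
  have M: "- 1 \<le> M" "\<And>x. x \<in> B \<Longrightarrow> cos (2 * pi * x - pi * (lo + hi)) \<le> M" "M < cos ?v"
    using B(1) cos_outside_class[OF lh] B(2) cv by (auto simp: M_def)
  \<comment> \<open>Strictly between the forbidden cosines and that of the endpoints, so that the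
    arc with \<open>cos w = m\<close> contains the class and misses \<open>B\<close>.\<close>
  define m where "m = (M + cos ?v) / 2"
  define C where "C = cos ?v"
  have C: "- 1 < C" "M < C" "C \<le> 1" using cv M(3) by (simp_all add: C_def)
  have "m = (M + C) / 2" by (simp add: m_def C_def)
  then have "- 1 < m" "M < m" "m < C" "m < 1" using C M(1) by simp_all
  then have m: "- 1 < m" "M < m" "m < cos ?v" "m < 1" by (simp_all add: C_def)
  define w where "w = arccos m"
  have cw: "cos w = m" and w: "0 < w" "w < pi"
    using m arccos_lt_bounded[of m] by (auto simp: w_def)
  have B': "cos (2 * pi * x - pi * (lo + hi)) \<le> cos w" if "x \<in> B" for x
    using M(2)[OF that] m cw by simp
  show ?thesis
  proof (cases "lo < hi")
    case True
    define g where "g = arc_chart w 1 ?v"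
    have "0 < ?v" using True by simp
    then have g: "0 < g" using v m cw by (simp add: g_def arc_chart_def sin_gt_zero)
    \<comment> \<open>The chart with scale 1 has the value \<open>g\<close> at the endpoint and is
      linear in its scale.\<close>
    define q where "q = plug_entry / g"
    have q: "0 < q" using g plug_entry_ge_1 by (simp add: q_def)
    interpret arc w q by standard (use w q in auto)
    have cvw: "cos w < cos ?v" using m cw by simp
    have "arc_chart w q ?v = q * g" by (simp add: g_def arc_chart_def)
    then have gv: "arc_chart w q ?v = plug_entry" using g by (simp add: q_def)
    have "cos w < cos d \<and> (arc_chart w q d)\<^sup>2 = plug_entry\<^sup>2 \<longleftrightarrow> cos d = cos ?v" for d
    proof
      assume "cos w < cos d \<and> (arc_chart w q d)\<^sup>2 = plug_entry\<^sup>2"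
      then show "cos d = cos ?v" using chart_squared_inj[of d ?v] cvw gv by simp
    next
      assume e: "cos d = cos ?v"
      have "(arc_chart w q d)\<^sup>2 * (cos d - cos w)\<^sup>2 = (arc_chart w q ?v)\<^sup>2 * (cos d - cos w)\<^sup>2"
        using chart_squared[of d] chart_squared[of ?v] e cvw by simp
      then show "cos w < cos d \<and> (arc_chart w q d)\<^sup>2 = plug_entry\<^sup>2" using e cvw gv by simp
    qed
    then show ?thesis unfolding plug_data_def using B' arc_axioms True by auto
  next
    case False
    interpret arc w 1 by standard (use w in auto)
    have "cos w < cos d \<and> (arc_chart w 1 d)\<^sup>2 = 0 \<longleftrightarrow> cos d = 1" for d
      using chart_eq_0[of d] cos_W by auto
    moreover have "hi - lo = 0" using False lh by simp
    ultimately show ?thesis unfolding plug_data_def using B' arc_axioms False by (intro exI[of _ w] exI[of _ 1]) simp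
  qed
qed

text \<open>The forbidden points of plug \<open>i\<close> are those of all later classes, whose
  plugs will be higher.\<close>

definition class_enumeration :: "nat \<Rightarrow> (nat \<Rightarrow> real) \<Rightarrow> (nat \<Rightarrow> real) \<Rightarrow> (nat \<Rightarrow> real) \<Rightarrow> (nat \<Rightarrow> real) \<Rightarrow> bool" where
  "class_enumeration n lo hi w q \<longleftrightarrow>
     (\<forall>i\<in>{1..n}. 0 \<le> lo i \<and> lo i \<le> hi i \<and> hi i < 1 \<and>
        plug_data (lo i) (hi i) (\<Union>j\<in>{i<..n}. {lo j, hi j}) (w i) (q i))"

lemma marked_set_plugs:
  assumes "marked_set A E"
  obtains n lo hi w q where "class_enumeration n lo hi w q"
    "A = (\<Union>i\<in>{1..n}. {lo i, hi i})" "E = (\<Union>i\<in>{1..n}. {lo i, hi i} \<times> {lo i, hi i})"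
proof (rule marked_set_enumeration[OF assms])
  fix n and lo hi :: "nat \<Rightarrow> real"
  assume e: "\<And>i. i \<in> {1..n} \<Longrightarrow> 0 \<le> lo i \<and> lo i \<le> hi i \<and> hi i < 1"
    "\<And>i j x. \<lbrakk>1 \<le> i; i < j; j \<le> n; x \<in> {lo j, hi j}\<rbrakk> \<Longrightarrow> x < lo i \<or> hi i < x"
    "A = (\<Union>i\<in>{1..n}. {lo i, hi i})" "E = (\<Union>i\<in>{1..n}. {lo i, hi i} \<times> {lo i, hi i})"
  have "\<exists>w q. plug_data (lo i) (hi i) (\<Union>j\<in>{i<..n}. {lo j, hi j}) w q" if i: "i \<in> {1..n}" for i
  proof (rule plug_data_exists)
    fix x assume "x \<in> (\<Union>j\<in>{i<..n}. {lo j, hi j})"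
    then obtain j where j: "i < j" "j \<le> n" "x \<in> {lo j, hi j}" by auto
    have "j \<in> {1..n}" using i j by auto
    then show "x \<in> {0..<1} \<and> (x < lo i \<or> hi i < x)" using e(1)[of j] e(2)[OF _ j] i j(3) by auto
  qed (use e(1)[OF i] in auto)
  then obtain w q where "\<And>i. i \<in> {1..n} \<Longrightarrow> plug_data (lo i) (hi i) (\<Union>j\<in>{i<..n}. {lo j, hi j}) (w i) (q i)"
    by metis
  then have "class_enumeration n lo hi w q" using e(1) unfolding class_enumeration_def by blast
  then show thesis by (rule that) (fact e(3,4))+
qed

context plug_field
begin

context
  fixes n lo hi w q
  assumes enum: "class_enumeration n lo hi w q"
    and pos_K: "\<And>k. k \<in> K \<Longrightarrow> 0 < k \<Longrightarrow> nat k \<in> {1..n}" "\<And>i. i \<in> {1..n} \<Longrightarrow> int i \<in> K"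
    and par: "\<And>i. i \<in> {1..n} \<Longrightarrow> th (int i) = pi * (lo i + hi i)"
      "\<And>i. i \<in> {1..n} \<Longrightarrow> W (int i) = w i" "\<And>i. i \<in> {1..n} \<Longrightarrow> kp (int i) = q i"
      "\<And>i. i \<in> {1..n} \<Longrightarrow> sg (int i) = (if lo i < hi i then 1 else - 1)"
begin

lemma hits_class:
  assumes "i \<in> {1..n}"
  shows "hits (int i) \<theta> \<longleftrightarrow> cos (\<theta> - pi * (lo i + hi i)) = cos (pi * (hi i - lo i))"
  using enum assms pos_K(2)[OF assms] par[OF assms] unfolding hits_def class_enumeration_def plug_data_def
  by (auto split: if_splits)

lemma positive_index:
  assumes "k \<in> K" "0 < k"
  obtains i where "i \<in> {1..n}" "k = int i"
  using pos_K(1)[OF assms] assms(2) that[of "nat k"] by simp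

text \<open>Entry angles of a later plug are \<open>2 * pi * x\<close> modulo \<open>2 * pi\<close>
  for the points \<open>x\<close> of its class, and \<open>plug_data\<close> keeps these out of all
  earlier arcs.\<close>

lemma enumeration_separated: "separated"
  unfolding separated_def
proof (intro allI impI notI)
  fix k l \<theta> assume kl: "0 < k" "k < l" and hit: "hits l \<theta>" and arc: "in_arc k \<theta>"
  obtain i where i: "i \<in> {1..n}" "k = int i" using positive_index[of k] arc kl by blast
  obtain j where j: "j \<in> {1..n}" "l = int j" using positive_index[of l] hit kl unfolding hits_def by auto
  have "cos (\<theta> - pi * (lo j + hi j)) = cos (pi * (hi j - lo j))" using hit hits_class j by blast
  then obtain m where m: "m \<in> \<int>" "\<theta> - pi * (lo j + hi j) = pi * (hi j - lo j) + 2 * m * pi \<or>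
      \<theta> - pi * (lo j + hi j) = - (pi * (hi j - lo j)) + 2 * m * pi" using cos_eq by blast
  then have "\<theta> = 2 * pi * hi j + 2 * pi * m \<or> \<theta> = 2 * pi * lo j + 2 * pi * m"
    by (simp add: algebra_simps)
  then obtain x where x: "x \<in> {lo j, hi j}" "\<theta> = 2 * pi * x + 2 * pi * m" by blast
  obtain z :: int where z: "m = of_int z" using m(1) by (rule Ints_cases)
  have "\<theta> - pi * (lo i + hi i) = (2 * pi * x - pi * (lo i + hi i)) + 2 * pi * of_int z"
    unfolding x(2) z by simp
  then have "cos (\<theta> - pi * (lo i + hi i)) = cos (2 * pi * x - pi * (lo i + hi i))"
    by (simp only: cos_add cos_int_2pin sin_int_2pin)
  also have "\<dots> \<le> cos (w i)"
    using enum i(1) j x(1) kl i(2) unfolding class_enumeration_def plug_data_def by auto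
  finally show False using arc par(1,2)[OF i(1)] i(2) by simp
qed

lemma enumeration_hits:
  "{a \<in> {0..<1}. \<exists>j>0. hits j (2 * pi * a)} = (\<Union>i\<in>{1..n}. {lo i, hi i})"
  "{(a, a'). a \<in> {0..<1} \<and> a' \<in> {0..<1} \<and> (\<exists>j>0. hits j (2 * pi * a) \<and> hits j (2 * pi * a'))} =
     (\<Union>i\<in>{1..n}. {lo i, hi i} \<times> {lo i, hi i})"
proof -
  have lh: "0 \<le> lo i" "lo i \<le> hi i" "hi i < 1" if "i \<in> {1..n}" for i
    using enum that unfolding class_enumeration_def by blast+
  have iff: "hits (int i) (2 * pi * a) \<longleftrightarrow> a \<in> {lo i, hi i}" if "i \<in> {1..n}" "a \<in> {0..<1}" for i a
    using hits_class[OF that(1)] cos_class_iff[OF lh[OF that(1)] that(2)] by simp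
  have ex: "\<exists>i\<in>{1..n}. j = int i" if "hits j \<theta>" "0 < j" for j \<theta>
    using positive_index[of j] that unfolding hits_def by blast
  have unit: "x \<in> {0..<1}" if "i \<in> {1..n}" "x \<in> {lo i, hi i}" for x i
    using lh[OF that(1)] that(2) by auto
  have pos: "0 < int i" if "i \<in> {1..n}" for i using that by simp
  show "{a \<in> {0..<1}. \<exists>j>0. hits j (2 * pi * a)} = (\<Union>i\<in>{1..n}. {lo i, hi i})"
  proof (intro equalityI subsetI)
    fix a assume "a \<in> {a \<in> {0..<1}. \<exists>j>0. hits j (2 * pi * a)}"
    then obtain j where a: "a \<in> {0..<1}" "0 < j" "hits j (2 * pi * a)" by blast
    obtain i where i: "i \<in> {1..n}" "j = int i" using ex[OF a(3,2)] by blast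
    then show "a \<in> (\<Union>i\<in>{1..n}. {lo i, hi i})" using iff[OF i(1) a(1)] a(3) by blast
  next
    fix a assume "a \<in> (\<Union>i\<in>{1..n}. {lo i, hi i})"
    then obtain i where i: "i \<in> {1..n}" "a \<in> {lo i, hi i}" by blast
    note u = unit[OF i]
    have "hits (int i) (2 * pi * a)" using iff[OF i(1) u] i(2) by blast
    then show "a \<in> {a \<in> {0..<1}. \<exists>j>0. hits j (2 * pi * a)}" using u pos[OF i(1)] by blast
  qed
  show "{(a, a'). a \<in> {0..<1} \<and> a' \<in> {0..<1} \<and> (\<exists>j>0. hits j (2 * pi * a) \<and> hits j (2 * pi * a'))} =
     (\<Union>i\<in>{1..n}. {lo i, hi i} \<times> {lo i, hi i})"
  proof (intro equalityI subrelI)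
    fix a a' assume "(a, a') \<in> {(a, a'). a \<in> {0..<1} \<and> a' \<in> {0..<1} \<and> (\<exists>j>0. hits j (2 * pi * a) \<and> hits j (2 * pi * a'))}"
    then obtain j where a: "a \<in> {0..<1}" "a' \<in> {0..<1}" "0 < j" "hits j (2 * pi * a)" "hits j (2 * pi * a')" by blast
    obtain i where i: "i \<in> {1..n}" "j = int i" using ex[OF a(4,3)] by blast
    then show "(a, a') \<in> (\<Union>i\<in>{1..n}. {lo i, hi i} \<times> {lo i, hi i})"
      using iff[OF i(1) a(1)] iff[OF i(1) a(2)] a(4,5) by blast
  next
    fix a a' assume "(a, a') \<in> (\<Union>i\<in>{1..n}. {lo i, hi i} \<times> {lo i, hi i})"
    then obtain i where i: "i \<in> {1..n}" "a \<in> {lo i, hi i}" "a' \<in> {lo i, hi i}" by blast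
    note u = unit[OF i(1,2)] and u' = unit[OF i(1,3)]
    have "hits (int i) (2 * pi * a)" "hits (int i) (2 * pi * a')"
      using iff[OF i(1) u] iff[OF i(1) u'] i(2,3) by blast+
    then show "(a, a') \<in> {(a, a'). a \<in> {0..<1} \<and> a' \<in> {0..<1} \<and> (\<exists>j>0. hits j (2 * pi * a) \<and> hits j (2 * pi * a'))}"
      using u u' pos[OF i(1)] by blast
  qed
qed

end

end

theorem theorem4:
  fixes Ap Am :: "real set" and Ep Em :: "real rel"
  assumes "marked_set Ap Ep" and "marked_set Am Em"
    and "non_synchronized Ap Am"
  shows "\<exists>v. class_PC v \<and> characteristic_sets v Ap Ep Am Em"
proof -
  obtain n lo hi w q where up: "class_enumeration n lo hi w q"
    "Ap = (\<Union>i\<in>{1..n}. {lo i, hi i})" "Ep = (\<Union>i\<in>{1..n}. {lo i, hi i} \<times> {lo i, hi i})"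
    using marked_set_plugs[OF assms(1)] by blast
  obtain n' lo' hi' w' q' where down: "class_enumeration n' lo' hi' w' q'"
    "Am = (\<Union>i\<in>{1..n'}. {lo' i, hi' i})" "Em = (\<Union>i\<in>{1..n'}. {lo' i, hi' i} \<times> {lo' i, hi' i})"
    using marked_set_plugs[OF assms(2)] by blast
  \<comment> \<open>Upper classes get positive indices and lower classes negative ones, numbered
    away from the equator.\<close>
  define K where "K = int ` {1..n} \<union> (\<lambda>i. - int i) ` {1..n'}"
  define sel :: "(nat \<Rightarrow> real) \<Rightarrow> (nat \<Rightarrow> real) \<Rightarrow> int \<Rightarrow> real"
    where "sel f f' k = (if 0 < k then f (nat k) else f' (nat (- k)))" for f f' k
  define th where "th = sel (\<lambda>i. pi * (lo i + hi i)) (\<lambda>i. pi * (lo' i + hi' i))"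
  \<comment> \<open>The signs of the lower plugs are negated in advance because reversal negates
    them again.\<close>
  define sg where "sg = sel (\<lambda>i. if lo i < hi i then 1 else - 1) (\<lambda>i. - (if lo' i < hi' i then 1 else - 1))"
  have sel: "sel f f' (int i) = f i" "sel f f' (- int i) = f' i" if "1 \<le> i" for f f' i
    using that by (simp_all add: sel_def)
  have arc: "arc (sel w w' k) (sel q q' k)" if "k \<in> K" for k
    using that up(1) down(1) unfolding K_def class_enumeration_def plug_data_def by (auto simp: sel)
  have sg1: "sg k = 1 \<or> sg k = - 1" if "k \<in> K" for k
    using that unfolding K_def sg_def by (auto simp: sel split: if_splits)
  have Kpos: "nat k \<in> {1..n}" if "k \<in> K" "0 < k" for k using that unfolding K_def by auto
  have Kneg: "nat k \<in> {1..n'}" if "k \<in> uminus ` K" "0 < k" for k using that unfolding K_def by auto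
  have K: "finite K" "0 \<notin> K" unfolding K_def by auto
  interpret fw: plug_field K 1 th "sel w w'" "sel q q'" sg
    by (rule plug_field.intro[OF K _ arc sg1]) simp_all
  interpret bw: plug_field "uminus ` K" "- 1" "\<lambda>k. th (- k)" "\<lambda>k. sel w w' (- k)" "\<lambda>k. sel q q' (- k)" "\<lambda>k. - sg (- k)"
  proof (rule plug_field.intro)
    show "arc (sel w w' (- k)) (sel q q' (- k))" if "k \<in> uminus ` K" for k using that arc by auto
    show "- sg (- k) = 1 \<or> - sg (- k) = - 1" if "k \<in> uminus ` K" for k using that sg1 by fastforce
  qed (use K in auto)
  have fw_par: "th (int i) = pi * (lo i + hi i)" "sel w w' (int i) = w i" "sel q q' (int i) = q i"
    "sg (int i) = (if lo i < hi i then 1 else - 1)" "int i \<in> K" if "i \<in> {1..n}" for i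
    using that by (simp_all add: th_def sg_def sel K_def)
  have bw_par: "th (- int i) = pi * (lo' i + hi' i)" "sel w w' (- int i) = w' i" "sel q q' (- int i) = q' i"
    "- sg (- int i) = (if lo' i < hi' i then 1 else - 1)" "int i \<in> uminus ` K" if "i \<in> {1..n'}" for i
  proof -
    have "- int i \<in> K" using that by (simp add: K_def)
    then show "int i \<in> uminus ` K" by (intro image_eqI[of _ _ "- int i"]) simp_all
  qed (use that in \<open>simp_all add: th_def sg_def sel\<close>)
  note fw_enum = up(1) Kpos fw_par(5,1-4)
  note bw_enum = down(1) Kneg bw_par(5,1-4)
  interpret plug_field_pair K 1 th "sel w w'" "sel q q'" sg
  proof (rule plug_field_pair.intro, unfold_locales)
    show "fw.separated" by (rule fw.enumeration_separated[OF fw_enum])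
    show "bw.separated" by (rule bw.enumeration_separated[OF bw_enum])
  qed
  have "{a \<in> {0..<1}. \<exists>j>0. fw.hits j (2 * pi * a)} = Ap"
    unfolding up(2) by (rule fw.enumeration_hits(1)[OF fw_enum])
  moreover have "{(a, a'). a \<in> {0..<1} \<and> a' \<in> {0..<1} \<and> (\<exists>j>0. fw.hits j (2 * pi * a) \<and> fw.hits j (2 * pi * a'))} = Ep"
    unfolding up(3) by (rule fw.enumeration_hits(2)[OF fw_enum])
  moreover have "{a \<in> {0..<1}. \<exists>j>0. bw.hits j (2 * pi * a)} = Am"
    unfolding down(2) by (rule bw.enumeration_hits(1)[OF bw_enum])
  moreover have "{(a, a'). a \<in> {0..<1} \<and> a' \<in> {0..<1} \<and> (\<exists>j>0. bw.hits j (2 * pi * a) \<and> bw.hits j (2 * pi * a'))} = Em"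
    unfolding down(3) by (rule bw.enumeration_hits(2)[OF bw_enum])
  ultimately show ?thesis using characteristic_sets_vf[OF refl] by metis
qed

end
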